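(* Let $\nu$ be a positive smooth measure on $E$ and $\{\nu_n\}$ be a sequence of positive strictly smooth measures on $E$ such that $\nu_n\nearrow\nu$. Then for every $\eta\in\mathcal B^+(E)$ such that $R\eta$ is bounded, $$R^{\nu_n}\eta(x)\to\check R^\nu\eta(x)\quad\text{as } n\to\infty,\qquad x\in E.$$
   Context: Setting. $E$ is a locally compact separable metric space, $m$ a Radon measure on $E$ with full support, $A$ a non-positive self-adjoint operator on $L^2(E;m)$ generating a strongly continuous Markov semigroup of contractions $(T_t)_{t\ge0}$, and $(\mathcal E,D(\mathcal E))$ the associated symmetric Dirichlet form ($\mathcal E(u,v)=(-Au,v)$ for $u\in D(A)\subset D(\mathcal E)$, $v\in D(\mathcal E)$), assumed regular and transient. $\mathbb X=((X_t),(P_x)_{x\in E\cup\{\Delta\}},(\mathcal F_t))$ is a Hunt process with cemetery $\Delta$ and lifetime $\zeta$ such that $T_tf(x)=E_xf(X_t)$ for $m$-a.e. $x$, $f\in\mathcal B(E)\cap L^2(E;m)$ (functions are extended by $f(\Delta)=0$). $\mathcal B(E)$, $\mathcal B^+(E)$ are the Borel, resp. non-negative Borel, functions on $E$. $P_tf(x)=E_xf(X_t)$, $R_\alpha f(x)=E_x\int_0^\zeta e^{-\alpha t}f(X_t)\,dt$ for $\alpha\ge0$, $R=R_0$. Absolute continuity condition (assumed): for bounded $f\in\mathcal B^+(E)$ with $\int f\,dm=0$ one has $P_tf(x)=0$ for all $t>0$, $x\in E$. A function $f\in\mathcal B^+(E)$ is excessive if $\sup_{\alpha>0}\alpha R_\alpha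 f=f$ on $E$. $G\ge0$ (the Green function) is the Borel function on $E\times E$ with $G(x,\cdot),G(\cdot,y)$ excessive and $Rf(x)=\int_E G(x,y)f(y)\,m(dy)$ for all $x\in E$, $f\in\mathcal B^+(E)$; $R\mu(x)=\int_EG(x,y)\,\mu(dy)$ for positive Borel measures $\mu$. The fine topology is the smallest topology on $E$ making all excessive functions continuous. Capacity and smooth measures. $\mathrm{Cap}(U)=\inf\{\mathcal E(u,u):u\in D(\mathcal E),\ u\ge \mathbf 1_U\ m\text{-a.e.}\}$ for open $U$, $\mathrm{Cap}(B)=\inf\{\mathrm{Cap}(U):U\supset B\text{ open}\}$. A positive Borel measure $\nu$ is smooth if it charges no set of zero capacity and there is an increasing sequence of closed sets $F_n$ with $\nu(F_n)<\infty$ and $\mathrm{Cap}(K\setminus F_n)\to0$ for every compact $K\subset E$. It is strictly smooth if moreover there are Borel $B_n\nearrow E$ with $R(\mathbf 1_{B_n}\cdot\nu)$ bounded for each $n$. $\nu_n\nearrow\nu$ means $\nu_n(B)$ increases to $\nu(B)$ for each Borel $B$. Objects attached to $\nu$. $E_\nu$ is the set of $x\in E$ having a finely open neighborhood $V_x$ with $\int_{V_x}G(x,y)\,\nu(dy)<\infty$; $N_\nu=E\setminus E_\nu$ (a polar set). For a strictly smooth measure $\beta$, $A^\beta$ is the strict positive continuous additive functional (no exceptional set) of $\mathbb X$ with $E_x\int_0^\zeta f(X_t)\,dA^\beta_t=\int_EG(x,y)f(y)\,\beta(dy)$, $x\in E$, $f\in\mathcal B^+(E)$, and $R^\beta f(x)=E_x\int_0^\zeta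 e^{-A^\beta_t}f(X_t)\,dt$, $x\in E$. For a general positive smooth $\nu$, $A^\nu_t=\sup_nA^{\beta_n}_t$ where $\{\beta_n\}$ is a sequence of positive strictly smooth measures increasing to $\nu$; $A^\nu$ is a PCAF of $\mathbb X$ with exceptional set $N_\nu$, does not depend (a.s.) on the choice of $\{\beta_n\}$, and $P_x(A^\nu_t=\infty,\ t>0)=1$ for $x\in N_\nu$. $\check R^\nu f(x)=E_x\int_0^\zeta e^{-A^\nu_t}f(X_t)\,dt$, $x\in E$, $f\in\mathcal B^+(E)$ (so $\check R^\nu f=0$ on $N_\nu$). *)

theory Defs
  imports "HOL-Probability.Probability"
begin

section \<open>Dirichlet forms on \<open>L\<^sup>2(E;m)\<close>\<close>

text \<open>
  The state space \<open>E\<close> is the type \<open>'a\<close>. Elements of \<open>L\<^sup>2(E;m)\<close> are represented by functions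
  \<open>'a \<Rightarrow> real\<close>, identified up to equality \<open>m\<close>-almost everywhere; every notion below is
  invariant under changing representatives.
\<close>

definition radon_full_support :: "'a::topological_space measure \<Rightarrow> bool" where
  "radon_full_support m \<longleftrightarrow>
     sets m = sets borel \<and>
     (\<forall>K. compact K \<longrightarrow> emeasure m K < \<infinity>) \<and>
     (\<forall>U. open U \<longrightarrow> U \<noteq> {} \<longrightarrow> emeasure m U > 0)"

definition L2 :: "'a measure \<Rightarrow> ('a \<Rightarrow> real) set" where
  "L2 m = {u \<in> borel_measurable m. integrable m (\<lambda>x. (u x)\<^sup>2)}"

definition L2_inner :: "'a measure \<Rightarrow> ('a \<Rightarrow> real) \<Rightarrow> ('a \<Rightarrow> real) \<Rightarrow> real" where
  "L2_inner m u v = (LINT x|m. u x * v x)"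

definition L2_norm :: "'a measure \<Rightarrow> ('a \<Rightarrow> real) \<Rightarrow> real" where
  "L2_norm m u = sqrt (L2_inner m u u)"

definition L2_dense :: "'a measure \<Rightarrow> ('a \<Rightarrow> real) set \<Rightarrow> bool" where
  "L2_dense m D \<longleftrightarrow> (\<forall>f\<in>L2 m. \<forall>e>0. \<exists>u\<in>D. L2_norm m (\<lambda>x. f x - u x) < e)"

text \<open>
  Unbounded operators are given by their graph. The middle condition says that the operator
  coincides with its adjoint (domains included); linearity, and single-valuedness up to
  null sets, follow from it and density of the domain.
\<close>

definition nonpositive_self_adjoint ::
    "'a measure \<Rightarrow> (('a \<Rightarrow> real) \<times> ('a \<Rightarrow> real)) set \<Rightarrow> bool" where
  "nonpositive_self_adjoint m A \<longleftrightarrow>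
     A \<subseteq> L2 m \<times> L2 m \<and> L2_dense m (Domain A) \<and>
     (\<forall>u\<in>L2 m. \<forall>w\<in>L2 m.
        (u, w) \<in> A \<longleftrightarrow> (\<forall>(v, z)\<in>A. L2_inner m z u = L2_inner m v w)) \<and>
     (\<forall>(u, w)\<in>A. L2_inner m w u \<le> 0)"

definition markov_contraction_semigroup ::
    "'a measure \<Rightarrow> (real \<Rightarrow> ('a \<Rightarrow> real) \<Rightarrow> ('a \<Rightarrow> real)) \<Rightarrow> bool" where
  "markov_contraction_semigroup m T \<longleftrightarrow>
     (\<forall>t\<ge>0. \<forall>u\<in>L2 m. T t u \<in> L2 m) \<and>
     (\<forall>t\<ge>0. \<forall>u\<in>L2 m. \<forall>v\<in>L2 m. (AE x in m. u x = v x) \<longrightarrow> (AE x in m. T t u x = T t v x)) \<and>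
     (\<forall>t\<ge>0. \<forall>u\<in>L2 m. \<forall>v\<in>L2 m. \<forall>a b.
        AE x in m. T t (\<lambda>y. a * u y + b * v y) x = a * T t u x + b * T t v x) \<and>
     (\<forall>u\<in>L2 m. AE x in m. T 0 u x = u x) \<and>
     (\<forall>s\<ge>0. \<forall>t\<ge>0. \<forall>u\<in>L2 m. AE x in m. T (s + t) u x = T s (T t u) x) \<and>
     (\<forall>t\<ge>0. \<forall>u\<in>L2 m. L2_norm m (T t u) \<le> L2_norm m u) \<and>
     (\<forall>u\<in>L2 m. ((\<lambda>t. L2_norm m (\<lambda>x. T t u x - u x)) \<longlongrightarrow> 0) (at_right 0)) \<and>
     (\<forall>t\<ge>0. \<forall>u\<in>L2 m. (AE x in m. 0 \<le> u x \<and> u x \<le> 1) \<longrightarrow>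
        (AE x in m. 0 \<le> T t u x \<and> T t u x \<le> 1))"

definition generates ::
    "'a measure \<Rightarrow> (('a \<Rightarrow> real) \<times> ('a \<Rightarrow> real)) set \<Rightarrow>
     (real \<Rightarrow> ('a \<Rightarrow> real) \<Rightarrow> ('a \<Rightarrow> real)) \<Rightarrow> bool" where
  "generates m A T \<longleftrightarrow>
     (\<forall>u\<in>L2 m. \<forall>w\<in>L2 m. (u, w) \<in> A \<longleftrightarrow>
        ((\<lambda>t. L2_norm m (\<lambda>x. (T t u x - u x) / t - w x)) \<longlongrightarrow> 0) (at_right 0))"

text \<open>The inner product \<open>\<E>\<^sub>1(u,v) = \<E>(u,v) + (u,v)\<close> on the diagonal.\<close>

definition form_one :: "'a measure \<Rightarrow> (('a \<Rightarrow> real) \<Rightarrow> ('a \<Rightarrow> real) \<Rightarrow> real) \<Rightarrow> ('a \<Rightarrow> real) \<Rightarrow> real"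
  where "form_one m \<E> u = \<E> u u + L2_inner m u u"

text \<open>Domain \<open>D\<close>, form \<open>\<E>\<close>: densely defined, symmetric, non-negative, closed, Markovian.\<close>

definition symmetric_dirichlet_form ::
    "'a measure \<Rightarrow> ('a \<Rightarrow> real) set \<Rightarrow> (('a \<Rightarrow> real) \<Rightarrow> ('a \<Rightarrow> real) \<Rightarrow> real) \<Rightarrow> bool" where
  "symmetric_dirichlet_form m D \<E> \<longleftrightarrow>
     D \<subseteq> L2 m \<and> L2_dense m D \<and>
     (\<forall>u\<in>D. \<forall>v\<in>D. \<forall>a b. (\<lambda>x. a * u x + b * v x) \<in> D) \<and>
     (\<forall>u\<in>D. \<forall>v\<in>L2 m. (AE x in m. u x = v x) \<longrightarrow> v \<in> D \<and> (\<forall>w\<in>D. \<E> v w = \<E> u w)) \<and>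
     (\<forall>u\<in>D. \<forall>v\<in>D. \<E> u v = \<E> v u) \<and>
     (\<forall>u\<in>D. \<forall>v\<in>D. \<forall>w\<in>D. \<forall>a b. \<E> (\<lambda>x. a * u x + b * v x) w = a * \<E> u w + b * \<E> v w) \<and>
     (\<forall>u\<in>D. 0 \<le> \<E> u u) \<and>
     (\<forall>f::nat \<Rightarrow> 'a \<Rightarrow> real. (\<forall>n. f n \<in> D) \<longrightarrow>
        (\<forall>e>0. \<exists>N. \<forall>j\<ge>N. \<forall>k\<ge>N. form_one m \<E> (\<lambda>x. f j x - f k x) < e) \<longrightarrow>
        (\<exists>u\<in>D. (\<lambda>n. form_one m \<E> (\<lambda>x. f n x - u x)) \<longlonglongrightarrow> 0)) \<and>
     (\<forall>u\<in>D. (\<lambda>x. min (max (u x) 0) 1) \<in> D \<and>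
        \<E> (\<lambda>x. min (max (u x) 0) 1) (\<lambda>x. min (max (u x) 0) 1) \<le> \<E> u u)"

definition form_of_operator ::
    "'a measure \<Rightarrow> (('a \<Rightarrow> real) \<times> ('a \<Rightarrow> real)) set \<Rightarrow>
     ('a \<Rightarrow> real) set \<Rightarrow> (('a \<Rightarrow> real) \<Rightarrow> ('a \<Rightarrow> real) \<Rightarrow> real) \<Rightarrow> bool" where
  "form_of_operator m A D \<E> \<longleftrightarrow>
     Domain A \<subseteq> D \<and> (\<forall>(u, w)\<in>A. \<forall>v\<in>D. \<E> u v = L2_inner m (\<lambda>x. - w x) v)"

definition continuous_compact_support :: "('a::topological_space \<Rightarrow> real) set" where
  "continuous_compact_support =
     {u. continuous_on UNIV u \<and> (\<exists>K. compact K \<and> (\<forall>x. x \<notin> K \<longrightarrow> u x = 0))}"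

definition regular_form ::
    "'a::topological_space measure \<Rightarrow> ('a \<Rightarrow> real) set \<Rightarrow>
     (('a \<Rightarrow> real) \<Rightarrow> ('a \<Rightarrow> real) \<Rightarrow> real) \<Rightarrow> bool" where
  "regular_form m D \<E> \<longleftrightarrow>
     (\<forall>u\<in>D. \<forall>e>0. \<exists>v\<in>D \<inter> continuous_compact_support. form_one m \<E> (\<lambda>x. u x - v x) < e) \<and>
     (\<forall>f\<in>continuous_compact_support. \<forall>e>0. \<exists>v\<in>D \<inter> continuous_compact_support.
        \<forall>x. \<bar>f x - v x\<bar> < e)"

definition transient_form ::
    "'a measure \<Rightarrow> ('a \<Rightarrow> real) set \<Rightarrow> (('a \<Rightarrow> real) \<Rightarrow> ('a \<Rightarrow> real) \<Rightarrow> real) \<Rightarrow> bool" where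
  "transient_form m D \<E> \<longleftrightarrow>
     (\<exists>g. integrable m g \<and> (\<exists>c. \<forall>x. \<bar>g x\<bar> \<le> c) \<and> (AE x in m. 0 < g x) \<and>
        (\<forall>u\<in>D. (\<integral>\<^sup>+x. ennreal (\<bar>u x\<bar> * g x) \<partial>m) \<le> ennreal (sqrt (\<E> u u))))"

section \<open>Capacity and smooth measures\<close>

definition cap_open ::
    "'a measure \<Rightarrow> ('a \<Rightarrow> real) set \<Rightarrow> (('a \<Rightarrow> real) \<Rightarrow> ('a \<Rightarrow> real) \<Rightarrow> real) \<Rightarrow> 'a set \<Rightarrow> ennreal"
  where
  "cap_open m D \<E> U = (INF u\<in>{u\<in>D. AE x in m. u x \<ge> indicator U x}. ennreal (\<E> u u))"

definition cap ::
    "'a::topological_space measure \<Rightarrow> ('a \<Rightarrow> real) set \<Rightarrow>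
     (('a \<Rightarrow> real) \<Rightarrow> ('a \<Rightarrow> real) \<Rightarrow> real) \<Rightarrow> 'a set \<Rightarrow> ennreal"
  where
  "cap m D \<E> B = (INF U\<in>{U. open U \<and> B \<subseteq> U}. cap_open m D \<E> U)"

definition smooth_measure ::
    "'a::topological_space measure \<Rightarrow> ('a \<Rightarrow> real) set \<Rightarrow>
     (('a \<Rightarrow> real) \<Rightarrow> ('a \<Rightarrow> real) \<Rightarrow> real) \<Rightarrow> 'a measure \<Rightarrow> bool" where
  "smooth_measure m D \<E> \<nu> \<longleftrightarrow>
     sets \<nu> = sets borel \<and>
     (\<forall>B\<in>sets borel. cap m D \<E> B = 0 \<longrightarrow> emeasure \<nu> B = 0) \<and>
     (\<exists>F::nat \<Rightarrow> 'a set. incseq F \<and> (\<forall>n. closed (F n)) \<and> (\<forall>n. emeasure \<nu> (F n) < \<infinity>) \<and>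
        (\<forall>K. compact K \<longrightarrow> (\<lambda>n. cap m D \<E> (K - F n)) \<longlonglongrightarrow> 0))"

text \<open>\<open>R\<mu>(x)\<close>, with \<open>G\<close> the Green function.\<close>

definition potential :: "('a \<Rightarrow> 'a \<Rightarrow> ennreal) \<Rightarrow> 'a measure \<Rightarrow> 'a \<Rightarrow> ennreal" where
  "potential G \<mu> x = (\<integral>\<^sup>+y. G x y \<partial>\<mu>)"

definition strictly_smooth_measure ::
    "'a::topological_space measure \<Rightarrow> ('a \<Rightarrow> real) set \<Rightarrow>
     (('a \<Rightarrow> real) \<Rightarrow> ('a \<Rightarrow> real) \<Rightarrow> real) \<Rightarrow> ('a \<Rightarrow> 'a \<Rightarrow> ennreal) \<Rightarrow> 'a measure \<Rightarrow> bool" where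
  "strictly_smooth_measure m D \<E> G \<nu> \<longleftrightarrow>
     smooth_measure m D \<E> \<nu> \<and>
     (\<exists>B::nat \<Rightarrow> 'a set. (\<forall>n. B n \<in> sets borel) \<and> incseq B \<and> (\<Union>n. B n) = UNIV \<and>
        (\<forall>n. \<exists>c::real. \<forall>x. potential G (density \<nu> (indicator (B n))) x \<le> ennreal c))"

definition measures_increase_to :: "(nat \<Rightarrow> 'a::topological_space measure) \<Rightarrow> 'a measure \<Rightarrow> bool"
  where
  "measures_increase_to \<nu>s \<nu> \<longleftrightarrow>
     (\<forall>B\<in>sets borel. incseq (\<lambda>n. emeasure (\<nu>s n) B) \<and>
        (\<lambda>n. emeasure (\<nu>s n) B) \<longlonglongrightarrow> emeasure \<nu> B)"

section \<open>Hunt processes\<close>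

text \<open>
  The cemetery is \<open>None\<close>: \<open>E \<union> {\<Delta>}\<close> is the one-point compactification of \<open>E\<close>
  (\<open>\<Delta>\<close> is isolated if \<open>E\<close> is compact). Time runs through \<open>[0,\<infinity>]\<close>, i.e. \<open>ennreal\<close>,
  with \<open>X\<^sub>\<infinity> = \<Delta>\<close>. The sample space is the whole type \<open>'w\<close>; \<open>P x\<close> is a
  probability measure on \<open>\<sigma>(X\<^sub>s : s \<ge> 0)\<close> and \<open>\<theta>\<close> are the shift operators.
\<close>

abbreviation cemetery_topology :: "'a::topological_space option topology" where
  "cemetery_topology \<equiv> Alexandroff_compactification euclidean"

definition cemetery_borel :: "'a::topological_space option measure" where
  "cemetery_borel = sigma UNIV {U. openin cemetery_topology U}"

definition extend_zero :: "('a \<Rightarrow> 'b::zero) \<Rightarrow> 'a option \<Rightarrow> 'b" where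
  "extend_zero f z = (case z of None \<Rightarrow> 0 | Some x \<Rightarrow> f x)"

definition natural_filtration ::
    "(ennreal \<Rightarrow> 'w \<Rightarrow> 'a::topological_space option) \<Rightarrow> ennreal \<Rightarrow> 'w measure" where
  "natural_filtration X t = sigma UNIV {X s -` B | s B. s \<le> t \<and> B \<in> sets cemetery_borel}"

text \<open>
  The minimal augmented admissible filtration: \<open>\<F>\<^sub>t\<close> is the intersection, over all
  initial laws \<open>\<mu>\<close> on \<open>E \<union> {\<Delta>}\<close>, of the \<open>P\<^sub>\<mu>\<close>-augmentations of the natural filtration;
  \<open>\<mu> \<bind> P\<close> is \<open>P\<^sub>\<mu>\<close>.
\<close>

definition augmented_filtration ::
    "(ennreal \<Rightarrow> 'w \<Rightarrow> 'a::topological_space option) \<Rightarrow> ('a option \<Rightarrow> 'w measure) \<Rightarrow>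
     ennreal \<Rightarrow> 'w measure" where
  "augmented_filtration X P t = sigma UNIV
     {S. \<forall>\<mu>\<in>space (prob_algebra cemetery_borel). \<exists>S'\<in>sets (natural_filtration X t).
           (S - S') \<union> (S' - S) \<in> null_sets (completion (\<mu> \<bind> P))}"

definition lifetime :: "(ennreal \<Rightarrow> 'w \<Rightarrow> 'a option) \<Rightarrow> 'w \<Rightarrow> ennreal" where
  "lifetime X \<omega> = Inf {t. X t \<omega> = None}"

text \<open>
  In the strong Markov property the event \<open>{\<sigma> = \<infinity>}\<close> needs no separate treatment, because
  \<open>X\<^sub>\<infinity> = \<Delta>\<close> and \<open>\<Delta>\<close> is a trap.
\<close>

definition hunt_process ::
    "(ennreal \<Rightarrow> 'w \<Rightarrow> 'a::topological_space option) \<Rightarrow> ('a option \<Rightarrow> 'w measure) \<Rightarrow>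
     (ennreal \<Rightarrow> 'w \<Rightarrow> 'w) \<Rightarrow> bool" where
  "hunt_process X P \<theta> \<longleftrightarrow>
     P \<in> cemetery_borel \<rightarrow>\<^sub>M prob_algebra (natural_filtration X \<infinity>) \<and>
     (\<forall>z. AE \<omega> in P z. X 0 \<omega> = z) \<and>
     (\<forall>\<omega>. X \<infinity> \<omega> = None) \<and>
     (\<forall>\<omega> t. lifetime X \<omega> \<le> t \<longrightarrow> X t \<omega> = None) \<and>
     (\<forall>s t \<omega>. X s (\<theta> t \<omega>) = X (t + s) \<omega>) \<and>
     (\<forall>\<omega> t. t < \<infinity> \<longrightarrow> limitin cemetery_topology (\<lambda>s. X s \<omega>) (X t \<omega>) (at_right t)) \<and>
     (\<forall>\<omega> t. 0 < t \<longrightarrow> t < \<infinity> \<longrightarrow> (\<exists>l. limitin cemetery_topology (\<lambda>s. X s \<omega>) l (at_left t))) \<and>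
     (\<forall>t<\<infinity>. sets (augmented_filtration X P t) = (\<Inter>u\<in>{t<..}. sets (augmented_filtration X P u))) \<and>
     (\<forall>\<mu>\<in>space (prob_algebra cemetery_borel). \<forall>\<sigma>.
        stopping_time (augmented_filtration X P) \<sigma> \<longrightarrow>
        (\<forall>S\<in>sets (filtration.pre_sigma UNIV (augmented_filtration X P) \<sigma>).
          \<forall>s. \<forall>B\<in>sets cemetery_borel.
           emeasure (completion (\<mu> \<bind> P)) {\<omega>\<in>S. X (\<sigma> \<omega> + s) \<omega> \<in> B} =
           (\<integral>\<^sup>+\<omega>. indicator S \<omega> * emeasure (P (X (\<sigma> \<omega>) \<omega>)) (X s -` B)
              \<partial>completion (\<mu> \<bind> P)))) \<and>
     (\<forall>\<mu>\<in>space (prob_algebra cemetery_borel). \<forall>\<sigma>s::nat \<Rightarrow> 'w \<Rightarrow> ennreal.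
        (\<forall>n. stopping_time (augmented_filtration X P) (\<sigma>s n)) \<longrightarrow>
        (\<forall>\<omega>. incseq (\<lambda>n. \<sigma>s n \<omega>)) \<longrightarrow>
        (AE \<omega> in completion (\<mu> \<bind> P). (SUP n. \<sigma>s n \<omega>) < \<infinity> \<longrightarrow>
           limitin cemetery_topology (\<lambda>n. X (\<sigma>s n \<omega>) \<omega>) (X (SUP n. \<sigma>s n \<omega>) \<omega>) sequentially))"

text \<open>\<open>P\<^sub>t f\<close> and \<open>R\<^sub>\<alpha> f\<close> for Borel \<open>f : E \<rightarrow> [0,\<infinity>]\<close>.\<close>

definition transition ::
    "(ennreal \<Rightarrow> 'w \<Rightarrow> 'a option) \<Rightarrow> ('a option \<Rightarrow> 'w measure) \<Rightarrow>
     real \<Rightarrow> ('a \<Rightarrow> ennreal) \<Rightarrow> 'a \<Rightarrow> ennreal" where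
  "transition X P t f x = (\<integral>\<^sup>+\<omega>. extend_zero f (X (ennreal t) \<omega>) \<partial>P (Some x))"

definition resolvent ::
    "(ennreal \<Rightarrow> 'w \<Rightarrow> 'a option) \<Rightarrow> ('a option \<Rightarrow> 'w measure) \<Rightarrow>
     real \<Rightarrow> ('a \<Rightarrow> ennreal) \<Rightarrow> 'a \<Rightarrow> ennreal" where
  "resolvent X P \<alpha> f x =
     (\<integral>\<^sup>+\<omega>. (\<integral>\<^sup>+t\<in>{t. 0 \<le> t \<and> ennreal t < lifetime X \<omega>}.
        ennreal (exp (- \<alpha> * t)) * extend_zero f (X (ennreal t) \<omega>) \<partial>lborel) \<partial>P (Some x))"

definition excessive ::
    "(ennreal \<Rightarrow> 'w \<Rightarrow> 'a::topological_space option) \<Rightarrow> ('a option \<Rightarrow> 'w measure) \<Rightarrow>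
     ('a \<Rightarrow> ennreal) \<Rightarrow> bool" where
  "excessive X P f \<longleftrightarrow> f \<in> borel_measurable borel \<and>
     (\<forall>x. (SUP \<alpha>\<in>{0<..}. ennreal \<alpha> * resolvent X P \<alpha> f x) = f x)"

definition associated ::
    "'a::topological_space measure \<Rightarrow> (real \<Rightarrow> ('a \<Rightarrow> real) \<Rightarrow> ('a \<Rightarrow> real)) \<Rightarrow>
     (ennreal \<Rightarrow> 'w \<Rightarrow> 'a option) \<Rightarrow> ('a option \<Rightarrow> 'w measure) \<Rightarrow> bool" where
  "associated m T X P \<longleftrightarrow>
     (\<forall>t\<ge>0. \<forall>f\<in>borel_measurable borel \<inter> L2 m.
        AE x in m. T t f x = (LINT \<omega>|P (Some x). extend_zero f (X (ennreal t) \<omega>)))"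

definition absolute_continuity_condition ::
    "'a::topological_space measure \<Rightarrow> (ennreal \<Rightarrow> 'w \<Rightarrow> 'a option) \<Rightarrow>
     ('a option \<Rightarrow> 'w measure) \<Rightarrow> bool" where
  "absolute_continuity_condition m X P \<longleftrightarrow>
     (\<forall>f\<in>borel_measurable borel. (\<exists>c::real. \<forall>x. f x \<le> ennreal c) \<longrightarrow> (\<integral>\<^sup>+x. f x \<partial>m) = 0 \<longrightarrow>
        (\<forall>t>0. \<forall>x. transition X P t f x = 0))"

definition green_function ::
    "'a::topological_space measure \<Rightarrow> (ennreal \<Rightarrow> 'w \<Rightarrow> 'a option) \<Rightarrow>
     ('a option \<Rightarrow> 'w measure) \<Rightarrow> ('a \<Rightarrow> 'a \<Rightarrow> ennreal) \<Rightarrow> bool" where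
  "green_function m X P G \<longleftrightarrow>
     (\<lambda>(x, y). G x y) \<in> borel_measurable borel \<and>
     (\<forall>x. excessive X P (\<lambda>y. G x y)) \<and> (\<forall>y. excessive X P (\<lambda>x. G x y)) \<and>
     (\<forall>f\<in>borel_measurable borel. \<forall>x. resolvent X P 0 f x = (\<integral>\<^sup>+y. G x y * f y \<partial>m))"

definition dirichlet_hunt_setting ::
    "'a::{metric_space, second_countable_topology} measure \<Rightarrow>
     (('a \<Rightarrow> real) \<times> ('a \<Rightarrow> real)) set \<Rightarrow> (real \<Rightarrow> ('a \<Rightarrow> real) \<Rightarrow> ('a \<Rightarrow> real)) \<Rightarrow>
     ('a \<Rightarrow> real) set \<Rightarrow> (('a \<Rightarrow> real) \<Rightarrow> ('a \<Rightarrow> real) \<Rightarrow> real) \<Rightarrow>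
     (ennreal \<Rightarrow> 'w \<Rightarrow> 'a option) \<Rightarrow> ('a option \<Rightarrow> 'w measure) \<Rightarrow> (ennreal \<Rightarrow> 'w \<Rightarrow> 'w) \<Rightarrow>
     ('a \<Rightarrow> 'a \<Rightarrow> ennreal) \<Rightarrow> bool" where
  "dirichlet_hunt_setting m A T D \<E> X P \<theta> G \<longleftrightarrow>
     locally_compact_space (euclidean :: 'a topology) \<and> radon_full_support m \<and>
     nonpositive_self_adjoint m A \<and> markov_contraction_semigroup m T \<and> generates m A T \<and>
     symmetric_dirichlet_form m D \<E> \<and> form_of_operator m A D \<E> \<and>
     regular_form m D \<E> \<and> transient_form m D \<E> \<and>
     hunt_process X P \<theta> \<and> associated m T X P \<and> absolute_continuity_condition m X P \<and>
     green_function m X P G"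

section \<open>Additive functionals\<close>

text \<open>
  Strict (no exceptional set) positive continuous additive functionals, with defining set
  \<open>\<Lambda>\<close>. The values \<open>V t \<omega> \<in> [0,\<infinity>]\<close> matter for \<open>t < \<infinity>\<close> only and may be infinite from the
  lifetime on.
\<close>

definition strict_pcaf ::
    "(ennreal \<Rightarrow> 'w \<Rightarrow> 'a::topological_space option) \<Rightarrow> ('a option \<Rightarrow> 'w measure) \<Rightarrow>
     (ennreal \<Rightarrow> 'w \<Rightarrow> 'w) \<Rightarrow> (ennreal \<Rightarrow> 'w \<Rightarrow> ennreal) \<Rightarrow> bool" where
  "strict_pcaf X P \<theta> V \<longleftrightarrow>
     (\<forall>t<\<infinity>. V t \<in> borel_measurable (augmented_filtration X P t)) \<and>
     (\<exists>\<Lambda>\<in>sets (augmented_filtration X P \<infinity>).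
        (\<forall>x. emeasure (completion (P (Some x))) \<Lambda> = 1) \<and>
        (\<forall>t<\<infinity>. \<theta> t ` \<Lambda> \<subseteq> \<Lambda>) \<and>
        (\<forall>\<omega>\<in>\<Lambda>.
           V 0 \<omega> = 0 \<and>
           continuous_on {..<\<infinity>} (\<lambda>t. V t \<omega>) \<and>
           (\<forall>t<lifetime X \<omega>. V t \<omega> < \<infinity>) \<and>
           (\<forall>t<\<infinity>. lifetime X \<omega> \<le> t \<longrightarrow> V t \<omega> = V (lifetime X \<omega>) \<omega>) \<and>
           (\<forall>s<\<infinity>. \<forall>t<\<infinity>. V (t + s) \<omega> = V t \<omega> + V s (\<theta> t \<omega>))))"

text \<open>
  The Stieltjes integral of \<open>f(X\<^sub>t)\<close> against \<open>V\<close> over \<open>[0,\<zeta>)\<close>, as the limit for \<open>s\<close> increasing to \<open>\<zeta>\<close> of the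
  integrals over \<open>[0,s]\<close>, on which \<open>V\<close> is finite. For \<open>t < 0\<close> one has \<open>ennreal t = 0\<close>, so the
  distribution function below vanishes there.
\<close>

definition integral_wrt_af ::
    "(ennreal \<Rightarrow> 'w \<Rightarrow> 'a option) \<Rightarrow> (ennreal \<Rightarrow> 'w \<Rightarrow> ennreal) \<Rightarrow> ('a \<Rightarrow> ennreal) \<Rightarrow> 'w \<Rightarrow> ennreal"
  where
  "integral_wrt_af X V f \<omega> =
     (SUP s\<in>{s::real. 0 \<le> s \<and> ennreal s < lifetime X \<omega>}.
        \<integral>\<^sup>+t\<in>{0..s}. extend_zero f (X (ennreal t) \<omega>)
          \<partial>interval_measure (\<lambda>t. enn2real (V (ennreal (min t s)) \<omega>)))"

text \<open>\<open>V\<close> is a version of \<open>A\<^sup>\<beta>\<close>, for strictly smooth \<open>\<beta>\<close>.\<close>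

definition strict_pcaf_of ::
    "(ennreal \<Rightarrow> 'w \<Rightarrow> 'a::topological_space option) \<Rightarrow> ('a option \<Rightarrow> 'w measure) \<Rightarrow>
     (ennreal \<Rightarrow> 'w \<Rightarrow> 'w) \<Rightarrow> ('a \<Rightarrow> 'a \<Rightarrow> ennreal) \<Rightarrow> 'a measure \<Rightarrow>
     (ennreal \<Rightarrow> 'w \<Rightarrow> ennreal) \<Rightarrow> bool" where
  "strict_pcaf_of X P \<theta> G \<beta> V \<longleftrightarrow>
     strict_pcaf X P \<theta> V \<and>
     (\<forall>f\<in>borel_measurable borel. \<forall>x.
        (\<integral>\<^sup>+\<omega>. integral_wrt_af X V f \<omega> \<partial>completion (P (Some x))) = (\<integral>\<^sup>+y. G x y * f y \<partial>\<beta>))"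

text \<open>
  \<open>V\<close> is a version of \<open>A\<^sup>\<nu>\<close>, for general smooth \<open>\<nu>\<close>: the supremum of the functionals of some
  sequence of strictly smooth measures increasing to \<open>\<nu>\<close>.
\<close>

definition pcaf_of_smooth ::
    "'a::topological_space measure \<Rightarrow> ('a \<Rightarrow> real) set \<Rightarrow>
     (('a \<Rightarrow> real) \<Rightarrow> ('a \<Rightarrow> real) \<Rightarrow> real) \<Rightarrow>
     (ennreal \<Rightarrow> 'w \<Rightarrow> 'a option) \<Rightarrow> ('a option \<Rightarrow> 'w measure) \<Rightarrow>
     (ennreal \<Rightarrow> 'w \<Rightarrow> 'w) \<Rightarrow> ('a \<Rightarrow> 'a \<Rightarrow> ennreal) \<Rightarrow> 'a measure \<Rightarrow>
     (ennreal \<Rightarrow> 'w \<Rightarrow> ennreal) \<Rightarrow> bool" where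
  "pcaf_of_smooth m D \<E> X P \<theta> G \<nu> V \<longleftrightarrow>
     (\<exists>\<beta>s Vs. (\<forall>n::nat. strictly_smooth_measure m D \<E> G (\<beta>s n)) \<and>
        measures_increase_to \<beta>s \<nu> \<and>
        (\<forall>n. strict_pcaf_of X P \<theta> G (\<beta>s n) (Vs n)) \<and>
        (\<forall>t \<omega>. V t \<omega> = (SUP n. Vs n t \<omega>)))"

definition exp_neg :: "ennreal \<Rightarrow> ennreal" where
  "exp_neg a = (if a = \<infinity> then 0 else ennreal (exp (- enn2real a)))"

text \<open>
  \<open>E\<^sub>x \<integral>\<^sub>0\<^sup>\<zeta> exp(-V\<^sub>t) f(X\<^sub>t) dt\<close>. This is \<open>R\<^sup>\<beta> f\<close> for \<open>V\<close> a version of \<open>A\<^sup>\<beta>\<close> (\<open>\<beta>\<close> strictly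
  smooth), and the checked \<open>R\<^sup>\<nu> f\<close> for \<open>V\<close> a version of \<open>A\<^sup>\<nu>\<close> (\<open>\<nu>\<close> smooth). The completion
  is needed because \<open>V\<close> is adapted to the augmented filtration only.
\<close>

definition killed_resolvent ::
    "(ennreal \<Rightarrow> 'w \<Rightarrow> 'a option) \<Rightarrow> ('a option \<Rightarrow> 'w measure) \<Rightarrow>
     (ennreal \<Rightarrow> 'w \<Rightarrow> ennreal) \<Rightarrow> ('a \<Rightarrow> ennreal) \<Rightarrow> 'a \<Rightarrow> ennreal" where
  "killed_resolvent X P V f x =
     (\<integral>\<^sup>+\<omega>. (\<integral>\<^sup>+t\<in>{t. 0 \<le> t \<and> ennreal t < lifetime X \<omega>}.
        exp_neg (V (ennreal t) \<omega>) * extend_zero f (X (ennreal t) \<omega>) \<partial>lborel)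
      \<partial>completion (P (Some x)))"

end

theory Submission
  imports Defs
begin

text \<open>
  Write \<open>A(\<beta>)\<close> for the functional of \<open>\<beta>\<close>. It is determined by its potentials: if \<open>f \<beta> = h \<gamma>\<close> has
  bounded potential, then \<open>\<integral>f(X) dA(\<beta>)\<close> and \<open>\<integral>h(X) dA(\<gamma>)\<close> differ by a continuous martingale of
  bounded variation, which vanishes because its second moment is the limit of the expected sums of
  its squared increments. If \<open>\<beta> \<le> \<nu>\<close> and \<open>\<gamma>\<^sub>n\<close> increases to \<open>\<nu>\<close>, let \<open>b\<close>, \<open>c\<^sub>n\<close> be the densities
  with respect to \<open>\<nu>\<close> and choose \<open>f\<^sub>n b = h\<^sub>n c\<^sub>n = min b c\<^sub>n\<close>; this gives \<open>A(\<beta>) \<le> sup\<^sub>n A(\<gamma>\<^sub>n)\<close>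
  up to the lifetime. Hence \<open>A(\<nu>\<^sub>n)\<close> increases to \<open>A(\<nu>)\<close> whatever sequence was used to define
  \<open>A(\<nu>)\<close>, and dominated convergence applies, the dominating variable \<open>\<integral>\<eta>(X\<^sub>t) dt\<close> having
  expectation \<open>R\<eta>(x) < \<infinity>\<close>.
\<close>

section \<open>The Hunt process and its filtrations\<close>

text \<open>Two obstacles shape the argument. Values lie in \<open>[0,\<infinity>]\<close>, where
  differences are unreliable, so the martingale is never formed: sums of increments of one process
  times the remaining increment of the other are compared instead, and the Markov property shows
  that such a sum sees the second process only through its expectations. Moreover, a functional is
  adapted only to the augmented filtration, while the strong Markov property is given for events at
  a single later time; it has to be carried to whole paths and then to the completions for all
  initial laws.

  Bounded potentials are available only on the nest of a strictly smooth measure. Truncating both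
  densities to their minimum lets a comparison borrow the nest of one side: the common measure is at
  most the dominating one, so its nest bounds both potentials. The same comparison, with a constant
  sequence in place of the increasing one, yields monotonicity of the functionals in the
  measure.\<close>

locale hunt =
  fixes X :: "ennreal \<Rightarrow> 'w \<Rightarrow> 'a::{metric_space, second_countable_topology} option"
    and P :: "'a option \<Rightarrow> 'w measure"
    and \<theta> :: "ennreal \<Rightarrow> 'w \<Rightarrow> 'w"
  assumes hunt: "hunt_process X P \<theta>"
    and locally_compact: "locally_compact_space (euclidean :: 'a topology)"
begin

abbreviation N where "N \<equiv> natural_filtration X"
abbreviation F where "F \<equiv> augmented_filtration X P"
abbreviation Q where "Q z \<equiv> completion (P z)"

lemma space_N [simp]: "space (N t) = UNIV"
  unfolding natural_filtration_def by (simp add: space_measure_of_conv)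

lemma space_F [simp]: "space (F t) = UNIV"
  unfolding augmented_filtration_def by (simp add: space_measure_of_conv)

lemma space_cemetery_borel [simp]: "space cemetery_borel = UNIV"
  unfolding cemetery_borel_def by (simp add: space_measure_of_conv)

lemma sets_N: "sets (N t) = sigma_sets UNIV {X s -` B | s B. s \<le> t \<and> B \<in> sets cemetery_borel}"
  unfolding natural_filtration_def by (simp add: sets_measure_of_conv)

lemma P_kernel: "P \<in> cemetery_borel \<rightarrow>\<^sub>M prob_algebra (N \<infinity>)"
  and X_start: "AE \<omega> in P z. X 0 \<omega> = z"
  and X_infinity: "X \<infinity> \<omega> = None"
  and X_dead: "lifetime X \<omega> \<le> t \<Longrightarrow> X t \<omega> = None"
  and X_shift: "X s (\<theta> t \<omega>) = X (t + s) \<omega>"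
  and X_right_limit: "t < \<infinity> \<Longrightarrow> limitin cemetery_topology (\<lambda>s. X s \<omega>) (X t \<omega>) (at_right t)"
  using hunt unfolding hunt_process_def by auto

lemma sets_P [simp]: "sets (P z) = sets (N \<infinity>)" and prob_P: "prob_space (P z)"
  using measurable_space[OF P_kernel, of z] by (auto simp: space_prob_algebra)

lemma space_P [simp]: "space (P z) = UNIV"
  using sets_eq_imp_space_eq[OF sets_P] by simp

lemma P_subprob: "P \<in> cemetery_borel \<rightarrow>\<^sub>M subprob_algebra (N \<infinity>)"
  by (rule measurable_prob_algebraD[OF P_kernel])

lemma prob_Q: "prob_space (Q z)"
  by (rule prob_space.prob_space_completion[OF prob_P])

lemma emeasure_Q_UNIV [simp]: "emeasure (Q z) UNIV = 1"
  using prob_space.emeasure_space_1[OF prob_Q[of z]] by simp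

lemma alive_iff: "X t \<omega> \<noteq> None \<longleftrightarrow> t < lifetime X \<omega>"
proof
  show "t < lifetime X \<omega>" if "X t \<omega> \<noteq> None"
    using that X_dead by (meson not_le)
  show "X t \<omega> \<noteq> None" if "t < lifetime X \<omega>"
    using that unfolding lifetime_def by (metis (mono_tags) Inf_lower mem_Collect_eq not_le)
qed

lemma dead_mono: "X s \<omega> = None \<Longrightarrow> s \<le> t \<Longrightarrow> X t \<omega> = None"
  using alive_iff by (metis order_le_less_trans)

text \<open>Point masses as initial laws turn the statements about \<open>\<mu> \<bind> P\<close> in
  the definitions of a Hunt process and of the augmentation into statements about
  \<open>P z\<close>.\<close>

lemma return_bind_P: "return cemetery_borel z \<bind> P = P z"
  by (rule bind_return[OF P_subprob]) simp

lemma return_prob: "return cemetery_borel z \<in> space (prob_algebra cemetery_borel)"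
  by (simp add: space_prob_algebra prob_space_return)

lemma X_measurable: "s \<le> t \<Longrightarrow> X s \<in> N t \<rightarrow>\<^sub>M cemetery_borel"
  by (rule measurableI) (auto simp: sets_N intro!: sigma_sets.Basic)

lemma N_mono: "s \<le> t \<Longrightarrow> sets (N s) \<subseteq> sets (N t)"
  unfolding sets_N by (rule sigma_sets_mono') (auto intro: order_trans)

lemma shift_measurable: "\<theta> t \<in> N \<infinity> \<rightarrow>\<^sub>M N \<infinity>"
proof (rule measurableI)
  fix S assume "S \<in> sets (N \<infinity>)"
  then have "\<theta> t -` S \<in> sigma_sets UNIV {X s -` B | s B. s \<le> \<infinity> \<and> B \<in> sets cemetery_borel}"
    unfolding sets_N
  proof induction
    case (Basic S)
    then obtain s B where S: "S = X s -` B" "B \<in> sets cemetery_borel" by auto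
    have "\<theta> t -` S = X (t + s) -` B" by (auto simp: S X_shift)
    then show ?case using S by (intro sigma_sets.Basic) auto
  next
    case (Compl S)
    have "\<theta> t -` (UNIV - S) = UNIV - \<theta> t -` S" by auto
    show ?case unfolding \<open>\<theta> t -` (UNIV - S) = UNIV - \<theta> t -` S\<close> by (rule sigma_sets.Compl) fact
  next
    case (Union S)
    have "\<theta> t -` (\<Union>(range S)) = (\<Union>i. \<theta> t -` S i)" by auto
    show ?case unfolding \<open>\<theta> t -` (\<Union>(range S)) = (\<Union>i. \<theta> t -` S i)\<close>
      by (rule sigma_sets.Union) fact
  qed (auto intro: sigma_sets.Empty)
  then show "\<theta> t -` S \<inter> space (N \<infinity>) \<in> sets (N \<infinity>)" by (simp add: sets_N)
qed auto

section \<open>Augmentation by the null sets of all initial laws\<close>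

lemma bind_P:
  assumes "\<mu> \<in> space (prob_algebra cemetery_borel)"
  shows "sets (\<mu> \<bind> P) = sets (N \<infinity>)" "space (\<mu> \<bind> P) = UNIV" "prob_space (\<mu> \<bind> P)"
  using sets_bind'[OF assms P_kernel] prob_space_bind'[OF assms P_kernel]
  by (auto dest: sets_eq_imp_space_eq)

text \<open>For a fixed initial law, the sets with an approximant in \<open>N t\<close> are closed
  under complements and countable unions, so passing from the generating family to the generated
  sigma-algebra adds no set without an approximant.\<close>

lemma augmented_sets:
  assumes \<mu>: "\<mu> \<in> space (prob_algebra cemetery_borel)" and S: "S \<in> sets (F t)"
  shows "\<exists>S'\<in>sets (N t). (S - S') \<union> (S' - S) \<in> null_sets (completion (\<mu> \<bind> P))"
proof -
  let ?n = "null_sets (completion (\<mu> \<bind> P))"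
  have "S \<in> sigma_sets UNIV {S. \<forall>\<mu>\<in>space (prob_algebra cemetery_borel). \<exists>S'\<in>sets (N t).
           (S - S') \<union> (S' - S) \<in> null_sets (completion (\<mu> \<bind> P))}"
    using S unfolding augmented_filtration_def by (simp add: sets_measure_of_conv)
  then show ?thesis
  proof induction
    case (Basic S)
    then show ?case using \<mu> by auto
  next
    case Empty
    show ?case by (rule bexI[of _ "{}"]) auto
  next
    case (Compl S)
    then obtain S' where S': "S' \<in> sets (N t)" "(S - S') \<union> (S' - S) \<in> ?n" by auto
    have "UNIV - S - (UNIV - S') \<union> (UNIV - S' - (UNIV - S)) = (S - S') \<union> (S' - S)" by auto
    moreover have "UNIV - S' \<in> sets (N t)" using sets.compl_sets[OF S'(1)] by simp
    ultimately show ?case using S' by metis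
  next
    case (Union S)
    then obtain S' where S': "\<And>i. S' i \<in> sets (N t)" "\<And>i. (S i - S' i) \<union> (S' i - S i) \<in> ?n"
      by metis
    have "(\<Union>i. (S i - S' i) \<union> (S' i - S i)) \<in> ?n"
      using S'(2) by (intro null_sets_UN) auto
    then have "(\<Union>(range S) - \<Union>(range S')) \<union> (\<Union>(range S') - \<Union>(range S)) \<in> ?n"
      by (rule null_sets_completion_subset[rotated]) auto
    then show ?case using S' by (intro bexI[of _ "\<Union>(range S')"]) auto
  qed
qed

lemma augmented_setsI:
  assumes "\<And>\<mu>. \<mu> \<in> space (prob_algebra cemetery_borel) \<Longrightarrow>
    \<exists>S'\<in>sets (N t). (S - S') \<union> (S' - S) \<in> null_sets (completion (\<mu> \<bind> P))"
  shows "S \<in> sets (F t)"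
  using assms unfolding augmented_filtration_def
  by (auto simp: sets_measure_of_conv intro!: sigma_sets.Basic)

lemma N_le_F: "sets (N t) \<subseteq> sets (F t)"
proof
  fix S assume "S \<in> sets (N t)"
  then show "S \<in> sets (F t)" by (intro augmented_setsI bexI[of _ S]) auto
qed

lemma F_mono: "s \<le> t \<Longrightarrow> sets (F s) \<subseteq> sets (F t)"
proof
  fix S assume "s \<le> t" "S \<in> sets (F s)"
  then show "S \<in> sets (F t)"
    using augmented_sets[of _ S s] N_mono[of s t] by (intro augmented_setsI) blast
qed

lemma F_le_completion:
  assumes \<mu>: "\<mu> \<in> space (prob_algebra cemetery_borel)"
  shows "sets (F t) \<subseteq> sets (completion (\<mu> \<bind> P))"
proof
  fix S assume "S \<in> sets (F t)"
  then obtain S' where S': "S' \<in> sets (N t)" "(S - S') \<union> (S' - S) \<in> null_sets (completion (\<mu> \<bind> P))"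
    using augmented_sets[OF \<mu>] by blast
  have "S' \<in> sets (completion (\<mu> \<bind> P))"
    using S'(1) N_mono[of t \<infinity>] bind_P[OF \<mu>] by auto
  moreover have "S - S' \<in> sets (completion (\<mu> \<bind> P))" "S' - S \<in> sets (completion (\<mu> \<bind> P))"
    using null_sets_completion_subset[OF _ S'(2)] by blast+
  moreover have "S = (S' - (S' - S)) \<union> (S - S')" by auto
  ultimately show "S \<in> sets (completion (\<mu> \<bind> P))" by (metis sets.Diff sets.Un)
qed

lemma F_le_Q: "sets (F t) \<subseteq> sets (Q z)"
  using F_le_completion[OF return_prob[of z], of t] by (simp add: return_bind_P)

lemma measurable_FQ: "f \<in> F t \<rightarrow>\<^sub>M M \<Longrightarrow> f \<in> Q z \<rightarrow>\<^sub>M M"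
  using measurable_mono[of M M "F t" "Q z"] F_le_Q by auto

lemma measurable_F_mono: "f \<in> F s \<rightarrow>\<^sub>M M \<Longrightarrow> s \<le> t \<Longrightarrow> f \<in> F t \<rightarrow>\<^sub>M M"
  using measurable_mono[of M M "F s" "F t"] F_mono[of s t] by auto

lemma measurable_NF: "f \<in> N s \<rightarrow>\<^sub>M M \<Longrightarrow> s \<le> t \<Longrightarrow> f \<in> F t \<rightarrow>\<^sub>M M"
  using measurable_mono[of M M "N s" "F t"] F_mono[of s t] N_le_F[of s] by auto

text \<open>A null event is covered by a null set of \<open>N \<infinity>\<close>, whose mass under
  \<open>P z\<close> is measurable in \<open>z\<close> and integrates to zero against
  \<open>\<mu>\<close>.\<close>

lemma AE_bind_P:
  assumes \<mu>: "\<mu> \<in> space (prob_algebra cemetery_borel)"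
    and ae: "AE \<omega> in \<mu> \<bind> P. R \<omega>"
  shows "AE z in \<mu>. AE \<omega> in P z. R \<omega>"
proof -
  obtain Z where Z: "Z \<in> sets (\<mu> \<bind> P)" "emeasure (\<mu> \<bind> P) Z = 0" "{\<omega>. \<not> R \<omega>} \<subseteq> Z"
    using ae bind_P[OF \<mu>] by (auto elim!: AE_E)
  have ZN: "Z \<in> sets (N \<infinity>)" using Z bind_P[OF \<mu>] by auto
  have sm: "sets \<mu> = sets cemetery_borel" using \<mu> by (simp add: space_prob_algebra)
  have m: "(\<lambda>z. emeasure (P z) Z) \<in> borel_measurable \<mu>"
    using measurable_emeasure_kernel[OF P_subprob ZN] by (simp add: measurable_cong_sets[OF sm])
  have "(\<integral>\<^sup>+z. emeasure (P z) Z \<partial>\<mu>) = 0"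
    using emeasure_bind_prob_algebra[OF \<mu> P_kernel ZN] Z by simp
  then have "AE z in \<mu>. emeasure (P z) Z = 0"
    using nn_integral_0_iff_AE[OF m] by simp
  then show ?thesis
  proof eventually_elim
    case (elim z)
    then have "Z \<in> null_sets (P z)" using ZN by (auto simp: null_sets_def)
    then show ?case by (rule AE_I') (use Z in auto)
  qed
qed

text \<open>An event that is null from every starting point is null for every initial law, so the
  empty set approximates it at any time. Its mass cannot be integrated over the starting point
  directly, since it need not lie in \<open>N \<infinity>\<close>; the approximant \<open>S'\<close>
  takes its place.\<close>

lemma null_in_F:
  assumes S: "S \<in> sets (F \<infinity>)" and null: "\<And>z. S \<in> null_sets (Q z)"
  shows "S \<in> sets (F t)"
proof (rule augmented_setsI)
  fix \<mu> :: "'a option measure" assume \<mu>: "\<mu> \<in> space (prob_algebra cemetery_borel)"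
  obtain S' where S': "S' \<in> sets (N \<infinity>)" "(S - S') \<union> (S' - S) \<in> null_sets (completion (\<mu> \<bind> P))"
    using augmented_sets[OF \<mu> S] by blast
  have "AE \<omega> in \<mu> \<bind> P. \<omega> \<notin> (S - S') \<union> (S' - S)"
    using AE_not_in[OF S'(2)] by (simp add: AE_completion_iff)
  then have "AE \<omega> in \<mu> \<bind> P. \<omega> \<in> S \<longleftrightarrow> \<omega> \<in> S'" by eventually_elim auto
  then have ae: "AE z in \<mu>. AE \<omega> in P z. \<omega> \<in> S \<longleftrightarrow> \<omega> \<in> S'" by (rule AE_bind_P[OF \<mu>])
  have nS: "AE \<omega> in P z. \<omega> \<notin> S" for z
    using AE_not_in[OF null[of z]] by (simp add: AE_completion_iff)
  from ae have "AE z in \<mu>. emeasure (P z) S' = 0"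
  proof eventually_elim
    case (elim z)
    from elim nS[of z] have "AE \<omega> in P z. \<omega> \<notin> S'" by eventually_elim auto
    then have "S' \<in> null_sets (P z)" using S'(1) AE_iff_null_sets[of S' "P z"] by simp
    then show ?case by auto
  qed
  moreover have "(\<lambda>z. emeasure (P z) S') \<in> borel_measurable \<mu>"
    using measurable_emeasure_kernel[OF P_subprob S'(1)] \<mu>
    by (simp add: space_prob_algebra cong: measurable_cong_sets)
  ultimately have "(\<integral>\<^sup>+z. emeasure (P z) S' \<partial>\<mu>) = 0" by (simp add: nn_integral_0_iff_AE)
  then have "S' \<in> null_sets (\<mu> \<bind> P)"
    using emeasure_bind_prob_algebra[OF \<mu> P_kernel S'(1)] S'(1) bind_P[OF \<mu>] by (auto simp: null_sets_def)
  then have "S' \<union> ((S - S') \<union> (S' - S)) \<in> null_sets (completion (\<mu> \<bind> P))"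
    using S'(2) null_sets_completionI[of S' "\<mu> \<bind> P"] by (metis null_sets.Un)
  then have "S \<in> null_sets (completion (\<mu> \<bind> P))"
    by (rule null_sets_completion_subset[rotated]) auto
  then show "\<exists>S'\<in>sets (N t). (S - S') \<union> (S' - S) \<in> null_sets (completion (\<mu> \<bind> P))"
    by (intro bexI[of _ "{}"]) auto
qed

section \<open>The Markov property\<close>

lemma X_measurable_F: "s \<le> t \<Longrightarrow> X s \<in> F t \<rightarrow>\<^sub>M cemetery_borel"
  using measurable_NF[OF X_measurable[OF order_refl]] by blast

lemma P_X_kernel: "(\<lambda>\<omega>. P (X t \<omega>)) \<in> F t \<rightarrow>\<^sub>M subprob_algebra (N \<infinity>)"
  by (rule measurable_compose[OF X_measurable_F[OF order_refl] P_subprob])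

lemma filtration_F: "filtration UNIV F"
  by standard (auto dest: F_mono)

text \<open>Constant times are stopping times, and every event of \<open>F t\<close> belongs to the
  past of the constant time \<open>t\<close>.\<close>

lemma markov_one_time:
  assumes S: "S \<in> sets (F t)" and B: "B \<in> sets cemetery_borel"
  shows "emeasure (Q z) (S \<inter> X (t + s) -` B) =
    (\<integral>\<^sup>+\<omega>. indicator S \<omega> * emeasure (P (X t \<omega>)) (X s -` B) \<partial>Q z)"
proof -
  have "S \<in> sets (filtration.pre_sigma UNIV F (\<lambda>_. t))"
  proof (rule filtration.sets_pre_sigmaI[OF filtration_F stopping_time_const])
    fix u show "{\<omega> \<in> S. t \<le> u} \<in> sets (F u)"
      using S F_mono[of t u] by (cases "t \<le> u") auto
  qed
  then have "emeasure (completion (return cemetery_borel z \<bind> P)) {\<omega>\<in>S. X (t + s) \<omega> \<in> B} =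
     (\<integral>\<^sup>+\<omega>. indicator S \<omega> * emeasure (P (X t \<omega>)) (X s -` B)
        \<partial>completion (return cemetery_borel z \<bind> P))"
    using hunt return_prob[of z] B stopping_time_const[of F t]
    unfolding hunt_process_def by blast
  then show ?thesis by (simp only: return_bind_P vimage_def Int_def mem_Collect_eq)
qed

text \<open>Both sides integrate \<open>g\<close> against a measure on the state space: the law of
  \<open>X (t + s)\<close> on \<open>S\<close>, and the mixture of the laws of \<open>X s\<close>
  under \<open>P (X t \<omega>)\<close>. These measures agree set by set.\<close>

lemma nn_integral_X_eq:
  assumes S: "S \<in> sets (F t)" and g: "g \<in> borel_measurable cemetery_borel"
  shows "(\<integral>\<^sup>+\<omega>. indicator S \<omega> * g (X (t + s) \<omega>) \<partial>Q z) =
    (\<integral>\<^sup>+\<omega>. indicator S \<omega> * (\<integral>\<^sup>+\<omega>'. g (X s \<omega>') \<partial>P (X t \<omega>)) \<partial>Q z)"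
proof -
  let ?D = "density (Q z) (indicator S)"
  let ?K = "\<lambda>\<omega>. distr (P (X t \<omega>)) cemetery_borel (X s)"
  have SQ: "S \<in> sets (Q z)" using S F_le_Q by blast
  have Xs: "X s \<in> N \<infinity> \<rightarrow>\<^sub>M cemetery_borel" by (rule X_measurable) simp
  have XQ: "X u \<in> Q z \<rightarrow>\<^sub>M cemetery_borel" for u
    by (rule measurable_FQ[OF X_measurable_F[OF order_refl]])
  have PQ: "(\<lambda>\<omega>. P (X t \<omega>)) \<in> Q z \<rightarrow>\<^sub>M subprob_algebra (N \<infinity>)"
    by (rule measurable_FQ[OF P_X_kernel])
  have K: "?K \<in> Q z \<rightarrow>\<^sub>M subprob_algebra cemetery_borel"
    by (rule measurable_compose[OF PQ measurable_distr[OF Xs]])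
  have K': "?K \<in> ?D \<rightarrow>\<^sub>M subprob_algebra cemetery_borel" using K by simp
  have eq: "distr ?D cemetery_borel (X (t + s)) = ?D \<bind> ?K"
  proof (rule measure_eqI)
    show "sets (distr ?D cemetery_borel (X (t + s))) = sets (?D \<bind> ?K)"
      using sets_bind_measurable[OF K'] by simp
    fix B assume "B \<in> sets (distr ?D cemetery_borel (X (t + s)))"
    then have B: "B \<in> sets cemetery_borel" by simp
    have m: "X u -` B \<in> sets (Q z)" for u using measurable_sets[OF XQ B] by simp
    have "emeasure (distr ?D cemetery_borel (X (t + s))) B = emeasure ?D (X (t + s) -` B)"
      using XQ B by (subst emeasure_distr) auto
    also have "\<dots> = emeasure (Q z) (S \<inter> X (t + s) -` B)"
      using SQ m by (simp add: emeasure_restricted del: emeasure_completion)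
    also have "\<dots> = (\<integral>\<^sup>+\<omega>. indicator S \<omega> * emeasure (P (X t \<omega>)) (X s -` B) \<partial>Q z)"
      by (rule markov_one_time[OF S B])
    also have "\<dots> = (\<integral>\<^sup>+\<omega>. indicator S \<omega> * emeasure (?K \<omega>) B \<partial>Q z)"
      using Xs B by (simp add: emeasure_distr measurable_cong_sets[OF sets_P refl])
    also have "\<dots> = (\<integral>\<^sup>+\<omega>. emeasure (?K \<omega>) B \<partial>?D)"
      using SQ measurable_emeasure_kernel[OF K B] by (subst nn_integral_density) auto
    also have "\<dots> = emeasure (?D \<bind> ?K) B"
      using emeasure_bind[OF _ K' B] by simp
    finally show "emeasure (distr ?D cemetery_borel (X (t + s))) B = emeasure (?D \<bind> ?K) B" .
  qed
  have "(\<integral>\<^sup>+\<omega>. indicator S \<omega> * g (X (t + s) \<omega>) \<partial>Q z) = (\<integral>\<^sup>+\<omega>. g (X (t + s) \<omega>) \<partial>?D)"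
    using SQ XQ g by (subst nn_integral_density) (auto intro: measurable_compose)
  also have "\<dots> = (\<integral>\<^sup>+y. g y \<partial>distr ?D cemetery_borel (X (t + s)))"
    using XQ g by (subst nn_integral_distr) auto
  also have "\<dots> = (\<integral>\<^sup>+\<omega>. (\<integral>\<^sup>+y. g y \<partial>?K \<omega>) \<partial>?D)"
    unfolding eq by (rule nn_integral_bind[OF g K'])
  also have "\<dots> = (\<integral>\<^sup>+\<omega>. indicator S \<omega> * (\<integral>\<^sup>+y. g y \<partial>?K \<omega>) \<partial>Q z)"
    using SQ by (subst nn_integral_density)
      (auto intro!: measurable_compose[OF K] nn_integral_measurable_subprob_algebra g)
  also have "\<dots> = (\<integral>\<^sup>+\<omega>. indicator S \<omega> * (\<integral>\<^sup>+\<omega>'. g (X s \<omega>') \<partial>P (X t \<omega>)) \<partial>Q z)"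
    using Xs g by (simp add: nn_integral_distr measurable_cong_sets[OF sets_P refl])
  finally show ?thesis .
qed

text \<open>Times are stored as increments, so that a shift only moves the starting time and an
  induction over the list can apply the Markov property at the first observation.\<close>

primrec cylinder :: "ennreal \<Rightarrow> (ennreal \<times> 'a option set) list \<Rightarrow> 'w set" where
  "cylinder t [] = UNIV"
| "cylinder t (p # l) = X (t + fst p) -` snd p \<inter> cylinder (t + fst p) l"

lemma cylinder_sets:
  "snd ` set l \<subseteq> sets cemetery_borel \<Longrightarrow> cylinder t l \<in> sets (N \<infinity>)"
proof (induction l arbitrary: t)
  case Nil
  then show ?case using sets.top[of "N \<infinity>"] by simp
next
  case (Cons p l)
  have "X (t + fst p) -` snd p \<in> sets (N \<infinity>)"
    using measurable_sets[OF X_measurable[of _ \<infinity>]] Cons.prems by auto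
  then show ?case using Cons by auto
qed

lemma cylinder_shift: "\<theta> t -` cylinder s l = cylinder (t + s) l"
  by (induction l arbitrary: s) (auto simp: X_shift add.assoc vimage_def)

text \<open>The induction hypothesis is used twice: at time \<open>t + s\<close>, with the first
  observation absorbed into the event, and from each state \<open>y\<close> at time
  \<open>s\<close>, to recognise the resulting function of \<open>X t\<close>.\<close>

lemma markov_cylinder:
  assumes "snd ` set l \<subseteq> sets cemetery_borel" "S \<in> sets (F t)"
  shows "emeasure (Q z) (S \<inter> cylinder t l) =
    (\<integral>\<^sup>+\<omega>. indicator S \<omega> * emeasure (P (X t \<omega>)) (cylinder 0 l) \<partial>Q z)"
  using assms
proof (induction l arbitrary: t S z)
  case Nil
  have "emeasure (P y) UNIV = 1" for y using prob_space.emeasure_space_1[OF prob_P[of y]] by simp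
  moreover have "S \<in> sets (Q z)" using Nil F_le_Q by blast
  ultimately show ?case by (simp del: emeasure_completion)
next
  case (Cons p l)
  obtain s B where p: "p = (s, B)" by force
  have B: "B \<in> sets cemetery_borel" and l: "snd ` set l \<subseteq> sets cemetery_borel"
    using Cons.prems p by auto
  \<comment> \<open>The probability, seen from the state at the first observation, that this and all
    later observations succeed.\<close>
  let ?g = "\<lambda>y. indicator B y * emeasure (P y) (cylinder 0 l)"
  have g: "?g \<in> borel_measurable cemetery_borel"
    using measurable_emeasure_kernel[OF P_subprob cylinder_sets[OF l]] B by auto
  have XB: "X u -` B \<in> sets (F u)" for u
    using measurable_sets[OF X_measurable_F[OF order_refl] B] by simp
  have first: "(\<integral>\<^sup>+\<omega>'. ?g (X s \<omega>') \<partial>P y) = emeasure (P y) (cylinder 0 (p # l))" for y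
  proof -
    have "(\<integral>\<^sup>+\<omega>'. ?g (X s \<omega>') \<partial>P y) =
      (\<integral>\<^sup>+\<omega>'. indicator (X s -` B) \<omega>' * emeasure (P (X s \<omega>')) (cylinder 0 l) \<partial>Q y)"
      by (simp add: nn_integral_completion indicator_def)
    also have "\<dots> = emeasure (Q y) (X s -` B \<inter> cylinder s l)"
      by (rule Cons.IH[OF l XB, symmetric])
    also have "\<dots> = emeasure (P y) (cylinder 0 (p # l))"
      using cylinder_sets[OF Cons.prems(1), of 0] by (simp add: p)
    finally show ?thesis .
  qed
  have S': "S \<inter> X (t + s) -` B \<in> sets (F (t + s))"
    using XB[of "t + s"] Cons.prems(2) F_mono[of t "t + s"] by auto
  have "emeasure (Q z) (S \<inter> cylinder t (p # l)) =
    emeasure (Q z) ((S \<inter> X (t + s) -` B) \<inter> cylinder (t + s) l)"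
    by (simp add: p Int_assoc del: emeasure_completion)
  also have "\<dots> = (\<integral>\<^sup>+\<omega>. indicator (S \<inter> X (t + s) -` B) \<omega> * emeasure (P (X (t + s) \<omega>)) (cylinder 0 l) \<partial>Q z)"
    by (rule Cons.IH[OF l S'])
  also have "\<dots> = (\<integral>\<^sup>+\<omega>. indicator S \<omega> * ?g (X (t + s) \<omega>) \<partial>Q z)"
    by (rule nn_integral_cong) (simp add: indicator_def)
  also have "\<dots> = (\<integral>\<^sup>+\<omega>. indicator S \<omega> * emeasure (P (X t \<omega>)) (cylinder 0 (p # l)) \<partial>Q z)"
    unfolding nn_integral_X_eq[OF Cons.prems(2) g] first ..
  finally show ?case .
qed

definition cylinder_sets_family :: "'w set set" where
  "cylinder_sets_family = {{\<omega>. \<forall>s\<in>T. X s \<omega> \<in> B s} | T B. finite T \<and> (\<forall>s. B s \<in> sets cemetery_borel)}"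

text \<open>The induction inserts a new smallest time, so the later times are already expressed
  relative to it. The lower bound \<open>c\<close> keeps the truncated difference
  \<open>b - c\<close> an honest increment.\<close>

lemma ex_cylinder:
  assumes "finite T" "\<And>s. B s \<in> sets cemetery_borel" "\<And>s. s \<in> T \<Longrightarrow> c \<le> s"
  shows "\<exists>l. snd ` set l \<subseteq> sets cemetery_borel \<and> cylinder c l = {\<omega>. \<forall>s\<in>T. X s \<omega> \<in> B s}"
  using assms(1,3)
proof (induction T arbitrary: c rule: finite_linorder_min_induct)
  case empty
  show ?case by (rule exI[of _ "[]"]) auto
next
  case (insert b T)
  have "b \<le> s" if "s \<in> T" for s using insert.hyps(2) that by (simp add: less_imp_le)
  from insert.IH[OF this] obtain l where
    l: "snd ` set l \<subseteq> sets cemetery_borel" "cylinder b l = {\<omega>. \<forall>s\<in>T. X s \<omega> \<in> B s}"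
    by blast
  have "c + (b - c) = b" using insert.prems by (simp add: add_diff_inverse_ennreal)
  then have "cylinder c ((b - c, B b) # l) = {\<omega>. \<forall>s\<in>insert b T. X s \<omega> \<in> B s}"
    unfolding cylinder.simps fst_conv snd_conv \<open>c + (b - c) = b\<close> l(2) by auto
  then show ?case using l(1) assms(2) by (intro exI[of _ "(b - c, B b) # l"]) simp
qed

lemma Int_stable_cylinders: "Int_stable cylinder_sets_family"
proof (rule Int_stableI)
  fix a b assume "a \<in> cylinder_sets_family" "b \<in> cylinder_sets_family"
  then obtain T B T' B' where
    ab: "a = {\<omega>. \<forall>s\<in>T. X s \<omega> \<in> B s}" "b = {\<omega>. \<forall>s\<in>T'. X s \<omega> \<in> B' s}" "finite T" "finite T'"
    "\<And>s. B s \<in> sets cemetery_borel" "\<And>s. B' s \<in> sets cemetery_borel"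
    unfolding cylinder_sets_family_def by auto
  have U: "UNIV \<in> sets (cemetery_borel :: 'a option measure)"
    using sets.top[of "cemetery_borel :: 'a option measure"] by simp
  show "a \<inter> b \<in> cylinder_sets_family"
    unfolding cylinder_sets_family_def
    by (intro CollectI exI[of _ "T \<union> T'"]
        exI[of _ "\<lambda>s. (if s \<in> T then B s else UNIV) \<inter> (if s \<in> T' then B' s else UNIV)"])
      (use ab U in auto)
qed

lemma sets_N_cylinders: "sets (N \<infinity>) = sigma_sets UNIV cylinder_sets_family"
proof
  show "sets (N \<infinity>) \<subseteq> sigma_sets UNIV cylinder_sets_family"
    unfolding sets_N
  proof (rule sigma_sets_mono', safe)
    fix s B assume "B \<in> sets (cemetery_borel :: 'a option measure)"
    then show "X s -` B \<in> cylinder_sets_family"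
      unfolding cylinder_sets_family_def
      by (intro CollectI exI[of _ "{s}"] exI[of _ "\<lambda>_. B"]) auto
  qed
  have "cylinder_sets_family \<subseteq> sets (N \<infinity>)"
  proof
    fix x assume "x \<in> cylinder_sets_family"
    then obtain T B where "x = {\<omega>. \<forall>s\<in>T. X s \<omega> \<in> B s}" "finite T" "\<And>s. B s \<in> sets cemetery_borel"
      unfolding cylinder_sets_family_def by auto
    then obtain l where "snd ` set l \<subseteq> sets cemetery_borel" "cylinder 0 l = x"
      using ex_cylinder[of T B 0] by auto
    then show "x \<in> sets (N \<infinity>)" using cylinder_sets by blast
  qed
  then show "sigma_sets UNIV cylinder_sets_family \<subseteq> sets (N \<infinity>)"
    using sets.sigma_sets_subset[of _ "N \<infinity>"] by simp
qed

text \<open>Finite measures that agree on the intersection-stable cylinder events agree on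
  \<open>N \<infinity>\<close>; this carries the Markov property from finitely many times to whole
  paths.\<close>

lemma distr_shift:
  assumes S: "S \<in> sets (F t)"
  shows "distr (density (Q z) (indicator S)) (N \<infinity>) (\<theta> t) =
    density (Q z) (indicator S) \<bind> (\<lambda>\<omega>. P (X t \<omega>))" (is "?A = ?B")
proof -
  let ?D = "density (Q z) (indicator S)"
  have SQ: "S \<in> sets (Q z)" using S F_le_Q by blast
  have K: "(\<lambda>\<omega>. P (X t \<omega>)) \<in> Q z \<rightarrow>\<^sub>M subprob_algebra (N \<infinity>)"
    by (rule measurable_FQ[OF P_X_kernel])
  have K': "(\<lambda>\<omega>. P (X t \<omega>)) \<in> ?D \<rightarrow>\<^sub>M subprob_algebra (N \<infinity>)" using K by simp
  have sh: "\<theta> t \<in> ?D \<rightarrow>\<^sub>M N \<infinity>"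
    using measurable_completion[of "\<theta> t" "P z"] shift_measurable by (simp cong: measurable_cong_sets)
  have main: "emeasure ?A C = emeasure ?B C" if C: "C \<in> cylinder_sets_family" for C
  proof -
    obtain T B where "C = {\<omega>. \<forall>s\<in>T. X s \<omega> \<in> B s}" "finite T" "\<And>s. B s \<in> sets cemetery_borel"
      using C unfolding cylinder_sets_family_def by auto
    then obtain l where l: "snd ` set l \<subseteq> sets cemetery_borel" "cylinder 0 l = C"
      using ex_cylinder[of T B 0] by auto
    have CN: "C \<in> sets (N \<infinity>)" using cylinder_sets l by blast
    have tC: "cylinder t l \<in> sets (Q z)" using cylinder_sets[OF l(1)] by auto
    have "emeasure ?A C = emeasure ?D (cylinder t l)"
      using sh CN cylinder_shift[of t 0 l] l(2) by (subst emeasure_distr) auto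
    also have "\<dots> = emeasure (Q z) (S \<inter> cylinder t l)"
      using SQ tC by (simp add: emeasure_restricted del: emeasure_completion)
    also have "\<dots> = (\<integral>\<^sup>+\<omega>. indicator S \<omega> * emeasure (P (X t \<omega>)) C \<partial>Q z)"
      using markov_cylinder[OF l(1) S] l(2) by simp
    also have "\<dots> = (\<integral>\<^sup>+\<omega>. emeasure (P (X t \<omega>)) C \<partial>?D)"
      using SQ measurable_emeasure_kernel[OF K CN] by (subst nn_integral_density) auto
    also have "\<dots> = emeasure ?B C"
      using emeasure_bind[OF _ K' CN] by simp
    finally show ?thesis .
  qed
  show ?thesis
  proof (rule measure_eqI_generator_eq[OF Int_stable_cylinders, of UNIV _ _ "\<lambda>_. UNIV"])
    show "sets ?A = sigma_sets UNIV cylinder_sets_family"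
      by (simp only: sets_distr sets_N_cylinders)
    show "sets ?B = sigma_sets UNIV cylinder_sets_family"
      unfolding sets_N_cylinders[symmetric] by (rule sets_bind_measurable[OF K']) simp
    show "range (\<lambda>_. UNIV) \<subseteq> cylinder_sets_family"
      unfolding cylinder_sets_family_def
      using sets.top[of "cemetery_borel :: 'a option measure"]
      by (auto intro!: exI[of _ "{}"] exI[of _ "\<lambda>_. UNIV"])
    have "emeasure ?A UNIV \<le> emeasure (Q z) UNIV"
      using sh SQ sets.top[of "N \<infinity>"] sets.top[of "Q z"] emeasure_mono[of S UNIV "Q z"]
      by (subst emeasure_distr) (auto simp: emeasure_restricted simp del: emeasure_completion emeasure_Q_UNIV)
    then show "emeasure ?A UNIV \<noteq> \<infinity>" by (auto simp: top_unique simp del: emeasure_completion)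
    show "emeasure ?A C = emeasure ?B C" if "C \<in> cylinder_sets_family" for C
      by (rule main[OF that])
  qed auto
qed

lemma nn_integral_shift_indicator:
  assumes S: "S \<in> sets (F t)" and Y: "Y \<in> borel_measurable (N \<infinity>)"
  shows "(\<integral>\<^sup>+\<omega>. indicator S \<omega> * Y (\<theta> t \<omega>) \<partial>Q z) =
    (\<integral>\<^sup>+\<omega>. indicator S \<omega> * integral\<^sup>N (P (X t \<omega>)) Y \<partial>Q z)"
proof -
  let ?D = "density (Q z) (indicator S)"
  have SQ: "S \<in> sets (Q z)" using S F_le_Q by blast
  have K: "(\<lambda>\<omega>. P (X t \<omega>)) \<in> Q z \<rightarrow>\<^sub>M subprob_algebra (N \<infinity>)"
    by (rule measurable_FQ[OF P_X_kernel])
  have K': "(\<lambda>\<omega>. P (X t \<omega>)) \<in> ?D \<rightarrow>\<^sub>M subprob_algebra (N \<infinity>)" using K by simp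
  have sh: "\<theta> t \<in> Q z \<rightarrow>\<^sub>M N \<infinity>"
    using measurable_completion[of "\<theta> t" "P z"] shift_measurable by (simp cong: measurable_cong_sets)
  have "(\<integral>\<^sup>+\<omega>. indicator S \<omega> * Y (\<theta> t \<omega>) \<partial>Q z) = (\<integral>\<^sup>+\<omega>. Y (\<theta> t \<omega>) \<partial>?D)"
    using SQ sh Y by (subst nn_integral_density) auto
  also have "\<dots> = (\<integral>\<^sup>+y. Y y \<partial>distr ?D (N \<infinity>) (\<theta> t))"
    using sh Y by (subst nn_integral_distr) auto
  also have "\<dots> = (\<integral>\<^sup>+\<omega>. integral\<^sup>N (P (X t \<omega>)) Y \<partial>?D)"
    unfolding distr_shift[OF S] by (rule nn_integral_bind[OF Y K'])
  also have "\<dots> = (\<integral>\<^sup>+\<omega>. indicator S \<omega> * integral\<^sup>N (P (X t \<omega>)) Y \<partial>Q z)"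
    using SQ by (subst nn_integral_density)
      (auto intro!: measurable_compose[OF K] nn_integral_measurable_subprob_algebra Y)
  finally show ?thesis .
qed

lemma nn_integral_shift:
  assumes H: "H \<in> borel_measurable (F t)" and Y: "Y \<in> borel_measurable (N \<infinity>)"
  shows "(\<integral>\<^sup>+\<omega>. H \<omega> * Y (\<theta> t \<omega>) \<partial>Q z) =
    (\<integral>\<^sup>+\<omega>. H \<omega> * integral\<^sup>N (P (X t \<omega>)) Y \<partial>Q z)"
proof -
  have sh: "(\<lambda>\<omega>. Y (\<theta> t \<omega>)) \<in> borel_measurable (Q z)"
    using measurable_compose[OF shift_measurable Y]
    by (intro measurable_completion) (simp cong: measurable_cong_sets)
  have k: "(\<lambda>\<omega>. \<integral>\<^sup>+\<omega>'. Y \<omega>' \<partial>P (X t \<omega>)) \<in> borel_measurable (Q z)"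
    by (rule measurable_compose[OF measurable_FQ[OF P_X_kernel] nn_integral_measurable_subprob_algebra[OF Y]])
  from H show ?thesis
  proof (induction rule: borel_measurable_induct)
    case (cong f g)
    then show ?case by simp
  next
    case (set A)
    then show ?case by (rule nn_integral_shift_indicator[OF _ Y])
  next
    case (mult u c)
    note [measurable] = measurable_FQ[OF mult.hyps(2), where z=z] sh k
    show ?case using mult.IH by (simp add: mult.assoc nn_integral_cmult)
  next
    case (add u v)
    note [measurable] = measurable_FQ[OF add.hyps(1), where z=z] measurable_FQ[OF add.hyps(3), where z=z] sh k
    show ?case using add.IH by (simp add: distrib_right nn_integral_add)
  next
    case (seq U)
    note [measurable] = measurable_FQ[OF seq.hyps(1), where z=z] sh k
    have inc: "incseq (\<lambda>i \<omega>. U i \<omega> * g \<omega>)" for g :: "'w \<Rightarrow> ennreal"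
      using seq.hyps(3) by (auto simp: incseq_def le_fun_def intro!: mult_right_mono)
    have e: "Sup (range U) \<omega> * c = (SUP i. U i \<omega> * c)" for \<omega> c
      unfolding SUP_apply by (simp add: SUP_mult_right_ennreal image_comp)
    show ?case unfolding e
      using seq.IH by (simp add: nn_integral_monotone_convergence_SUP[OF inc])
  qed
qed

text \<open>The shifted path is the process started from the law of \<open>X t\<close>. As the
  augmentation ranges over all initial laws, this law is among them, which is what controls events
  of \<open>F \<infinity>\<close> after a shift.\<close>

lemma distr_shift_bind:
  "distr (Q z) (N \<infinity>) (\<theta> t) = distr (Q z) cemetery_borel (X t) \<bind> P"
  "distr (Q z) cemetery_borel (X t) \<in> space (prob_algebra cemetery_borel)"
proof -
  have XQ: "X t \<in> Q z \<rightarrow>\<^sub>M cemetery_borel"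
    by (rule measurable_FQ[OF X_measurable_F[OF order_refl]])
  have UF: "UNIV \<in> sets (F t)" using sets.top[of "F t"] by simp
  have D: "density (Q z) (indicator UNIV) = Q z"
    using density_1[of "Q z"] by (simp add: indicator_def)
  have "distr (Q z) (N \<infinity>) (\<theta> t) = Q z \<bind> (\<lambda>\<omega>. P (X t \<omega>))"
    using distr_shift[OF UF, of z] unfolding D .
  also have "\<dots> = distr (Q z) cemetery_borel (X t) \<bind> P"
    using bind_distr[OF XQ P_subprob] by simp
  finally show "distr (Q z) (N \<infinity>) (\<theta> t) = distr (Q z) cemetery_borel (X t) \<bind> P" .
  show "distr (Q z) cemetery_borel (X t) \<in> space (prob_algebra cemetery_borel)"
    using prob_space.prob_space_distr[OF prob_Q XQ] by (simp add: space_prob_algebra)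
qed

text \<open>\<open>y \<mapsto> \<integral>Y dP\<^sub>y\<close> need not be Borel; the integrand on the right-hand side is only equal
  almost everywhere to a measurable function.\<close>

theorem markov_property:
  assumes H: "H \<in> borel_measurable (F t)" and Y: "Y \<in> borel_measurable (F \<infinity>)"
  shows "(\<integral>\<^sup>+\<omega>. H \<omega> * Y (\<theta> t \<omega>) \<partial>Q z) =
    (\<integral>\<^sup>+\<omega>. H \<omega> * integral\<^sup>N (Q (X t \<omega>)) Y \<partial>Q z)"
proof -
  let ?\<mu> = "distr (Q z) cemetery_borel (X t)"
  have XQ: "X t \<in> Q z \<rightarrow>\<^sub>M cemetery_borel"
    by (rule measurable_FQ[OF X_measurable_F[OF order_refl]])
  note \<mu> = distr_shift_bind(2)[of z t] and law = distr_shift_bind(1)[of z t]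
  \<comment> \<open>\<open>Y\<close> is measurable for the completion of the shifted law, so it
    agrees almost everywhere with some \<open>Y'\<close> measurable for
    \<open>N \<infinity>\<close>. The exceptional set is then negligible both along
    \<open>\<theta> t\<close> and, for almost every path, under
    \<open>P (X t \<omega>)\<close>.\<close>
  have "Y \<in> borel_measurable (completion (?\<mu> \<bind> P))"
    using measurable_mono[of borel borel "F \<infinity>" "completion (?\<mu> \<bind> P)"] F_le_completion[OF \<mu>, of \<infinity>]
      bind_P[OF \<mu>] Y by auto
  then obtain Y' where Y': "Y' \<in> borel_measurable (?\<mu> \<bind> P)" and ae: "AE \<omega> in ?\<mu> \<bind> P. Y \<omega> = Y' \<omega>"
    using completion_ex_borel_measurable by blast
  have Y'N: "Y' \<in> borel_measurable (N \<infinity>)" using Y' by (simp add: measurable_cong_sets[OF bind_P(1)[OF \<mu>]])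
  have sh: "\<theta> t \<in> Q z \<rightarrow>\<^sub>M N \<infinity>"
    using measurable_completion[of "\<theta> t" "P z"] shift_measurable by (simp cong: measurable_cong_sets)
  have 1: "AE \<omega> in Q z. Y (\<theta> t \<omega>) = Y' (\<theta> t \<omega>)"
    by (rule AE_distrD[OF sh]) (use ae law in metis)
  have "AE y in ?\<mu>. AE \<omega> in P y. Y \<omega> = Y' \<omega>" by (rule AE_bind_P[OF \<mu> ae])
  then have "AE \<omega> in Q z. AE \<omega>' in P (X t \<omega>). Y \<omega>' = Y' \<omega>'" by (rule AE_distrD[OF XQ])
  then have 2: "AE \<omega> in Q z. integral\<^sup>N (Q (X t \<omega>)) Y = integral\<^sup>N (P (X t \<omega>)) Y'"
    by eventually_elim (auto simp: nn_integral_completion intro: nn_integral_cong_AE)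
  have "(\<integral>\<^sup>+\<omega>. H \<omega> * Y (\<theta> t \<omega>) \<partial>Q z) = (\<integral>\<^sup>+\<omega>. H \<omega> * Y' (\<theta> t \<omega>) \<partial>Q z)"
    by (rule nn_integral_cong_AE) (use 1 in eventually_elim, simp)
  also have "\<dots> = (\<integral>\<^sup>+\<omega>. H \<omega> * integral\<^sup>N (P (X t \<omega>)) Y' \<partial>Q z)"
    by (rule nn_integral_shift[OF H Y'N])
  also have "\<dots> = (\<integral>\<^sup>+\<omega>. H \<omega> * integral\<^sup>N (Q (X t \<omega>)) Y \<partial>Q z)"
    by (rule nn_integral_cong_AE) (use 2 in eventually_elim, simp)
  finally show ?thesis .
qed

end

section \<open>Measurability of the paths\<close>

lemma Some_image_cemetery_borel:
  fixes A :: "'a::topological_space set"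
  assumes "A \<in> sets borel"
  shows "Some ` A \<in> sets cemetery_borel"
proof -
  have gen: "Some ` U \<in> sets cemetery_borel" if "open U" for U :: "'a set"
    using that unfolding cemetery_borel_def by (auto simp: sets_measure_of_conv intro!: sigma_sets.Basic)
  have "A \<in> sigma_sets UNIV {S. open S}"
    using assms by (simp add: borel_def)
  then show ?thesis
  proof induction
    case (Basic S)
    then show ?case using gen by simp
  next
    case (Compl S)
    have "Some ` (UNIV - S) = Some ` UNIV - Some ` S" by auto
    then show ?case using gen[of UNIV] Compl.IH by auto
  next
    case (Union S)
    have "Some ` (\<Union>(range S)) = (\<Union>i. Some ` S i)" by auto
    then show ?case using Union.IH by auto
  qed simp
qed

lemma None_cemetery_borel: "{None :: 'a::topological_space option} \<in> sets cemetery_borel"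
proof -
  have "space cemetery_borel - Some ` (UNIV :: 'a set) \<in> sets cemetery_borel"
    by (intro sets.compl_sets Some_image_cemetery_borel) simp
  moreover have "space cemetery_borel - Some ` (UNIV :: 'a set) = {None}"
    by (auto simp: cemetery_borel_def space_measure_of_conv notin_range_Some)
  ultimately show ?thesis by simp
qed

lemma measurable_extend_zero:
  fixes f :: "'a::topological_space \<Rightarrow> ennreal"
  assumes "f \<in> borel_measurable borel"
  shows "extend_zero f \<in> borel_measurable cemetery_borel"
proof (rule measurableI)
  fix B :: "ennreal set" assume B: "B \<in> sets borel"
  have "f -` B \<in> sets borel" using measurable_sets[OF assms B] by simp
  moreover have "extend_zero f -` B \<inter> space cemetery_borel =
      Some ` (f -` B) \<union> (if 0 \<in> B then {None} else {})"
    by (rule set_eqI, case_tac x)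
      (auto simp: extend_zero_def cemetery_borel_def space_measure_of_conv)
  ultimately show "extend_zero f -` B \<inter> space cemetery_borel \<in> sets cemetery_borel"
    using Some_image_cemetery_borel[of "f -` B"] None_cemetery_borel
    by (simp only:, intro sets.Un) auto
qed (simp add: cemetery_borel_def)

text \<open>Closures of basis sets inside small balls are compact subsets of \<open>U\<close>.
  Covering by interiors is what turns convergence to a point of \<open>U\<close> into being
  eventually in a single \<open>C\<close>.\<close>

lemma open_eq_Union_interior_compact:
  fixes U :: "'a::{metric_space, second_countable_topology} set"
  assumes lc: "locally_compact_space (euclidean :: 'a topology)" and U: "open U"
  obtains \<C> where "countable \<C>" "\<And>C. C \<in> \<C> \<Longrightarrow> compact C \<and> C \<subseteq> U" "U = (\<Union>C\<in>\<C>. interior C)"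
proof -
  obtain \<B> :: "'a set set" where \<B>: "countable \<B>" "topological_basis \<B>"
    using ex_countable_basis by auto
  let ?C = "{closure b | b. b \<in> \<B> \<and> compact (closure b) \<and> closure b \<subseteq> U}"
  have "\<exists>C\<in>?C. x \<in> interior C" if x: "x \<in> U" for x
  proof -
    obtain V K where VK: "open V" "compact K" "x \<in> V" "V \<subseteq> K"
      using lc unfolding locally_compact_space_def by (auto dest!: spec[of _ x])
    obtain r where r: "r > 0" "cball x r \<subseteq> V \<inter> U"
      using open_contains_cball[of "V \<inter> U"] VK U x by blast
    obtain b where b: "b \<in> \<B>" "x \<in> b" "b \<subseteq> ball x r"
      using topological_basisE[OF \<B>(2), of "ball x r" x] r(1) by auto
    have "closure b \<subseteq> cball x r"
      using b(3) by (meson ball_subset_cball closed_cball closure_minimal subset_trans)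
    moreover have "compact (closure b)"
    proof -
      have "cball x r \<subseteq> K" using r(2) VK(4) by (simp only: le_inf_iff) (metis subset_trans)
      with \<open>closure b \<subseteq> cball x r\<close> have "closure b \<subseteq> K" by (rule subset_trans)
      then have "K \<inter> closure b = closure b" by (rule Int_absorb1)
      with compact_Int_closed[OF VK(2) closed_closure[of b]] show ?thesis by (rule back_subst)
    qed
    moreover have "x \<in> interior (closure b)"
      using interior_maximal[OF closure_subset topological_basis_open[OF \<B>(2) b(1)]] b(2) by blast
    moreover have "cball x r \<subseteq> U" using r(2) by (simp only: le_inf_iff)
    ultimately show ?thesis using b(1) by (intro bexI[of _ "closure b"]) auto
  qed
  then have "U = (\<Union>C\<in>?C. interior C)"
    using interior_subset by fast
  moreover have "countable ?C"
    using countable_image[OF \<B>(1), of closure] by (rule countable_subset[rotated]) auto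
  ultimately show ?thesis by (intro that[of ?C]) auto
qed

text \<open>The limit lies in an open subset of \<open>E\<close> exactly when the sequence is
  eventually in one \<open>C\<close> of a countable family: interiors are open, which gives one
  direction, and compact sets stay closed in the compactification, which gives the other.
  Neighbourhoods of the cemetery follow by complements.\<close>

lemma measurable_cemetery_limit:
  fixes Y :: "nat \<Rightarrow> 'b \<Rightarrow> 'a::{metric_space, second_countable_topology} option"
  assumes lc: "locally_compact_space (euclidean :: 'a topology)"
    and Y: "\<And>n. Y n \<in> M \<rightarrow>\<^sub>M cemetery_borel"
    and lim: "\<And>x. x \<in> space M \<Longrightarrow> limitin cemetery_topology (\<lambda>n. Y n x) (L x) sequentially"
  shows "L \<in> M \<rightarrow>\<^sub>M cemetery_borel"
proof -
  have opens: "{x\<in>space M. L x \<in> Some ` U} \<in> sets M" if U: "open U" for U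
  proof -
    obtain \<C> where \<C>: "countable \<C>" "\<And>C. C \<in> \<C> \<Longrightarrow> compact C \<and> C \<subseteq> U" "U = (\<Union>C\<in>\<C>. interior C)"
      using open_eq_Union_interior_compact[OF lc U] by blast
    have m: "{x\<in>space M. \<exists>n0. \<forall>n\<ge>n0. Y n x \<in> Some ` C} \<in> sets M" if "C \<in> \<C>" for C
    proof -
      have "Some ` C \<in> sets cemetery_borel"
        using \<C>(2)[OF that] by (intro Some_image_cemetery_borel borel_closed compact_imp_closed) auto
      from measurable_sets[OF Y this] have "Measurable.pred M (\<lambda>x. Y n x \<in> Some ` C)" for n
        by (simp add: pred_def vimage_def Int_def conj_commute)
      then show ?thesis by measurable
    qed
    have "{x\<in>space M. L x \<in> Some ` U} = (\<Union>C\<in>\<C>. {x\<in>space M. \<exists>n0. \<forall>n\<ge>n0. Y n x \<in> Some ` C})"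
    proof (intro equalityI subsetI)
      fix x assume "x \<in> {x\<in>space M. L x \<in> Some ` U}"
      then obtain y where x: "x \<in> space M" "L x = Some y" "y \<in> U" by auto
      from x(3) obtain C where C: "C \<in> \<C>" "y \<in> interior C" using \<C>(3) by auto
      have "openin cemetery_topology (Some ` interior C)" by simp
      then have "\<forall>\<^sub>F n in sequentially. Y n x \<in> Some ` interior C"
        using lim[OF x(1)] x(2) C(2) unfolding limitin_def by auto
      then have "\<forall>\<^sub>F n in sequentially. Y n x \<in> Some ` C"
        by eventually_elim (use interior_subset in auto)
      then show "x \<in> (\<Union>C\<in>\<C>. {x\<in>space M. \<exists>n0. \<forall>n\<ge>n0. Y n x \<in> Some ` C})"
        using x C by (auto simp: eventually_sequentially)
    next
      fix x assume "x \<in> (\<Union>C\<in>\<C>. {x\<in>space M. \<exists>n0. \<forall>n\<ge>n0. Y n x \<in> Some ` C})"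
      then obtain C n0 where C: "C \<in> \<C>" and x: "x \<in> space M" "\<forall>n\<ge>n0. Y n x \<in> Some ` C" by blast
      have "closedin cemetery_topology (Some ` C)"
        using \<C>(2)[OF C] by (simp add: compact_imp_closed)
      then have op: "openin cemetery_topology (UNIV - Some ` C)"
        by (simp add: closedin_def UNIV_option_conv)
      have "L x \<in> Some ` C"
      proof (rule ccontr)
        assume "L x \<notin> Some ` C"
        then have "\<forall>\<^sub>F n in sequentially. Y n x \<in> UNIV - Some ` C"
          using lim[OF x(1)] op unfolding limitin_def by blast
        then obtain n1 where "\<forall>n\<ge>n1. Y n x \<in> UNIV - Some ` C" by (auto simp: eventually_sequentially)
        then have "Y (max n0 n1) x \<in> UNIV - Some ` C" by (simp del: Diff_iff)
        moreover have "Y (max n0 n1) x \<in> Some ` C" using x(2) by (simp del: image_iff)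
        ultimately show False by blast
      qed
      then show "x \<in> {x\<in>space M. L x \<in> Some ` U}" using \<C>(2)[OF C] x(1) by auto
    qed
    then show ?thesis by (simp only:) (rule sets.countable_UN''[OF \<C>(1) m])
  qed
  show ?thesis
    unfolding cemetery_borel_def
  proof (rule measurable_measure_of)
    fix V assume "V \<in> {U. openin (cemetery_topology :: 'a option topology) U}"
    then consider U where "V = Some ` U" "open U" | K where "V = insert None (Some ` (UNIV - K))" "closed K"
      by (auto simp: openin_Alexandroff_compactification)
    then show "L -` V \<inter> space M \<in> sets M"
    proof cases
      case 1
      then show ?thesis using opens[of U] by (simp add: vimage_def Int_def conj_commute)
    next
      case 2
      have "L -` V \<inter> space M = space M -
          ({x\<in>space M. L x \<in> Some ` UNIV} - {x\<in>space M. L x \<in> Some ` (UNIV - K)})"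
        unfolding 2(1) by (auto simp: notin_range_Some)
      then show ?thesis using opens[of UNIV] opens[of "UNIV - K"] 2(2)
        by (auto simp: Compl_eq_Diff_UNIV[symmetric])
    qed
  qed auto
qed

section \<open>Joint measurability in time and path\<close>

lemma limitin_compose:
  "limitin T f l G \<Longrightarrow> filterlim g G H \<Longrightarrow> limitin T (\<lambda>x. f (g x)) l H"
  unfolding limitin_def by (auto dest: eventually_compose_filterlim)

text \<open>The first multiple of \<open>1 / Suc n\<close> strictly above \<open>r\<close>.
  Strictness matters because \<open>at_right\<close> excludes the point itself.\<close>

definition grid_up :: "nat \<Rightarrow> real \<Rightarrow> real" where
  "grid_up n r = real_of_int (\<lfloor>real (Suc n) * r\<rfloor> + 1) / real (Suc n)"

lemma grid_up_gt: "r < grid_up n r" and grid_up_le: "grid_up n r \<le> r + 1 / real (Suc n)"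
proof -
  have "real (Suc n) * r < real_of_int (\<lfloor>real (Suc n) * r\<rfloor> + 1)" by linarith
  then show "r < grid_up n r" unfolding grid_up_def by (simp add: field_simps)
  have "real_of_int (\<lfloor>real (Suc n) * r\<rfloor> + 1) \<le> real (Suc n) * r + 1" by linarith
  then have "grid_up n r \<le> (real (Suc n) * r + 1) / real (Suc n)"
    unfolding grid_up_def by (rule divide_right_mono) simp
  also have "\<dots> = r + 1 / real (Suc n)" by (simp add: field_simps)
  finally show "grid_up n r \<le> r + 1 / real (Suc n)" .
qed

lemma grid_up_LIMSEQ: "(\<lambda>n. grid_up n r) \<longlonglongrightarrow> r"
proof (rule tendsto_sandwich[of "\<lambda>_. r" _ _ "\<lambda>n. r + 1 / real (Suc n)"])
  show "(\<lambda>n. r + 1 / real (Suc n)) \<longlonglongrightarrow> r"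
    using tendsto_add[OF tendsto_const[of r] LIMSEQ_inverse_real_of_nat] by (simp add: inverse_eq_divide)
  show "\<forall>\<^sub>F n in sequentially. r \<le> grid_up n r"
    by (intro always_eventually allI less_imp_le grid_up_gt)
  show "\<forall>\<^sub>F n in sequentially. grid_up n r \<le> r + 1 / real (Suc n)"
    by (intro always_eventually allI grid_up_le)
qed auto

lemma grid_up_nonpos: "r < 0 \<Longrightarrow> grid_up n r \<le> 0"
proof -
  assume "r < 0"
  then have "real (Suc n) * r < 0" by (simp add: mult_pos_neg)
  then have "\<lfloor>real (Suc n) * r\<rfloor> < 0" by linarith
  then have "real_of_int (\<lfloor>real (Suc n) * r\<rfloor> + 1) \<le> 0" by linarith
  then show ?thesis unfolding grid_up_def by (rule divide_nonpos_pos) simp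
qed

text \<open>\<open>grid_up n\<close> takes countably many values, so measurability of each
  \<open>f u\<close> is enough.\<close>

lemma measurable_grid_step:
  assumes "\<And>u. f u \<in> M \<rightarrow>\<^sub>M L"
  shows "(\<lambda>(r, \<omega>). f (grid_up n r) \<omega>) \<in> borel \<Otimes>\<^sub>M M \<rightarrow>\<^sub>M L"
proof -
  have "(\<lambda>x. f (real_of_int (i + 1) / real (Suc n)) (snd x)) \<in> borel \<Otimes>\<^sub>M M \<rightarrow>\<^sub>M L" for i
    using assms by measurable
  moreover have "(\<lambda>x. \<lfloor>real (Suc n) * fst x\<rfloor>) \<in> borel \<Otimes>\<^sub>M M \<rightarrow>\<^sub>M count_space UNIV"
    by measurable
  ultimately have "(\<lambda>x. f (real_of_int (\<lfloor>real (Suc n) * fst x\<rfloor> + 1) / real (Suc n)) (snd x)) \<in> borel \<Otimes>\<^sub>M M \<rightarrow>\<^sub>M L"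
    by (rule measurable_compose_countable)
  then show ?thesis by (simp add: grid_up_def split_beta' del: of_nat_Suc)
qed

lemma measurable_pair_mono:
  assumes f: "f \<in> A \<Otimes>\<^sub>M M' \<rightarrow>\<^sub>M L" and le: "sets M' \<subseteq> sets M" "space M' = space M"
  shows "f \<in> A \<Otimes>\<^sub>M M \<rightarrow>\<^sub>M L"
proof -
  have "snd \<in> A \<Otimes>\<^sub>M M \<rightarrow>\<^sub>M M'"
    by (rule measurable_compose[OF measurable_snd, of "\<lambda>x. x", simplified])
      (use le in \<open>auto intro!: measurableI\<close>)
  then have "(\<lambda>x. (fst x, snd x)) \<in> A \<Otimes>\<^sub>M M \<rightarrow>\<^sub>M A \<Otimes>\<^sub>M M'" by measurable
  from measurable_compose[OF this f] show ?thesis by simp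
qed

context hunt begin

text \<open>Progressive measurability. Cutting the grid at \<open>t\<close> keeps every observation
  in \<open>N (ennreal t)\<close>, and right-continuity recovers the path from the grid.\<close>

lemma measurable_X_joint:
  assumes t: "0 \<le> t"
  shows "(\<lambda>(r, \<omega>). X (ennreal (min r t)) \<omega>) \<in> borel \<Otimes>\<^sub>M N (ennreal t) \<rightarrow>\<^sub>M cemetery_borel"
proof (rule measurable_cemetery_limit[OF locally_compact])
  fix n
  have "(\<lambda>(r, \<omega>). (\<lambda>u. X (ennreal (min u t))) (grid_up n r) \<omega>) \<in> borel \<Otimes>\<^sub>M N (ennreal t) \<rightarrow>\<^sub>M cemetery_borel"
    by (rule measurable_grid_step) (auto intro!: X_measurable ennreal_leI)
  then show "(\<lambda>(r, \<omega>). X (ennreal (min (grid_up n r) t)) \<omega>) \<in> borel \<Otimes>\<^sub>M N (ennreal t) \<rightarrow>\<^sub>M cemetery_borel"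
    by simp
next
  fix x :: "real \<times> 'w"
  obtain r \<omega> where x: "x = (r, \<omega>)" by force
  consider "t \<le> r" | "r < 0" | "0 \<le> r" "r < t" by linarith
  then have "limitin cemetery_topology (\<lambda>n. X (ennreal (min (grid_up n r) t)) \<omega>) (X (ennreal (min r t)) \<omega>) sequentially"
  proof cases
    case 1
    then have "min (grid_up n r) t = t" "min r t = t" for n
      using grid_up_gt[of r n] by auto
    then show ?thesis by (simp add: limitin_const UNIV_option_conv[symmetric])
  next
    case 2
    \<comment> \<open>\<open>ennreal\<close> sends every nonpositive time to 0, and the grid point
      after a negative \<open>r\<close> is still nonpositive, so the sequence is constant.\<close>
    then have "ennreal (min (grid_up n r) t) = 0" "ennreal (min r t) = 0" for n
      using grid_up_nonpos[OF 2, of n] by (auto simp: ennreal_neg min_def)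
    then show ?thesis by (simp add: limitin_const UNIV_option_conv[symmetric])
  next
    case 3
    have "filterlim (\<lambda>n. ennreal (min (grid_up n r) t)) (at_right (ennreal r)) sequentially"
      unfolding filterlim_at
    proof
      show "\<forall>\<^sub>F n in sequentially. ennreal (min (grid_up n r) t) \<in> {ennreal r<..} \<and>
          ennreal (min (grid_up n r) t) \<noteq> ennreal r"
      proof (intro always_eventually allI)
        fix n
        have "ennreal r < ennreal (min (grid_up n r) t)"
          using 3 grid_up_gt[of r n] by (simp add: ennreal_less_iff)
        then show "ennreal (min (grid_up n r) t) \<in> {ennreal r<..} \<and>
            ennreal (min (grid_up n r) t) \<noteq> ennreal r" by auto
      qed
      have "(\<lambda>n. min (grid_up n r) t) \<longlonglongrightarrow> min r t"
        by (intro tendsto_min grid_up_LIMSEQ tendsto_const)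
      then show "(\<lambda>n. ennreal (min (grid_up n r) t)) \<longlonglongrightarrow> ennreal r"
        using 3 by (intro tendsto_ennrealI) simp
    qed
    from limitin_compose[OF X_right_limit this] 3 show ?thesis by simp
  qed
  then show "limitin cemetery_topology (\<lambda>n. (\<lambda>(r, \<omega>). X (ennreal (min (grid_up n r) t)) \<omega>) x)
      ((\<lambda>(r, \<omega>). X (ennreal (min r t)) \<omega>) x) sequentially"
    by (simp add: x)
qed

lemma measurable_X_joint_infinity:
  "(\<lambda>(r, \<omega>). X (ennreal r) \<omega>) \<in> borel \<Otimes>\<^sub>M N \<infinity> \<rightarrow>\<^sub>M cemetery_borel"
proof (rule measurable_cemetery_limit[OF locally_compact])
  fix n
  show "(\<lambda>(r, \<omega>). X (ennreal (min r (real n))) \<omega>) \<in> borel \<Otimes>\<^sub>M N \<infinity> \<rightarrow>\<^sub>M cemetery_borel"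
    by (rule measurable_pair_mono[OF measurable_X_joint]) (use N_mono[of "ennreal n" \<infinity>] in auto)
next
  fix x :: "real \<times> 'w"
  obtain r \<omega> where x: "x = (r, \<omega>)" by force
  have "\<forall>\<^sub>F n in sequentially. r \<le> real n"
    by (rule eventually_sequentiallyI[of "nat \<lceil>r\<rceil>"]) linarith
  then have "limitin cemetery_topology (\<lambda>n. X (ennreal (min r (real n))) \<omega>) (X (ennreal r) \<omega>) sequentially"
    by (rule limitin_eventually[rotated, OF eventually_mono]) (auto simp: UNIV_option_conv[symmetric] min_def)
  then show "limitin cemetery_topology (\<lambda>n. (\<lambda>(r, \<omega>). X (ennreal (min r (real n))) \<omega>) x)
      ((\<lambda>(r, \<omega>). X (ennreal r) \<omega>) x) sequentially"
    by (simp add: x)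
qed

end

section \<open>Stieltjes integrals along a path\<close>

definition regular_path :: "(ennreal \<Rightarrow> ennreal) \<Rightarrow> bool" where
  "regular_path v \<longleftrightarrow> v 0 = 0 \<and> mono_on {..<\<infinity>} v \<and> continuous_on {..<\<infinity>} v"

text \<open>The generalised inverse of \<open>v\<close>. The infimum of the empty set makes it
  \<open>\<infinity>\<close> at levels that are never reached.\<close>

definition level_time :: "(ennreal \<Rightarrow> ennreal) \<Rightarrow> real \<Rightarrow> ennreal" where
  "level_time v r = Inf {t. t < \<infinity> \<and> ennreal r \<le> v t}"

text \<open>The Stieltjes integral of \<open>y\<close> against \<open>v\<close> over \<open>(0,t]\<close>, written as a Lebesgue integral
  through the inverse of \<open>v\<close>. It makes sense also if \<open>v\<close> becomes infinite.\<close>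

definition path_integral :: "(ennreal \<Rightarrow> ennreal) \<Rightarrow> (ennreal \<Rightarrow> ennreal) \<Rightarrow> ennreal \<Rightarrow> ennreal" where
  "path_integral v y t =
    (\<integral>\<^sup>+r. indicator {0<..} r * (if level_time v r \<le> t then y (level_time v r) else 0) \<partial>lborel)"

lemma regular_pathD:
  assumes "regular_path v"
  shows "v 0 = 0" "s \<le> t \<Longrightarrow> t < \<infinity> \<Longrightarrow> v s \<le> v t" "continuous_on {..<\<infinity>} v"
  using assms unfolding regular_path_def by (auto simp: mono_on_def)

lemma open_path_level:
  assumes "regular_path v"
  shows "open {t. t < \<infinity> \<and> v t < c}" "open {t. t < \<infinity> \<and> c < v t}"
proof -
  have "open ({..<\<infinity>} \<inter> v -` {..<c})" "open ({..<\<infinity>} \<inter> v -` {c<..})"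
    by (intro continuous_open_preimage regular_pathD[OF assms] open_lessThan open_greaterThan)+
  then show "open {t. t < \<infinity> \<and> v t < c}" "open {t. t < \<infinity> \<and> c < v t}"
    by (auto simp: vimage_def Int_def)
qed

text \<open>The Galois connection between \<open>v\<close> and its inverse. Continuity from the
  right enters: if \<open>v y\<close> is below the level, so is \<open>v\<close> slightly later, and
  the level time stays away from \<open>y\<close>.\<close>

lemma level_time_le_iff:
  assumes v: "regular_path v" and y: "y < \<infinity>"
  shows "level_time v r \<le> y \<longleftrightarrow> ennreal r \<le> v y"
proof
  assume "ennreal r \<le> v y"
  then show "level_time v r \<le> y" unfolding level_time_def using y by (intro Inf_lower) auto
next
  assume le: "level_time v r \<le> y"
  show "ennreal r \<le> v y"
  proof (rule ccontr)
    assume "\<not> ennreal r \<le> v y"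
    then have "y \<in> {t. t < \<infinity> \<and> v t < ennreal r}" using y by auto
    from open_right[OF open_path_level(1)[OF v] this y] obtain b where
      b: "y < b" "{y..<b} \<subseteq> {t. t < \<infinity> \<and> v t < ennreal r}" by auto
    obtain y' where y': "y < y'" "y' < b" using dense[OF b(1)] by auto
    then have "y' \<in> {y..<b}" by simp
    from subsetD[OF b(2) this] have "v y' < ennreal r" "y' < \<infinity>" by auto
    then have "y' \<le> t" if "t < \<infinity>" "ennreal r \<le> v t" for t
      using regular_pathD(2)[OF v, of t y'] that by (metis leI less_imp_le not_less order_trans)
    then have "y' \<le> level_time v r" unfolding level_time_def by (intro Inf_greatest) auto
    then show False using y' le by auto
  qed
qed

text \<open>Continuity from the left enters here: a value above \<open>r\<close> at \<open>t\<close>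
  would put the level time before \<open>t\<close>. Hence only one level can be reached exactly at
  \<open>t\<close>, a null set of levels.\<close>

lemma level_time_eq:
  assumes v: "regular_path v" and t: "t < \<infinity>" and r: "0 < r" and eq: "level_time v r = t"
  shows "v t = ennreal r"
proof (rule antisym)
  show "ennreal r \<le> v t" using level_time_le_iff[OF v t, of r] eq by simp
  show "v t \<le> ennreal r"
  proof (rule ccontr)
    assume a: "\<not> v t \<le> ennreal r"
    then have m: "t \<in> {t. t < \<infinity> \<and> ennreal r < v t}" using t by auto
    have "t \<noteq> 0" using a regular_pathD(1)[OF v] by auto
    then have "0 < t" by (simp add: zero_less_iff_neq_zero)
    from open_left[OF open_path_level(2)[OF v] m this] obtain b where
      b: "b < t" "{b<..t} \<subseteq> {t. t < \<infinity> \<and> ennreal r < v t}" by auto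
    obtain t' where t': "b < t'" "t' < t" using dense[OF b(1)] by auto
    then have "t' \<in> {b<..t}" by simp
    from subsetD[OF b(2) this] have "ennreal r < v t'" "t' < \<infinity>" by auto
    then have "level_time v r \<le> t'" using level_time_le_iff[OF v] by auto
    then show False using eq t' by auto
  qed
qed

lemma measurable_level_time:
  assumes "regular_path v"
  shows "level_time v \<in> borel_measurable borel"
proof (rule borel_measurableI_le)
  fix y :: ennreal
  show "{r \<in> space borel. level_time v r \<le> y} \<in> sets borel"
    by (cases "y < \<infinity>") (auto simp: level_time_le_iff[OF assms] not_less top_unique)
qed

lemma measurable_path_integrand:
  fixes y :: "ennreal \<Rightarrow> ennreal"
  assumes v: "regular_path v" and y: "y \<in> borel_measurable borel"
  shows "(\<lambda>r. indicator {0<..} r * (if level_time v r \<le> t then y (level_time v r) else 0)) \<in> borel_measurable borel"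
proof -
  have [measurable]: "Measurable.pred borel (\<lambda>r. level_time v r \<le> t)"
    using measurable_sets[OF measurable_level_time[OF v], of "{..t}"] by (simp add: pred_def vimage_def)
  have [measurable]: "(\<lambda>r. y (level_time v r)) \<in> borel_measurable borel"
    by (rule measurable_compose[OF measurable_level_time[OF v] y])
  show ?thesis by measurable
qed

lemma path_integral_mono:
  "s \<le> t \<Longrightarrow> path_integral v y s \<le> path_integral v y t"
  unfolding path_integral_def by (intro nn_integral_mono mult_left_mono) auto

lemma path_integral_0: "regular_path v \<Longrightarrow> path_integral v y 0 = 0"
proof -
  assume v: "regular_path v"
  have "(\<lambda>r. indicator {0<..} r * (if level_time v r \<le> 0 then y (level_time v r) else 0)) = (\<lambda>r. 0)"
    using level_time_le_iff[OF v, of 0] regular_pathD(1)[OF v] by (auto simp: indicator_def fun_eq_iff)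
  then show ?thesis unfolding path_integral_def by (simp only: nn_integral_const mult_zero_left)
qed

text \<open>Finite upper bounds separate the points of \<open>[0,\<infinity>]\<close>; they are the
  only ones for which \<open>level_time_le_iff\<close> is available.\<close>

lemma ennreal_eqI_le:
  fixes a b :: ennreal
  assumes "\<And>y. y < \<infinity> \<Longrightarrow> a \<le> y \<longleftrightarrow> b \<le> y"
  shows "a = b"
proof (rule ccontr)
  assume "a \<noteq> b"
  then consider "a < b" | "b < a" by fastforce
  then show False
  proof cases
    case 1
    obtain y where "a < y" "y < b" using dense[OF 1] by auto
    moreover from this have "y < \<infinity>" by (metis infinity_ennreal_def less_le_trans top_greatest)
    ultimately show False using assms[of y] by auto
  next
    case 2
    obtain y where "b < y" "y < a" using dense[OF 2] by auto
    moreover from this have "y < \<infinity>" by (metis infinity_ennreal_def less_le_trans top_greatest)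
    ultimately show False using assms[of y] by auto
  qed
qed

text \<open>Levels up to \<open>v t\<close> are passed by time \<open>t\<close>, and the level
  \<open>v t + r\<close> is passed \<open>level_time w r\<close> later. Splitting the levels at the
  finite value \<open>v t\<close> and translating the upper part gives the two terms.\<close>

lemma path_integral_add:
  assumes v: "regular_path v" and w: "regular_path w"
    and y: "y \<in> borel_measurable borel" and y': "y' \<in> borel_measurable borel"
    and t: "t < \<infinity>" "v t < \<infinity>"
    and add: "\<And>s. s < \<infinity> \<Longrightarrow> v (t + s) = v t + w s"
    and shift: "\<And>s. y (t + s) = y' s"
  shows "path_integral v y (t + s) = path_integral v y t + path_integral w y' s"
proof -
  obtain c where c: "v t = ennreal c" "0 \<le> c" using t by (cases "v t") auto
  have lt: "level_time v (c + r) = t + level_time w r" if r: "0 < r" for r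
  proof (rule ennreal_eqI_le)
    fix u :: ennreal assume u: "u < \<infinity>"
    show "level_time v (c + r) \<le> u \<longleftrightarrow> t + level_time w r \<le> u"
    proof (cases "t \<le> u")
      case True
      then obtain d where d: "u = t + d" by (metis add_diff_inverse_ennreal)
      then have "d < \<infinity>" using u by (auto simp: less_top[symmetric])
      then have "level_time v (c + r) \<le> u \<longleftrightarrow> ennreal c + ennreal r \<le> ennreal c + w d"
        using level_time_le_iff[OF v u, of "c + r"] add[of d] c r by (simp add: d)
      also have "\<dots> \<longleftrightarrow> level_time w r \<le> d"
        using level_time_le_iff[OF w \<open>d < \<infinity>\<close>, of r] by (simp add: ennreal_add_left_cancel_le)
      also have "\<dots> \<longleftrightarrow> t + level_time w r \<le> u"
        using t(1) by (auto simp: d ennreal_add_left_cancel_le)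
      finally show ?thesis .
    next
      case False
      then have "v u \<le> ennreal c" using regular_pathD(2)[OF v, of u t] t c by auto
      moreover have "ennreal c < ennreal (c + r)" using r c by (simp add: ennreal_less_iff)
      ultimately have "\<not> level_time v (c + r) \<le> u"
        using level_time_le_iff[OF v u, of "c + r"] by auto
      moreover have "\<not> t + level_time w r \<le> u" using False by (meson le_iff_add order_trans)
      ultimately show ?thesis by simp
    qed
  qed
  let ?g = "\<lambda>r. indicator {0<..} r * (if level_time w r \<le> s then y' (level_time w r) else 0)"
  have "indicator {0<..} r * (if level_time v r \<le> t + s then y (level_time v r) else 0) =
    indicator {0<..} r * (if level_time v r \<le> t then y (level_time v r) else 0) + ?g (- c + 1 * r)" for r
  proof (cases "r \<le> c")
    case True
    then have "ennreal r \<le> v t" using c by (simp add: ennreal_leI)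
    then have "level_time v r \<le> t" using level_time_le_iff[OF v t(1)] by simp
    then show ?thesis using True by (auto intro: order_trans)
  next
    case False
    then have 1: "level_time v r = t + level_time w (- c + r)" using lt[of "r - c"] by simp
    have "\<not> ennreal r \<le> v t" using False c by (simp add: ennreal_le_iff)
    then have "\<not> level_time v r \<le> t" using level_time_le_iff[OF v t(1)] by simp
    moreover have "t + level_time w (- c + r) \<le> t + s \<longleftrightarrow> level_time w (- c + r) \<le> s"
      using t(1) by (auto simp: ennreal_add_left_cancel_le)
    ultimately show ?thesis using False c by (simp add: 1 shift)
  qed
  then have "path_integral v y (t + s) = (\<integral>\<^sup>+r. indicator {0<..} r *
      (if level_time v r \<le> t then y (level_time v r) else 0) + ?g (- c + 1 * r) \<partial>lborel)"
    unfolding path_integral_def by (rule nn_integral_cong)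
  also have "\<dots> = path_integral v y t + (\<integral>\<^sup>+r. ?g (- c + 1 * r) \<partial>lborel)"
    unfolding path_integral_def
  proof (rule nn_integral_add)
    show "(\<lambda>r. indicator {0<..} r * (if level_time v r \<le> t then y (level_time v r) else 0)) \<in> borel_measurable lborel"
      using measurable_path_integrand[OF v y, of t] by simp
    show "(\<lambda>r. ?g (- c + 1 * r)) \<in> borel_measurable lborel"
      by (rule measurable_compose[OF _ measurable_path_integrand[OF w y', of s]]) simp
  qed
  also have "(\<integral>\<^sup>+r. ?g (- c + 1 * r) \<partial>lborel) = path_integral w y' s"
    unfolding path_integral_def
    using nn_integral_real_affine[OF measurable_path_integrand[OF w y', of s], of 1 "- c"] by simp
  finally show ?thesis .
qed

lemma nn_integral_level: "(\<integral>\<^sup>+r. indicator {0<..} r * indicator {r. ennreal r \<le> ennreal c} r \<partial>lborel) = ennreal c"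
proof -
  have "(\<integral>\<^sup>+r. indicator {0<..} r * indicator {r. ennreal r \<le> ennreal c} r \<partial>lborel) =
      (\<integral>\<^sup>+r. indicator {0<..max 0 c} r \<partial>lborel)"
    by (intro nn_integral_cong) (auto simp: indicator_def ennreal_le_iff2)
  also have "\<dots> = ennreal c" by (simp add: max_def ennreal_neg)
  finally show ?thesis .
qed

lemma path_integral_le:
  assumes v: "regular_path v" and t: "t < \<infinity>" and y: "\<And>s. y s \<le> 1"
  shows "path_integral v y t \<le> v t"
proof (cases "v t")
  case (real c)
  have "path_integral v y t \<le> (\<integral>\<^sup>+r. indicator {0<..} r * indicator {r. ennreal r \<le> ennreal c} r \<partial>lborel)"
    unfolding path_integral_def
    using level_time_le_iff[OF v t] y by (intro nn_integral_mono mult_left_mono) (auto simp: real)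
  then show ?thesis by (simp only: nn_integral_level real)
qed simp

lemma path_integral_eq:
  assumes v: "regular_path v" and t: "t < \<infinity>" "v t < \<infinity>" and y: "\<And>s. s \<le> t \<Longrightarrow> y s = 1"
  shows "path_integral v y t = v t"
proof -
  obtain c where c: "v t = ennreal c" using t by (cases "v t") auto
  have "path_integral v y t = (\<integral>\<^sup>+r. indicator {0<..} r * indicator {r. ennreal r \<le> ennreal c} r \<partial>lborel)"
    unfolding path_integral_def
    using level_time_le_iff[OF v t(1)] y by (intro nn_integral_cong) (auto simp: c)
  then show ?thesis by (simp only: nn_integral_level c)
qed

text \<open>Levels that are never reached have level time \<open>\<infinity>\<close>; they would be
  counted on the left but at no finite time, and \<open>y \<infinity> = 0\<close> removes
  them.\<close>

lemma path_integral_infinity: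
  assumes v: "regular_path v" and y: "y \<in> borel_measurable borel" and y0: "y \<infinity> = 0"
  shows "path_integral v y \<infinity> = (SUP n. path_integral v y (of_nat n))"
proof -
  let ?g = "\<lambda>t r. indicator {0<..} r * (if level_time v r \<le> t then y (level_time v r) else 0)"
  have "(SUP n. ?g (of_nat n) r) = ?g \<infinity> r" for r
  proof (rule antisym)
    show "(SUP n. ?g (of_nat n) r) \<le> ?g \<infinity> r" by (intro SUP_least mult_left_mono) auto
    show "?g \<infinity> r \<le> (SUP n. ?g (of_nat n) r)"
    proof (cases "level_time v r < \<infinity>")
      case True
      then obtain n where "level_time v r \<le> of_nat n"
        using ennreal_Ex_less_of_nat[of "level_time v r"] by (auto intro: less_imp_le)
      then show ?thesis by (intro SUP_upper2[of n]) auto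
    next
      case False
      then show ?thesis using y0 by (simp add: less_top[symmetric])
    qed
  qed
  then have "path_integral v y \<infinity> = (\<integral>\<^sup>+r. (SUP n. ?g (of_nat n) r) \<partial>lborel)"
    unfolding path_integral_def by simp
  also have "\<dots> = (SUP n. path_integral v y (of_nat n))"
    unfolding path_integral_def
  proof (rule nn_integral_monotone_convergence_SUP)
    show "incseq (\<lambda>n. ?g (of_nat n))"
      by (auto simp: incseq_def le_fun_def indicator_def dest: order_trans[OF _ of_nat_mono])
  qed (use measurable_path_integrand[OF v y] in simp)
  finally show ?thesis .
qed

text \<open>Dominated convergence over the levels, with the integrand at \<open>\<infinity>\<close>
  as majorant. The integrand can jump at time \<open>a\<close> only for a level reached exactly at
  \<open>a\<close>, that is for the single level \<open>v a\<close>.\<close>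

lemma path_integral_continuous:
  assumes v: "regular_path v" and y: "y \<in> borel_measurable borel" and fin: "path_integral v y \<infinity> < \<infinity>"
  shows "continuous_on {0..} (\<lambda>t. path_integral v y (ennreal t))"
  unfolding continuous_on_sequentially
proof safe
  fix a :: real and x :: "nat \<Rightarrow> real" assume x: "\<forall>n. x n \<in> {0..}" "0 \<le> a" "x \<longlonglongrightarrow> a"
  let ?g = "\<lambda>t r. indicator {0<..} r * (if level_time v r \<le> t then y (level_time v r) else 0)"
  note m = measurable_path_integrand[OF v y]
  have xe: "(\<lambda>n. ennreal (x n)) \<longlonglongrightarrow> ennreal a" by (rule tendsto_ennrealI[OF x(3)])
  have "AE r in lborel. r \<noteq> enn2real (v (ennreal a))" by (rule AE_lborel_singleton)
  then have "AE r in lborel. (\<lambda>n. ?g (ennreal (x n)) r) \<longlonglongrightarrow> ?g (ennreal a) r"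
  proof eventually_elim
    case (elim r)
    show ?case
    proof (cases "0 < r")
      case True
      have ne: "level_time v r \<noteq> ennreal a"
        using level_time_eq[OF v _ True, of "ennreal a"] elim True by auto
      then consider "level_time v r < ennreal a" | "ennreal a < level_time v r" by fastforce
      then have "\<forall>\<^sub>F n in sequentially. ?g (ennreal (x n)) r = ?g (ennreal a) r"
      proof cases
        case 1
        from order_tendstoD(1)[OF xe 1] show ?thesis by eventually_elim (use 1 in auto)
      next
        case 2
        from order_tendstoD(2)[OF xe 2] show ?thesis by eventually_elim (use 2 in auto)
      qed
      then show ?thesis by (rule tendsto_eventually)
    qed simp
  qed
  then have "(\<lambda>n. \<integral>\<^sup>+r. ?g (ennreal (x n)) r \<partial>lborel) \<longlonglongrightarrow> (\<integral>\<^sup>+r. ?g (ennreal a) r \<partial>lborel)"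
    by (intro nn_integral_dominated_convergence[where w = "?g \<infinity>"])
      (use m m[of \<infinity>] fin in \<open>auto simp: path_integral_def intro!: AE_I2 mult_left_mono\<close>)
  then show "((\<lambda>t. path_integral v y (ennreal t)) \<circ> x) \<longlonglongrightarrow> path_integral v y (ennreal a)"
    unfolding path_integral_def comp_def .
qed

text \<open>The Stieltjes measure is the image of Lebesgue measure on the levels up to
  \<open>v (ennreal s)\<close> under the inverse of \<open>v\<close>, because both have the
  distribution function \<open>F\<close>.\<close>

lemma nn_integral_interval_measure_path:
  assumes v: "regular_path v" and y: "y \<in> borel_measurable borel"
    and s: "0 \<le> s" "v (ennreal s) < \<infinity>"
  shows "(\<integral>\<^sup>+u\<in>{0..s}. y (ennreal u) \<partial>interval_measure (\<lambda>u. enn2real (v (ennreal (min u s))))) =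
    path_integral v y (ennreal s)"
proof -
  define F where "F = (\<lambda>u. enn2real (v (ennreal (min u s))))"
  obtain c where c: "v (ennreal s) = ennreal c" "0 \<le> c" using s by (cases "v (ennreal s)") auto
  have le_c: "v (ennreal (min u s)) \<le> ennreal c" for u
    using regular_pathD(2)[OF v, of "ennreal (min u s)" "ennreal s"] c by (simp add: ennreal_leI)
  have vF: "v (ennreal (min u s)) = ennreal (F u)" for u
    unfolding F_def using le_c[of u] by (metis ennreal_enn2real ennreal_less_top le_less_trans infinity_ennreal_def)
  have F0: "0 \<le> F u" for u unfolding F_def by simp
  have Fc: "F u \<le> c" for u using le_c[of u] vF[of u] c(2) F0[of u] by (simp add: ennreal_le_iff)
  have mono: "F u \<le> F u'" if "u \<le> u'" for u u'
  proof -
    have "v (ennreal (min u s)) \<le> v (ennreal (min u' s))"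
      by (rule regular_pathD(2)[OF v]) (use that in \<open>auto intro!: ennreal_leI\<close>)
    then show ?thesis unfolding vF using F0 by (simp add: ennreal_le_iff)
  qed
  have Fneg: "F u = 0" if "u \<le> 0" for u
    using that regular_pathD(1)[OF v] unfolding F_def by (simp add: ennreal_neg min_def)
  have Fs: "F u = c" if "s \<le> u" for u using that c unfolding F_def by (simp add: min_def)
  have cont: "isCont F a" for a
  proof -
    have "continuous_on UNIV (\<lambda>u. v (ennreal (min u s)))"
      by (rule continuous_on_compose2[OF regular_pathD(3)[OF v]])
        (auto intro!: continuous_on_ennreal continuous_intros)
    then have "isCont (\<lambda>u. v (ennreal (min u s))) a" by (simp add: continuous_on_eq_continuous_at)
    then have "((\<lambda>u. ennreal (F u)) \<longlongrightarrow> ennreal (F a)) (at a)" unfolding isCont_def vF .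
    then show ?thesis unfolding isCont_def
      by (rule tendsto_ennrealD) (use F0 in auto)
  qed
  have bot: "(F \<longlongrightarrow> 0) at_bot"
    by (rule tendsto_eventually) (use Fneg in \<open>auto simp: eventually_at_bot_linorder\<close>)
  have top: "(F \<longlongrightarrow> c) at_top"
    by (rule tendsto_eventually) (use Fs in \<open>auto simp: eventually_at_top_linorder\<close>)
  let ?D = "density lborel (indicator {0<..c})"
  let ?\<psi> = "\<lambda>r. enn2real (level_time v r)"
  let ?\<kappa> = "distr ?D borel ?\<psi>"
  have \<psi>[measurable]: "?\<psi> \<in> borel_measurable borel" using measurable_level_time[OF v] by measurable
  have le: "level_time v r \<le> ennreal s" if "r \<le> c" for r
    using level_time_le_iff[OF v, of "ennreal s" r] that c by (simp add: ennreal_leI)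
  \<comment> \<open>The Galois connection read in the real numbers; it gives the distribution
    function of \<open>?\<kappa>\<close>.\<close>
  have \<psi>_le: "?\<psi> r \<le> b \<longleftrightarrow> r \<le> F b" if r: "0 < r" "r \<le> c" for r b
  proof (cases "0 \<le> b")
    case True
    have "level_time v r = ennreal (?\<psi> r)" using le[OF r(2)]
      by (metis ennreal_enn2real ennreal_less_top le_less_trans)
    then have "?\<psi> r \<le> b \<longleftrightarrow> level_time v r \<le> ennreal b"
      using True by (metis enn2real_leI ennreal_leI)
    also have "\<dots> \<longleftrightarrow> level_time v r \<le> ennreal (min b s)"
      using le[OF r(2)] by (auto simp: min_def intro: order_trans[OF _ ennreal_leI])
    also have "\<dots> \<longleftrightarrow> r \<le> F b"
      using level_time_le_iff[OF v, of "ennreal (min b s)" r] F0[of b] by (simp add: vF ennreal_le_iff)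
    finally show ?thesis .
  next
    case False
    then have "F b = 0" "\<not> ?\<psi> r \<le> b" using Fneg[of b] order_trans[OF enn2real_nonneg[of "level_time v r"]] by auto
    then show ?thesis using r by simp
  qed
  have "interval_measure F = ?\<kappa>"
  proof (rule cdf_unique')
    show "finite_borel_measure (interval_measure F)"
      using finite_borel_measure_interval_measure[of F c] mono cont bot top c(2)
        continuous_at_imp_continuous_at_within by blast
    have "finite_measure ?\<kappa>"
      by (rule finite_measureI) (use c(2) in \<open>simp add: emeasure_distr emeasure_restricted\<close>)
    then show "finite_borel_measure ?\<kappa>"
      by (simp add: finite_borel_measure_def finite_borel_measure_axioms_def)
    have "cdf ?\<kappa> b = F b" for b
    proof -
      have "emeasure ?\<kappa> {..b} = emeasure ?D {r. ?\<psi> r \<le> b}"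
        by (subst emeasure_distr) (auto intro!: arg_cong2[where f = emeasure])
      also have "\<dots> = emeasure lborel ({0<..c} \<inter> {r. ?\<psi> r \<le> b})"
        by (subst emeasure_restricted) auto
      also have "{0<..c} \<inter> {r. ?\<psi> r \<le> b} = {0<..F b}"
        using \<psi>_le Fc[of b] by (auto intro: order_trans)
      finally show ?thesis using F0[of b] by (simp add: cdf_def measure_def)
    qed
    moreover have "cdf (interval_measure F) = F"
      using mono cont bot continuous_at_imp_continuous_at_within by (intro cdf_interval_measure) blast+
    ultimately show "cdf (interval_measure F) = cdf ?\<kappa>" by auto
  qed
  then have "(\<integral>\<^sup>+u\<in>{0..s}. y (ennreal u) \<partial>interval_measure F) = (\<integral>\<^sup>+u\<in>{0..s}. y (ennreal u) \<partial>?\<kappa>)"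
    by simp
  also have "\<dots> = (\<integral>\<^sup>+r. indicator {0<..c} r * (y (ennreal (?\<psi> r)) * indicator {0..s} (?\<psi> r)) \<partial>lborel)"
    using y by (subst nn_integral_distr; (subst nn_integral_density)?) (auto intro!: measurable_compose[OF \<psi>])
  also have "\<dots> = path_integral v y (ennreal s)"
    unfolding path_integral_def
  proof (rule nn_integral_cong)
    fix r :: real
    have iff: "level_time v r \<le> ennreal s \<longleftrightarrow> r \<le> c"
      using level_time_le_iff[OF v, of "ennreal s" r] c by (simp add: ennreal_le_iff)
    show "indicator {0<..c} r * (y (ennreal (?\<psi> r)) * indicator {0..s} (?\<psi> r)) =
      indicator {0<..} r * (if level_time v r \<le> ennreal s then y (level_time v r) else 0)"
    proof (cases "0 < r \<and> r \<le> c")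
      case True
      then have "level_time v r \<le> ennreal s" using iff by simp
      moreover from this have "ennreal (?\<psi> r) = level_time v r"
        by (metis ennreal_enn2real ennreal_less_top le_less_trans)
      moreover have "?\<psi> r \<le> s" using \<psi>_le[of r s] True Fs[of s] by simp
      ultimately show ?thesis using True by simp
    qed (use iff in auto)
  qed
  finally show ?thesis unfolding F_def .
qed

section \<open>Uniqueness of continuous additive processes\<close>

text \<open>Discrete integration by parts. Adding the sum \<open>?q\<close> of products of
  simultaneous increments makes everything telescope to \<open>a T * b T\<close>, and
  \<open>?q\<close> is at most \<open>a T\<close> times the oscillation of \<open>b\<close> over one
  step, which tends to 0 by uniform continuity.\<close>

lemma product_sums_LIMSEQ:
  fixes a b :: "real \<Rightarrow> real"
  assumes T: "0 \<le> T" and mono: "mono_on {0..T} a" "mono_on {0..T} b" and cont: "continuous_on {0..T} b"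
    and zero: "a 0 = 0" "b 0 = 0"
  defines "t n i \<equiv> T * real i / real (Suc n)"
  shows "(\<lambda>n. (\<Sum>i<Suc n. (a (t n (Suc i)) - a (t n i)) * (b T - b (t n (Suc i))) +
      (b (t n (Suc i)) - b (t n i)) * (a T - a (t n (Suc i))))) \<longlonglongrightarrow> a T * b T"
proof -
  let ?s = "\<lambda>n. \<Sum>i<Suc n. (a (t n (Suc i)) - a (t n i)) * (b T - b (t n (Suc i))) +
      (b (t n (Suc i)) - b (t n i)) * (a T - a (t n (Suc i)))"
  let ?q = "\<lambda>n. \<Sum>i<Suc n. (a (t n (Suc i)) - a (t n i)) * (b (t n (Suc i)) - b (t n i))"
  have t0: "t n 0 = 0" and tn: "t n (Suc n) = T" for n
    unfolding t_def by (simp_all del: of_nat_Suc)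
  have t_in: "t n i \<in> {0..T}" if "i \<le> Suc n" for n i
  proof -
    have "T * (real i / real (Suc n)) \<le> T * 1"
      using that T by (intro mult_left_mono) (simp_all del: of_nat_Suc add: divide_le_eq_1)
    then show ?thesis unfolding t_def using T by simp
  qed
  have t_le: "t n i \<le> t n (Suc i)" for n i
    unfolding t_def using T by (intro divide_right_mono mult_left_mono) auto
  have step: "t n (Suc i) - t n i = T / real (Suc n)" for n i
  proof -
    have "T * real (Suc i) - T * real i = T" by (simp add: algebra_simps)
    then show ?thesis unfolding t_def diff_divide_distrib[symmetric] by simp
  qed
  have da: "0 \<le> a (t n (Suc i)) - a (t n i)" and db: "0 \<le> b (t n (Suc i)) - b (t n i)" if "i < Suc n" for n i
    using mono_onD[OF mono(1) t_in[of i n] t_in[of "Suc i" n] t_le]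
      mono_onD[OF mono(2) t_in[of i n] t_in[of "Suc i" n] t_le] that by auto
  have tel: "?s n + ?q n = a T * b T" for n
  proof -
    have "?s n + ?q n = (\<Sum>i<Suc n. (a T - a (t n i)) * (b T - b (t n i)) -
        (a T - a (t n (Suc i))) * (b T - b (t n (Suc i))))"
      unfolding sum.distrib[symmetric] by (intro sum.cong) (auto simp: algebra_simps)
    also have "\<dots> = a T * b T"
      unfolding sum_lessThan_telescope'[of "\<lambda>i. (a T - a (t n i)) * (b T - b (t n i))" "Suc n"]
      by (simp only: t0 tn zero) simp
    finally show ?thesis .
  qed
  have "?q \<longlonglongrightarrow> 0"
  proof (rule LIMSEQ_I)
    fix e :: real assume e: "0 < e"
    have aT: "0 \<le> a T" using mono_onD[OF mono(1), of 0 T] T zero by auto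
    \<comment> \<open>The added 1 keeps the divisor positive when \<open>a T = 0\<close> and makes
      the final bound strict.\<close>
    define e' where "e' = e / (a T + 1)"
    have e': "0 < e'" unfolding e'_def using e aT by simp
    have "uniformly_continuous_on {0..T} b" by (rule compact_uniformly_continuous[OF cont]) simp
    then obtain d where d: "d > 0" "\<And>x x'. x \<in> {0..T} \<Longrightarrow> x' \<in> {0..T} \<Longrightarrow> dist x' x < d \<Longrightarrow> dist (b x') (b x) < e'"
      using e' unfolding uniformly_continuous_on_def by metis
    have "(\<lambda>n. T / real (Suc n)) \<longlonglongrightarrow> 0"
      using LIMSEQ_Suc[OF lim_const_over_n[of T]] by simp
    then obtain n0 where n0: "\<And>n. n \<ge> n0 \<Longrightarrow> T / real (Suc n) < d"
      using d(1) T by (auto simp: LIMSEQ_def dist_real_def)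
    show "\<exists>no. \<forall>n\<ge>no. norm (?q n - 0) < e"
    proof (intro exI[of _ n0] allI impI)
      fix n assume n: "n0 \<le> n"
      have q0: "0 \<le> ?q n" by (intro sum_nonneg mult_nonneg_nonneg da db) auto
      have "?q n \<le> (\<Sum>i<Suc n. (a (t n (Suc i)) - a (t n i)) * e')"
      proof (intro sum_mono mult_left_mono da)
        fix i assume i: "i \<in> {..<Suc n}"
        have "dist (t n (Suc i)) (t n i) < d"
          using n0[OF n] step[of n i] t_le[of n i] by (simp add: dist_real_def)
        then have "dist (b (t n (Suc i))) (b (t n i)) < e'"
          using d(2)[OF t_in[of i n] t_in[of "Suc i" n]] i by auto
        then show "b (t n (Suc i)) - b (t n i) \<le> e'" by (simp add: dist_real_def)
      qed auto
      also have "\<dots> = a T * e'"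
        unfolding sum_distrib_right[symmetric] sum_lessThan_telescope[of "\<lambda>i. a (t n i)" "Suc n"]
        by (simp only: t0 tn zero) simp
      also have "\<dots> < (a T + 1) * e'" using e' by simp
      also have "\<dots> = e" unfolding e'_def using aT by simp
      finally show "norm (?q n - 0) < e" using q0 by simp
    qed
  qed
  then have "(\<lambda>n. a T * b T - ?q n) \<longlonglongrightarrow> a T * b T - 0" by (intro tendsto_diff tendsto_const)
  moreover have "?s n = a T * b T - ?q n" for n using tel[of n] by linarith
  ultimately show ?thesis by (simp only: diff_zero)
qed

context hunt begin

text \<open>An event of \<open>F \<infinity>\<close> has an approximant for the law of
  \<open>X t\<close> as initial law. The error set pulls back to a null set, since the shifted path
  has precisely the law started from there.\<close>

lemma measurable_shift_F: "\<theta> t \<in> Q z \<rightarrow>\<^sub>M F \<infinity>"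
proof (rule measurableI)
  fix S assume "S \<in> sets (F \<infinity>)"
  from augmented_sets[OF distr_shift_bind(2) this] obtain S' where
    S': "S' \<in> sets (N \<infinity>)" "(S - S') \<union> (S' - S) \<in> null_sets (completion (distr (Q z) (N \<infinity>) (\<theta> t)))"
    unfolding distr_shift_bind(1) by blast
  then obtain Z where Z: "Z \<in> null_sets (distr (Q z) (N \<infinity>) (\<theta> t))" "(S - S') \<union> (S' - S) \<subseteq> Z"
    unfolding null_sets_completion_iff2 by blast
  have sh: "\<theta> t \<in> Q z \<rightarrow>\<^sub>M N \<infinity>"
    using measurable_completion[of "\<theta> t" "P z"] shift_measurable by (simp cong: measurable_cong_sets)
  have n: "\<theta> t -` Z \<in> null_sets (Q z)"
    using Z(1) sh null_sets_distr_iff[OF sh, of Z] by simp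
  have "\<theta> t -` (S - S') \<subseteq> \<theta> t -` Z" "\<theta> t -` (S' - S) \<subseteq> \<theta> t -` Z"
    using Z(2) by (simp_all add: vimage_mono)
  from this[THEN null_sets_completion_subset, OF n]
  have "\<theta> t -` (S - S') \<in> sets (Q z)" "\<theta> t -` (S' - S) \<in> sets (Q z)" using null_setsD2 by blast+
  moreover have "\<theta> t -` S' \<in> sets (Q z)" using measurable_sets[OF sh S'(1)] by simp
  moreover have "\<theta> t -` S = (\<theta> t -` S' - \<theta> t -` (S' - S)) \<union> \<theta> t -` (S - S')" by auto
  ultimately show "\<theta> t -` S \<inter> space (Q z) \<in> sets (Q z)"
    by (simp only: space_completion space_P Int_UNIV_right) (intro sets.Un sets.Diff)
qed simp

text \<open>Admitting \<open>s = \<infinity>\<close> splits the total at every finite time, which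
  transfers equal expectations of the totals to finite times. Continuity is asked only of paths with
  finite total, which are almost all paths once the expected total is bounded.\<close>

definition additive_process :: "(ennreal \<Rightarrow> 'w \<Rightarrow> ennreal) \<Rightarrow> bool" where
  "additive_process K \<longleftrightarrow>
    (\<forall>t. K t \<in> borel_measurable (F t)) \<and>
    (\<forall>\<omega> s t. s \<le> t \<longrightarrow> K s \<omega> \<le> K t \<omega>) \<and>
    (\<forall>\<omega>. K 0 \<omega> = 0) \<and>
    (\<forall>z. AE \<omega> in Q z. \<forall>t<\<infinity>. \<forall>s. K (t + s) \<omega> = K t \<omega> + K s (\<theta> t \<omega>)) \<and>
    (\<forall>\<omega>. K \<infinity> \<omega> < \<infinity> \<longrightarrow> continuous_on {0..} (\<lambda>t. K (ennreal t) \<omega>))"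

lemma additive_processD:
  assumes "additive_process K"
  shows "K t \<in> borel_measurable (F t)" "s \<le> t \<Longrightarrow> K s \<omega> \<le> K t \<omega>" "K 0 \<omega> = 0"
    "AE \<omega> in Q z. \<forall>t<\<infinity>. \<forall>s. K (t + s) \<omega> = K t \<omega> + K s (\<theta> t \<omega>)"
    "K \<infinity> \<omega> < \<infinity> \<Longrightarrow> continuous_on {0..} (\<lambda>t. K (ennreal t) \<omega>)"
  using assms unfolding additive_process_def by simp_all

lemma measurable_additive_process:
  assumes "additive_process K"
  shows "K t \<in> borel_measurable (Q z)" "(\<lambda>\<omega>. K s (\<theta> t \<omega>)) \<in> borel_measurable (Q z)"
proof -
  show "K t \<in> borel_measurable (Q z)" by (rule measurable_FQ[OF additive_processD(1)[OF assms]])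
  have "K s \<in> borel_measurable (F \<infinity>)"
    by (rule measurable_F_mono[OF additive_processD(1)[OF assms]]) simp
  from measurable_compose[OF measurable_shift_F this]
  show "(\<lambda>\<omega>. K s (\<theta> t \<omega>)) \<in> borel_measurable (Q z)" .
qed

lemma additive_process_markov:
  assumes K: "additive_process K" and H: "H \<in> borel_measurable (F t)"
  shows "(\<integral>\<^sup>+\<omega>. H \<omega> * K s (\<theta> t \<omega>) \<partial>Q z) = (\<integral>\<^sup>+\<omega>. H \<omega> * integral\<^sup>N (Q (X t \<omega>)) (K s) \<partial>Q z)"
  by (rule markov_property[OF H measurable_F_mono[OF additive_processD(1)[OF K]]]) simp

lemma AE_additive_process_finite:
  assumes K: "additive_process K" and c: "integral\<^sup>N (Q z) (K \<infinity>) \<le> ennreal c"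
  shows "AE \<omega> in Q z. K \<infinity> \<omega> < \<infinity>"
proof -
  have "integral\<^sup>N (Q z) (K \<infinity>) \<noteq> \<infinity>"
    using le_less_trans[OF c ennreal_less_top] by (simp only: infinity_ennreal_def top.not_eq_extremum)
  from nn_integral_PInf_AE[OF measurable_additive_process(1)[OF K] this]
  show ?thesis by eventually_elim (simp only: infinity_ennreal_def top.not_eq_extremum)
qed

text \<open>The expected total is the expectation up to \<open>t\<close> plus the expected total
  seen from \<open>X t\<close>. The second term is the same for both processes, finite, and
  cancels.\<close>

lemma additive_process_expectation_eq:
  assumes K: "additive_process K" and L: "additive_process L"
    and eq: "\<And>z. integral\<^sup>N (Q z) (K \<infinity>) = integral\<^sup>N (Q z) (L \<infinity>)"
    and c: "\<And>z. integral\<^sup>N (Q z) (K \<infinity>) \<le> ennreal c" and t: "t < \<infinity>"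
  shows "integral\<^sup>N (Q z) (K t) = integral\<^sup>N (Q z) (L t)"
proof -
  define b where "b = (\<integral>\<^sup>+\<omega>. integral\<^sup>N (Q (X t \<omega>)) (K \<infinity>) \<partial>Q z)"
  have dec: "integral\<^sup>N (Q z) (A \<infinity>) = integral\<^sup>N (Q z) (A t) + (\<integral>\<^sup>+\<omega>. integral\<^sup>N (Q (X t \<omega>)) (A \<infinity>) \<partial>Q z)"
    if A: "additive_process A" for A
  proof -
    have "integral\<^sup>N (Q z) (A \<infinity>) = (\<integral>\<^sup>+\<omega>. A t \<omega> + A \<infinity> (\<theta> t \<omega>) \<partial>Q z)"
    proof (rule nn_integral_cong_AE)
      show "AE \<omega> in Q z. A \<infinity> \<omega> = A t \<omega> + A \<infinity> (\<theta> t \<omega>)"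
        using additive_processD(4)[OF A, of z]
      proof eventually_elim
        case (elim \<omega>)
        from elim[rule_format, OF t, of \<infinity>] show ?case by simp
      qed
    qed
    also have "\<dots> = integral\<^sup>N (Q z) (A t) + (\<integral>\<^sup>+\<omega>. A \<infinity> (\<theta> t \<omega>) \<partial>Q z)"
      by (intro nn_integral_add measurable_additive_process[OF A])
    also have "(\<integral>\<^sup>+\<omega>. A \<infinity> (\<theta> t \<omega>) \<partial>Q z) = (\<integral>\<^sup>+\<omega>. integral\<^sup>N (Q (X t \<omega>)) (A \<infinity>) \<partial>Q z)"
      using additive_process_markov[OF A, where H = "\<lambda>_. 1" and t = t and s = \<infinity> and z = z] by simp
    finally show ?thesis .
  qed
  have "integral\<^sup>N (Q z) (K t) + b = integral\<^sup>N (Q z) (L t) + b"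
    using trans[OF dec[OF K, symmetric] trans[OF eq dec[OF L]]] unfolding b_def by (simp only: eq)
  moreover have "b \<noteq> \<top>"
  proof -
    have "b \<le> integral\<^sup>N (Q z) (K \<infinity>)" unfolding dec[OF K] b_def by simp
    from le_less_trans[OF order_trans[OF this c] ennreal_less_top]
    show ?thesis by (simp only: top.not_eq_extremum)
  qed
  ultimately show ?thesis
    using ennreal_add_left_cancel[of b "integral\<^sup>N (Q z) (K t)" "integral\<^sup>N (Q z) (L t)"]
    by (simp only: add.commute[of _ b] infinity_ennreal_def) blast
qed

text \<open>A Riemann sum for the integral of the remaining increment of \<open>B\<close> against
  \<open>A\<close>. The remainder is written through the shift at the right end point of each step,
  where the increment of \<open>A\<close> is already known, so that the Markov property applies term
  by term.\<close>

definition product_sum ::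
  "real \<Rightarrow> (ennreal \<Rightarrow> 'w \<Rightarrow> ennreal) \<Rightarrow> (ennreal \<Rightarrow> 'w \<Rightarrow> ennreal) \<Rightarrow> nat \<Rightarrow> 'w \<Rightarrow> ennreal" where
  "product_sum T A B n \<omega> = (\<Sum>i<Suc n.
    (A (ennreal (T * real (Suc i) / real (Suc n))) \<omega> - A (ennreal (T * real i / real (Suc n))) \<omega>) *
     B (ennreal (T - T * real (Suc i) / real (Suc n))) (\<theta> (ennreal (T * real (Suc i) / real (Suc n))) \<omega>))"

lemma measurable_increment:
  assumes A: "additive_process A" and T: "0 \<le> T"
  shows "(\<lambda>\<omega>. A (ennreal (T * real (Suc i) / real (Suc n))) \<omega> - A (ennreal (T * real i / real (Suc n))) \<omega>)
    \<in> borel_measurable (F (ennreal (T * real (Suc i) / real (Suc n))))"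
proof -
  have "ennreal (T * real i / real (Suc n)) \<le> ennreal (T * real (Suc i) / real (Suc n))"
    using T by (intro ennreal_leI divide_right_mono mult_left_mono) auto
  from measurable_F_mono[OF additive_processD(1)[OF A] this] additive_processD(1)[OF A]
  show ?thesis by (rule borel_measurable_minus_ennreal[rotated])
qed

lemma measurable_product_term:
  assumes A: "additive_process A" and B: "additive_process B" and T: "0 \<le> T"
  shows "(\<lambda>\<omega>. (A (ennreal (T * real (Suc i) / real (Suc n))) \<omega> - A (ennreal (T * real i / real (Suc n))) \<omega>) *
     B s (\<theta> t \<omega>)) \<in> borel_measurable (Q z)"
  by (rule borel_measurable_times_ennreal[OF measurable_FQ[OF measurable_increment[OF A T]]
      measurable_additive_process(2)[OF B]])

lemma measurable_product_sum:
  assumes A: "additive_process A" and B: "additive_process B" and T: "0 \<le> T"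
  shows "product_sum T A B n \<in> borel_measurable (Q z)"
  unfolding product_sum_def by (intro borel_measurable_sum measurable_product_term assms)

text \<open>The right-hand side involves \<open>B\<close> only through its expectations from the
  various states: a process with the same expectations may be substituted for it.\<close>

lemma nn_integral_product_sum:
  assumes A: "additive_process A" and B: "additive_process B" and T: "0 \<le> T"
  shows "integral\<^sup>N (Q z) (product_sum T A B n) = (\<Sum>i<Suc n. \<integral>\<^sup>+\<omega>.
    (A (ennreal (T * real (Suc i) / real (Suc n))) \<omega> - A (ennreal (T * real i / real (Suc n))) \<omega>) *
     (\<integral>\<^sup>+\<omega>'. B (ennreal (T - T * real (Suc i) / real (Suc n))) \<omega>'
        \<partial>Q (X (ennreal (T * real (Suc i) / real (Suc n))) \<omega>)) \<partial>Q z)"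
  unfolding product_sum_def
  by (simp only: nn_integral_sum[OF measurable_product_term[OF A B T]]
      additive_process_markov[OF B measurable_increment[OF A T]])

text \<open>On a path with finite totals both processes are real-valued, monotone and continuous, so
  the discrete integration by parts applies. The first bound serves as majorant; the second controls
  the summed increments in the estimate of second moments.\<close>

lemma AE_product_sum:
  assumes A: "additive_process A" and B: "additive_process B" and T: "0 \<le> T"
    and cA: "\<And>z. integral\<^sup>N (Q z) (A \<infinity>) \<le> ennreal c" and cB: "\<And>z. integral\<^sup>N (Q z) (B \<infinity>) \<le> ennreal c"
  shows "AE \<omega> in Q z. (\<lambda>n. product_sum T A B n \<omega> + product_sum T B A n \<omega>)
      \<longlonglongrightarrow> A (ennreal T) \<omega> * B (ennreal T) \<omega> \<and>
    (\<forall>n. product_sum T A B n \<omega> + product_sum T B A n \<omega> \<le> A (ennreal T) \<omega> * B (ennreal T) \<omega>) \<and>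
    (\<forall>n. (\<Sum>i<Suc n. A (ennreal (T * real (Suc i) / real (Suc n))) \<omega> - A (ennreal (T * real i / real (Suc n))) \<omega>)
       \<le> A (ennreal T) \<omega>)"
  using AE_additive_process_finite[OF A cA, of z] AE_additive_process_finite[OF B cB, of z]
    additive_processD(4)[OF A, of z] additive_processD(4)[OF B, of z]
proof eventually_elim
  case (elim \<omega>)
  define a where "a t = enn2real (A (ennreal t) \<omega>)" for t
  define b where "b t = enn2real (B (ennreal t) \<omega>)" for t
  define t where "t n i = T * real i / real (Suc n)" for n i
  have fin: "A u \<omega> < \<infinity>" "B u \<omega> < \<infinity>" for u
    using additive_processD(2)[OF A, of u \<infinity> \<omega>] additive_processD(2)[OF B, of u \<infinity> \<omega>] elim(1,2) by auto
  have Aa: "A (ennreal u) \<omega> = ennreal (a u)" and Bb: "B (ennreal u) \<omega> = ennreal (b u)" for u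
    unfolding a_def b_def using fin by (simp_all add: ennreal_enn2real)
  have nonneg: "0 \<le> a u" "0 \<le> b u" for u unfolding a_def b_def by simp_all
  have mono: "mono a" "mono b"
    using fin by (auto intro!: monoI enn2real_mono additive_processD(2)[OF A]
        additive_processD(2)[OF B] ennreal_leI simp: a_def b_def)
  have cont: "continuous_on {0..} f" if "continuous_on {0..} (\<lambda>u. ennreal (f u))" "\<And>u. 0 \<le> f u" for f :: "real \<Rightarrow> real"
    using that unfolding continuous_on_def by (auto intro!: tendsto_ennrealD)
  have cab: "continuous_on {0..T} a" "continuous_on {0..T} b"
    using additive_processD(5)[OF A elim(1)] additive_processD(5)[OF B elim(2)] nonneg
    by (auto simp: Aa Bb intro!: continuous_on_subset[OF cont])
  have zero: "a 0 = 0" "b 0 = 0"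
    unfolding a_def b_def using additive_processD(3)[OF A] additive_processD(3)[OF B] by simp_all
  have t_bounds: "0 \<le> t n i" "i \<le> Suc n \<Longrightarrow> t n i \<le> T" "t n i \<le> t n (Suc i)" for n i
  proof -
    show "0 \<le> t n i" "t n i \<le> t n (Suc i)"
      unfolding t_def using T by (auto intro!: divide_right_mono mult_left_mono)
    assume "i \<le> Suc n"
    then have "T * (real i / real (Suc n)) \<le> T * 1"
      using T by (intro mult_left_mono) (simp_all del: of_nat_Suc add: divide_le_eq_1)
    then show "t n i \<le> T" unfolding t_def by simp
  qed
  \<comment> \<open>By additivity, the functional of the shifted path over the remaining time is the
    increment from \<open>u\<close> to \<open>T\<close>.\<close>
  have rest: "A (ennreal (T - u)) (\<theta> (ennreal u) \<omega>) = ennreal (a T - a u)"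
    "B (ennreal (T - u)) (\<theta> (ennreal u) \<omega>) = ennreal (b T - b u)" if u: "0 \<le> u" "u \<le> T" for u
  proof -
    have s: "ennreal u + ennreal (T - u) = ennreal T" using u by (simp flip: ennreal_plus)
    have "ennreal (a T) = ennreal (a u) + A (ennreal (T - u)) (\<theta> (ennreal u) \<omega>)"
      using elim(3)[rule_format, of "ennreal u" "ennreal (T - u)"] by (simp add: s Aa)
    moreover have "ennreal (b T) = ennreal (b u) + B (ennreal (T - u)) (\<theta> (ennreal u) \<omega>)"
      using elim(4)[rule_format, of "ennreal u" "ennreal (T - u)"] by (simp add: s Bb)
    ultimately show "A (ennreal (T - u)) (\<theta> (ennreal u) \<omega>) = ennreal (a T - a u)"
      "B (ennreal (T - u)) (\<theta> (ennreal u) \<omega>) = ennreal (b T - b u)"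
      using nonneg by (metis ennreal_add_diff_cancel_left ennreal_minus ennreal_neq_top)+
  qed
  have da: "0 \<le> a (t n (Suc i)) - a (t n i)" "0 \<le> b (t n (Suc i)) - b (t n i)" for n i
    using monoD[OF mono(1) t_bounds(3)] monoD[OF mono(2) t_bounds(3)] by simp_all
  have dT: "i \<le> Suc n \<Longrightarrow> 0 \<le> a T - a (t n i)" "i \<le> Suc n \<Longrightarrow> 0 \<le> b T - b (t n i)" for n i
    using monoD[OF mono(1) t_bounds(2)] monoD[OF mono(2) t_bounds(2)] by simp_all
  have psAB: "product_sum T A B n \<omega> = ennreal (\<Sum>i<Suc n. (a (t n (Suc i)) - a (t n i)) * (b T - b (t n (Suc i))))" for n
    unfolding product_sum_def t_def[symmetric]
    using da dT t_bounds nonneg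
    by (subst sum_ennreal[symmetric]) (auto simp: Aa rest ennreal_minus ennreal_mult intro!: sum.cong simp del: sum.lessThan_Suc)
  have psBA: "product_sum T B A n \<omega> = ennreal (\<Sum>i<Suc n. (b (t n (Suc i)) - b (t n i)) * (a T - a (t n (Suc i))))" for n
    unfolding product_sum_def t_def[symmetric]
    using da dT t_bounds nonneg
    by (subst sum_ennreal[symmetric]) (auto simp: Bb rest ennreal_minus ennreal_mult intro!: sum.cong simp del: sum.lessThan_Suc)
  let ?s = "\<lambda>n. \<Sum>i<Suc n. (a (t n (Suc i)) - a (t n i)) * (b T - b (t n (Suc i))) +
      (b (t n (Suc i)) - b (t n i)) * (a T - a (t n (Suc i)))"
  have ps: "product_sum T A B n \<omega> + product_sum T B A n \<omega> = ennreal (?s n)" for n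
    unfolding psAB psBA sum.distrib
    by (intro ennreal_plus[symmetric] sum_nonneg mult_nonneg_nonneg) (use da dT in auto)
  have "?s \<longlonglongrightarrow> a T * b T"
    unfolding t_def using mono zero T cab by (intro product_sums_LIMSEQ) (auto simp: mono_on_def mono_def)
  then have 1: "(\<lambda>n. product_sum T A B n \<omega> + product_sum T B A n \<omega>) \<longlonglongrightarrow> A (ennreal T) \<omega> * B (ennreal T) \<omega>"
    unfolding ps Aa Bb using nonneg by (simp add: ennreal_mult[symmetric] tendsto_ennrealI)
  have t0: "t n 0 = 0" and tn: "t n (Suc n) = T" for n
    unfolding t_def by (simp_all del: of_nat_Suc)
  \<comment> \<open>The products of simultaneous increments left out of \<open>?s\<close> are
    nonnegative, so the telescoping sum dominates.\<close>
  have s_le: "?s n \<le> (\<Sum>i<Suc n. (a T - a (t n i)) * (b T - b (t n i)) -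
        (a T - a (t n (Suc i))) * (b T - b (t n (Suc i))))" for n
  proof (rule sum_mono)
    fix i
    have "0 \<le> (a (t n (Suc i)) - a (t n i)) * (b (t n (Suc i)) - b (t n i))"
      using da by (intro mult_nonneg_nonneg)
    then show "(a (t n (Suc i)) - a (t n i)) * (b T - b (t n (Suc i))) +
      (b (t n (Suc i)) - b (t n i)) * (a T - a (t n (Suc i))) \<le> (a T - a (t n i)) * (b T - b (t n i)) -
        (a T - a (t n (Suc i))) * (b T - b (t n (Suc i)))" by (simp add: algebra_simps)
  qed
  have tel: "(\<Sum>i<Suc n. (a T - a (t n i)) * (b T - b (t n i)) -
        (a T - a (t n (Suc i))) * (b T - b (t n (Suc i)))) = a T * b T" for n
    unfolding sum_lessThan_telescope'[of "\<lambda>i. (a T - a (t n i)) * (b T - b (t n i))" "Suc n"]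
    by (simp only: t0 tn zero) simp
  have "?s n \<le> a T * b T" for n using s_le[of n] unfolding tel .
  then have 2: "product_sum T A B n \<omega> + product_sum T B A n \<omega> \<le> A (ennreal T) \<omega> * B (ennreal T) \<omega>" for n
    unfolding ps Aa Bb using nonneg by (simp add: ennreal_mult[symmetric] ennreal_leI)
  have "(\<Sum>i<Suc n. A (ennreal (t n (Suc i))) \<omega> - A (ennreal (t n i)) \<omega>) = ennreal (\<Sum>i<Suc n. a (t n (Suc i)) - a (t n i))" for n
    using da nonneg by (subst sum_ennreal[symmetric]) (auto simp: Aa ennreal_minus simp del: sum.lessThan_Suc)
  moreover have "(\<Sum>i<Suc n. a (t n (Suc i)) - a (t n i)) = a T" for n
    unfolding sum_lessThan_telescope[of "\<lambda>i. a (t n i)" "Suc n"] by (simp only: t0 tn zero diff_zero)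
  ultimately have 3: "(\<Sum>i<Suc n. A (ennreal (t n (Suc i))) \<omega> - A (ennreal (t n i)) \<omega>) \<le> A (ennreal T) \<omega>" for n
    by (simp only: Aa order_refl)
  show ?case using 1 2 3 unfolding t_def by blast
qed

text \<open>Each remaining increment has conditional expectation at most \<open>c\<close>, so the
  two product sums have expectation at most twice \<open>c * c\<close>. Fatou's lemma passes to the
  limit; a majorant would presuppose the integrability that is being proved.\<close>

lemma additive_process_second_moment:
  assumes K: "additive_process K" and c: "\<And>z. integral\<^sup>N (Q z) (K \<infinity>) \<le> ennreal c" and T: "0 \<le> T"
  shows "(\<integral>\<^sup>+\<omega>. K (ennreal T) \<omega> * K (ennreal T) \<omega> \<partial>Q z) < \<infinity>"
proof -
  let ?H = "\<lambda>n i \<omega>. K (ennreal (T * real (Suc i) / real (Suc n))) \<omega> - K (ennreal (T * real i / real (Suc n))) \<omega>"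
  note ae = AE_product_sum[OF K K T c c, of z]
  have Kc: "integral\<^sup>N (Q y) (K s) \<le> ennreal c" for s y
    by (rule order_trans[OF nn_integral_mono c]) (rule additive_processD(2)[OF K], simp)
  have bound: "(\<integral>\<^sup>+\<omega>. product_sum T K K n \<omega> + product_sum T K K n \<omega> \<partial>Q z) \<le> 2 * (ennreal c * ennreal c)" for n
  proof -
    have mH: "?H n i \<in> borel_measurable (Q z)" for i
      by (rule measurable_FQ[OF measurable_increment[OF K T]])
    have "integral\<^sup>N (Q z) (product_sum T K K n) \<le> (\<Sum>i<Suc n. \<integral>\<^sup>+\<omega>. ?H n i \<omega> * ennreal c \<partial>Q z)"
      unfolding nn_integral_product_sum[OF K K T]
      by (intro sum_mono nn_integral_mono mult_left_mono Kc) simp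
    also have "\<dots> = (\<integral>\<^sup>+\<omega>. (\<Sum>i<Suc n. ?H n i \<omega>) \<partial>Q z) * ennreal c"
      by (simp only: nn_integral_multc[OF mH] nn_integral_sum[OF mH] sum_distrib_right[symmetric])
    also have "(\<integral>\<^sup>+\<omega>. (\<Sum>i<Suc n. ?H n i \<omega>) \<partial>Q z) \<le> integral\<^sup>N (Q z) (K (ennreal T))"
      by (rule nn_integral_mono_AE) (use ae in eventually_elim, blast)
    also have "\<dots> \<le> ennreal c" by (rule Kc)
    finally have 1: "integral\<^sup>N (Q z) (product_sum T K K n) \<le> ennreal c * ennreal c"
      by (simp add: mult_right_mono)
    have "(\<integral>\<^sup>+\<omega>. product_sum T K K n \<omega> + product_sum T K K n \<omega> \<partial>Q z) =
        integral\<^sup>N (Q z) (product_sum T K K n) + integral\<^sup>N (Q z) (product_sum T K K n)"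
      by (intro nn_integral_add measurable_product_sum K T)
    also have "\<dots> \<le> 2 * (ennreal c * ennreal c)" unfolding mult_2 by (intro add_mono 1)
    finally show ?thesis .
  qed
  have "(\<integral>\<^sup>+\<omega>. K (ennreal T) \<omega> * K (ennreal T) \<omega> \<partial>Q z) =
      (\<integral>\<^sup>+\<omega>. liminf (\<lambda>n. product_sum T K K n \<omega> + product_sum T K K n \<omega>) \<partial>Q z)"
  proof (rule nn_integral_cong_AE)
    show "AE \<omega> in Q z. K (ennreal T) \<omega> * K (ennreal T) \<omega> =
        liminf (\<lambda>n. product_sum T K K n \<omega> + product_sum T K K n \<omega>)"
      using ae by eventually_elim (metis lim_imp_Liminf sequentially_bot)
  qed
  also have "\<dots> \<le> liminf (\<lambda>n. \<integral>\<^sup>+\<omega>. product_sum T K K n \<omega> + product_sum T K K n \<omega> \<partial>Q z)"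
    by (intro nn_integral_liminf borel_measurable_add measurable_product_sum K T)
  also have "\<dots> \<le> 2 * (ennreal c * ennreal c)"
    using Liminf_mono[OF always_eventually[OF allI[OF bound]], of sequentially]
    by (simp add: Liminf_const)
  also have "\<dots> < \<infinity>" by (simp add: ennreal_mult_less_top)
  finally show ?thesis .
qed

text \<open>Product sums converge to squares and mixed products. Exchanging the second factor shows
  that the squares of \<open>K\<close> and \<open>L\<close> together integrate to twice the mixed
  product, so the square of the difference integrates to zero.\<close>

theorem additive_process_eq_of_expectation:
  assumes K: "additive_process K" and L: "additive_process L"
    and eq: "\<And>z. integral\<^sup>N (Q z) (K \<infinity>) = integral\<^sup>N (Q z) (L \<infinity>)"
    and c: "\<And>z. integral\<^sup>N (Q z) (K \<infinity>) \<le> ennreal c" and T: "0 \<le> T"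
  shows "AE \<omega> in Q z. K (ennreal T) \<omega> = L (ennreal T) \<omega>"
proof -
  have cL: "integral\<^sup>N (Q z) (L \<infinity>) \<le> ennreal c" for z using c eq by simp
  let ?k = "K (ennreal T)" and ?l = "L (ennreal T)"
  have m: "?k \<in> borel_measurable (Q z)" "?l \<in> borel_measurable (Q z)"
    using measurable_additive_process(1) K L by blast+
  note ps = measurable_product_sum[OF K K T, of _ z] measurable_product_sum[OF L L T, of _ z]
    measurable_product_sum[OF K L T, of _ z] measurable_product_sum[OF L K T, of _ z]
  have e: "integral\<^sup>N (Q y) (K (ennreal s)) = integral\<^sup>N (Q y) (L (ennreal s))" for s y
    by (rule additive_process_expectation_eq[OF K L eq c]) simp
  \<comment> \<open>The second factor enters through its expectations only, and these agree for
    \<open>K\<close> and \<open>L\<close> at finite times.\<close>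
  have KK: "integral\<^sup>N (Q z) (product_sum T K K n) = integral\<^sup>N (Q z) (product_sum T K L n)" for n
    unfolding nn_integral_product_sum[OF K K T] nn_integral_product_sum[OF K L T] e ..
  have LL: "integral\<^sup>N (Q z) (product_sum T L L n) = integral\<^sup>N (Q z) (product_sum T L K n)" for n
    unfolding nn_integral_product_sum[OF L L T] nn_integral_product_sum[OF L K T] e ..
  have fin: "(\<integral>\<^sup>+\<omega>. ?k \<omega> * ?k \<omega> + ?l \<omega> * ?l \<omega> \<partial>Q z) < \<infinity>"
  proof -
    have "(\<integral>\<^sup>+\<omega>. ?k \<omega> * ?k \<omega> + ?l \<omega> * ?l \<omega> \<partial>Q z) = (\<integral>\<^sup>+\<omega>. ?k \<omega> * ?k \<omega> \<partial>Q z) + (\<integral>\<^sup>+\<omega>. ?l \<omega> * ?l \<omega> \<partial>Q z)"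
      by (intro nn_integral_add borel_measurable_times_ennreal m)
    then show ?thesis
      using additive_process_second_moment[OF K c T, of z] additive_process_second_moment[OF L cL T, of z]
      by (simp only: infinity_ennreal_def ennreal_add_less_top simp_thms)
  qed
  \<comment> \<open>The larger of the two squares dominates the product, which makes the mixed term
    integrable and usable as a majorant.\<close>
  have kl: "?k \<omega> * ?l \<omega> \<le> ?k \<omega> * ?k \<omega> + ?l \<omega> * ?l \<omega>" for \<omega>
  proof (cases "?k \<omega> \<le> ?l \<omega>")
    case True
    then have "?k \<omega> * ?l \<omega> \<le> ?l \<omega> * ?l \<omega>" by (rule mult_right_mono) simp
    then show ?thesis by (rule add_increasing[rotated]) simp
  next
    case False
    then have "?k \<omega> * ?l \<omega> \<le> ?k \<omega> * ?k \<omega>" by (intro mult_left_mono) simp_all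
    then show ?thesis by (rule add_increasing2[rotated]) simp
  qed
  have finkl: "(\<integral>\<^sup>+\<omega>. ?k \<omega> * ?l \<omega> \<partial>Q z) < \<infinity>"
    by (rule le_less_trans[OF nn_integral_mono fin]) (rule kl)
  have lim1: "(\<lambda>n. \<integral>\<^sup>+\<omega>. (product_sum T K K n \<omega> + product_sum T K K n \<omega>) +
      (product_sum T L L n \<omega> + product_sum T L L n \<omega>) \<partial>Q z) \<longlonglongrightarrow> (\<integral>\<^sup>+\<omega>. ?k \<omega> * ?k \<omega> + ?l \<omega> * ?l \<omega> \<partial>Q z)"
  proof (rule nn_integral_dominated_convergence[where w = "\<lambda>\<omega>. ?k \<omega> * ?k \<omega> + ?l \<omega> * ?l \<omega>"])
    show "AE \<omega> in Q z. (product_sum T K K n \<omega> + product_sum T K K n \<omega>) +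
      (product_sum T L L n \<omega> + product_sum T L L n \<omega>) \<le> ?k \<omega> * ?k \<omega> + ?l \<omega> * ?l \<omega>" for n
      using AE_product_sum[OF K K T c c, of z] AE_product_sum[OF L L T cL cL, of z]
      by eventually_elim (intro add_mono; blast)
    show "AE \<omega> in Q z. (\<lambda>n. (product_sum T K K n \<omega> + product_sum T K K n \<omega>) +
      (product_sum T L L n \<omega> + product_sum T L L n \<omega>)) \<longlonglongrightarrow> ?k \<omega> * ?k \<omega> + ?l \<omega> * ?l \<omega>"
      using AE_product_sum[OF K K T c c, of z] AE_product_sum[OF L L T cL cL, of z]
      by eventually_elim (intro tendsto_add; blast)
  qed (intro borel_measurable_add borel_measurable_times_ennreal m ps fin)+
  have lim2: "(\<lambda>n. \<integral>\<^sup>+\<omega>. product_sum T K L n \<omega> + product_sum T L K n \<omega> \<partial>Q z) \<longlonglongrightarrow> (\<integral>\<^sup>+\<omega>. ?k \<omega> * ?l \<omega> \<partial>Q z)"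
  proof (rule nn_integral_dominated_convergence[where w = "\<lambda>\<omega>. ?k \<omega> * ?l \<omega>"])
    show "AE \<omega> in Q z. product_sum T K L n \<omega> + product_sum T L K n \<omega> \<le> ?k \<omega> * ?l \<omega>" for n
      using AE_product_sum[OF K L T c cL, of z] by eventually_elim blast
    show "AE \<omega> in Q z. (\<lambda>n. product_sum T K L n \<omega> + product_sum T L K n \<omega>) \<longlonglongrightarrow> ?k \<omega> * ?l \<omega>"
      using AE_product_sum[OF K L T c cL, of z] by eventually_elim blast
  qed (intro borel_measurable_add borel_measurable_times_ennreal m ps finkl)+
  have "(\<integral>\<^sup>+\<omega>. (product_sum T K K n \<omega> + product_sum T K K n \<omega>) +
      (product_sum T L L n \<omega> + product_sum T L L n \<omega>) \<partial>Q z) =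
    (\<integral>\<^sup>+\<omega>. product_sum T K L n \<omega> + product_sum T L K n \<omega> \<partial>Q z) +
    (\<integral>\<^sup>+\<omega>. product_sum T K L n \<omega> + product_sum T L K n \<omega> \<partial>Q z)" for n
    unfolding nn_integral_add[OF borel_measurable_add borel_measurable_add, OF ps(1,1,2,2)]
      nn_integral_add[OF ps(1,1)] nn_integral_add[OF ps(2,2)] nn_integral_add[OF ps(3,4)] KK LL
    by (simp only: ac_simps)
  with lim1 have "(\<lambda>n. (\<integral>\<^sup>+\<omega>. product_sum T K L n \<omega> + product_sum T L K n \<omega> \<partial>Q z) +
    (\<integral>\<^sup>+\<omega>. product_sum T K L n \<omega> + product_sum T L K n \<omega> \<partial>Q z)) \<longlonglongrightarrow> (\<integral>\<^sup>+\<omega>. ?k \<omega> * ?k \<omega> + ?l \<omega> * ?l \<omega> \<partial>Q z)"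
    by (simp only:)
  from LIMSEQ_unique[OF this tendsto_add[OF lim2 lim2]]
  have int_eq: "(\<integral>\<^sup>+\<omega>. ?k \<omega> * ?k \<omega> + ?l \<omega> * ?l \<omega> \<partial>Q z) = (\<integral>\<^sup>+\<omega>. ?k \<omega> * ?l \<omega> + ?k \<omega> * ?l \<omega> \<partial>Q z)"
    by (simp only: nn_integral_add[OF borel_measurable_times_ennreal borel_measurable_times_ennreal, OF m m])
  have fink: "AE \<omega> in Q z. ?k \<omega> < \<infinity> \<and> ?l \<omega> < \<infinity>"
    using AE_additive_process_finite[OF K c, of z] AE_additive_process_finite[OF L cL, of z]
  proof eventually_elim
    case (elim \<omega>)
    have "?k \<omega> \<le> K \<infinity> \<omega>" "?l \<omega> \<le> L \<infinity> \<omega>"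
      by (rule additive_processD(2)[OF K] additive_processD(2)[OF L]; simp)+
    with elim show ?case by (blast intro: le_less_trans)
  qed
  have real: "?k \<omega> * ?l \<omega> + ?k \<omega> * ?l \<omega> \<le> ?k \<omega> * ?k \<omega> + ?l \<omega> * ?l \<omega>"
    "(?k \<omega> * ?k \<omega> + ?l \<omega> * ?l \<omega>) - (?k \<omega> * ?l \<omega> + ?k \<omega> * ?l \<omega>) = 0 \<Longrightarrow> ?k \<omega> = ?l \<omega>"
    if kl_fin: "?k \<omega> < \<infinity> \<and> ?l \<omega> < \<infinity>" for \<omega>
  proof -
    obtain a b where ab: "?k \<omega> = ennreal a" "?l \<omega> = ennreal b" "0 \<le> a" "0 \<le> b"
      using kl_fin by (cases "?k \<omega>"; cases "?l \<omega>") auto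
    have "0 \<le> (a - b)\<^sup>2" by simp
    then have le: "a * b + a * b \<le> a * a + b * b" by (simp add: power2_eq_square algebra_simps)
    have e: "?k \<omega> * ?l \<omega> + ?k \<omega> * ?l \<omega> = ennreal (a * b + a * b)" "?k \<omega> * ?k \<omega> + ?l \<omega> * ?l \<omega> = ennreal (a * a + b * b)"
      using ab by (simp_all only: ennreal_mult ennreal_plus mult_nonneg_nonneg)
    show "?k \<omega> * ?l \<omega> + ?k \<omega> * ?l \<omega> \<le> ?k \<omega> * ?k \<omega> + ?l \<omega> * ?l \<omega>"
      unfolding e by (rule ennreal_leI[OF le])
    assume "(?k \<omega> * ?k \<omega> + ?l \<omega> * ?l \<omega>) - (?k \<omega> * ?l \<omega> + ?k \<omega> * ?l \<omega>) = 0"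
    moreover have "ennreal (a * a + b * b) - ennreal (a * b + a * b) = ennreal (a * a + b * b - (a * b + a * b))"
      using ab by (intro ennreal_minus) simp
    ultimately have "ennreal (a * a + b * b - (a * b + a * b)) = 0" unfolding e by (simp only:)
    then have "a * a + b * b - (a * b + a * b) \<le> 0" by (simp only: ennreal_eq_0_iff)
    then have "(a - b)\<^sup>2 \<le> 0" by (simp add: power2_eq_square algebra_simps)
    then show "?k \<omega> = ?l \<omega>" using ab by simp
  qed
  \<comment> \<open>The integrand is the square of the difference on the paths where both values are
    finite, hence almost everywhere.\<close>
  have "(\<integral>\<^sup>+\<omega>. (?k \<omega> * ?k \<omega> + ?l \<omega> * ?l \<omega>) - (?k \<omega> * ?l \<omega> + ?k \<omega> * ?l \<omega>) \<partial>Q z) = 0"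
  proof (subst nn_integral_diff)
    show "AE \<omega> in Q z. ?k \<omega> * ?l \<omega> + ?k \<omega> * ?l \<omega> \<le> ?k \<omega> * ?k \<omega> + ?l \<omega> * ?l \<omega>"
      using fink by eventually_elim (rule real(1))
    show "(\<integral>\<^sup>+\<omega>. ?k \<omega> * ?l \<omega> + ?k \<omega> * ?l \<omega> \<partial>Q z) \<noteq> \<infinity>" using fin unfolding int_eq by (rule less_imp_neq)
    show "(\<integral>\<^sup>+\<omega>. ?k \<omega> * ?k \<omega> + ?l \<omega> * ?l \<omega> \<partial>Q z) - (\<integral>\<^sup>+\<omega>. ?k \<omega> * ?l \<omega> + ?k \<omega> * ?l \<omega> \<partial>Q z) = 0"
      unfolding int_eq using fin[unfolded int_eq] by (simp only: diff_eq_0_iff_ennreal infinity_ennreal_def order_refl simp_thms)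
  qed (intro borel_measurable_add borel_measurable_times_ennreal m)+
  then have "AE \<omega> in Q z. (?k \<omega> * ?k \<omega> + ?l \<omega> * ?l \<omega>) - (?k \<omega> * ?l \<omega> + ?k \<omega> * ?l \<omega>) = 0"
    by (subst (asm) nn_integral_0_iff_AE)
      (intro borel_measurable_minus_ennreal borel_measurable_add borel_measurable_times_ennreal m)
  with fink show ?thesis by eventually_elim (rule real(2))
qed

end

section \<open>Comparison of measures through densities\<close>

text \<open>The integrals may be infinite, so they are not subtracted. Replacing \<open>b\<close> by
  the maximum of \<open>a\<close> and \<open>b\<close> does not change the measure, because on the
  set where \<open>a\<close> exceeds \<open>b\<close> the hypothesis gives the missing inequality;
  uniqueness of densities concludes.\<close>

lemma AE_density_le:
  assumes "sigma_finite_measure M" and a: "a \<in> borel_measurable M" and b: "b \<in> borel_measurable M"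
    and le: "\<And>A. A \<in> sets M \<Longrightarrow> emeasure (density M a) A \<le> emeasure (density M b) A"
  shows "AE x in M. a x \<le> b x"
proof -
  interpret sigma_finite_measure M by fact
  have "density M (\<lambda>x. max (a x) (b x)) = density M b"
  proof (rule measure_eqI)
    fix A assume "A \<in> sets (density M (\<lambda>x. max (a x) (b x)))"
    then have A: "A \<in> sets M" by simp
    let ?E = "{x\<in>space M. b x < a x}"
    have E: "?E \<in> sets M" using a b by measurable
    have split: "emeasure (density M g) A = (\<integral>\<^sup>+x. g x * indicator (A \<inter> ?E) x \<partial>M) + (\<integral>\<^sup>+x. g x * indicator (A - ?E) x \<partial>M)"
      if "g \<in> borel_measurable M" for g
      using that A E sets.sets_into_space[OF A]
      by (subst nn_integral_add[symmetric]) (auto simp: emeasure_density intro!: nn_integral_cong split: split_indicator)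
    have "(\<integral>\<^sup>+x. max (a x) (b x) * indicator (A \<inter> ?E) x \<partial>M) = emeasure (density M a) (A \<inter> ?E)"
      using a A E by (subst emeasure_density) (auto intro!: nn_integral_cong split: split_indicator)
    also have "\<dots> \<le> (\<integral>\<^sup>+x. b x * indicator (A \<inter> ?E) x \<partial>M)"
      using le[of "A \<inter> ?E"] A E b by (simp add: emeasure_density)
    finally have 1: "(\<integral>\<^sup>+x. max (a x) (b x) * indicator (A \<inter> ?E) x \<partial>M) \<le> (\<integral>\<^sup>+x. b x * indicator (A \<inter> ?E) x \<partial>M)" .
    have 2: "(\<integral>\<^sup>+x. max (a x) (b x) * indicator (A - ?E) x \<partial>M) = (\<integral>\<^sup>+x. b x * indicator (A - ?E) x \<partial>M)"
      by (intro nn_integral_cong) (auto simp: max_def split: split_indicator)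
    show "emeasure (density M (\<lambda>x. max (a x) (b x))) A = emeasure (density M b) A"
    proof (rule antisym)
      show "emeasure (density M (\<lambda>x. max (a x) (b x))) A \<le> emeasure (density M b) A"
        using a b by (subst (1 2) split) (auto intro!: add_mono 1 simp: 2)
      show "emeasure (density M b) A \<le> emeasure (density M (\<lambda>x. max (a x) (b x))) A"
        using a b A by (subst (1 2) emeasure_density) (auto intro!: nn_integral_mono mult_right_mono)
    qed
  qed simp
  then have "AE x in M. max (a x) (b x) = b x"
    using a b by (intro density_unique) auto
  then show ?thesis by eventually_elim (metis max.cobounded1)
qed

lemma increasing_measures_common_densities:
  fixes \<nu> \<beta> :: "'a::topological_space measure" and \<gamma> :: "nat \<Rightarrow> 'a measure"
  assumes "sigma_finite_measure \<nu>" and sets: "sets \<nu> = sets borel" "sets \<beta> = sets borel" "\<And>n. sets (\<gamma> n) = sets borel"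
    and \<beta>: "\<And>B. B \<in> sets borel \<Longrightarrow> emeasure \<beta> B \<le> emeasure \<nu> B" and \<gamma>: "measures_increase_to \<gamma> \<nu>"
  obtains f h :: "nat \<Rightarrow> 'a \<Rightarrow> ennreal"
  where "\<And>n. f n \<in> borel_measurable borel" "\<And>n. h n \<in> borel_measurable borel"
    "\<And>n x. f n x \<le> 1" "\<And>n x. h n x \<le> 1"
    "\<And>n. density \<beta> (f n) = density (\<gamma> n) (h n)" "AE x in \<beta>. (\<lambda>n. f n x) \<longlonglongrightarrow> 1"
proof -
  interpret sigma_finite_measure \<nu> by fact
  have \<gamma>': "incseq (\<lambda>n. emeasure (\<gamma> n) B)" "(\<lambda>n. emeasure (\<gamma> n) B) \<longlonglongrightarrow> emeasure \<nu> B" if "B \<in> sets borel" for B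
    using \<gamma> that unfolding measures_increase_to_def by auto
  have \<gamma>_le: "emeasure (\<gamma> n) B \<le> emeasure \<nu> B" if "B \<in> sets borel" for B n
    using \<gamma>'[OF that] by (rule incseq_le)
  have bm: "g \<in> borel_measurable \<nu> \<longleftrightarrow> g \<in> borel_measurable borel" for g :: "'a \<Rightarrow> ennreal"
    using sets(1) by (simp cong: measurable_cong_sets)
  have RN: "\<exists>g\<in>borel_measurable borel. density \<nu> g = \<mu> \<and> (\<forall>x. g x \<le> 1)"
    if \<mu>: "sets \<mu> = sets borel" and le: "\<And>B. B \<in> sets borel \<Longrightarrow> emeasure \<mu> B \<le> emeasure \<nu> B" for \<mu>
  proof -
    have "absolutely_continuous \<nu> \<mu>"
      unfolding absolutely_continuous_def
    proof
      fix B assume "B \<in> null_sets \<nu>"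
      then have "B \<in> sets borel" "emeasure \<nu> B = 0" using sets(1) by auto
      with le[of B] show "B \<in> null_sets \<mu>" using \<mu> by (intro null_setsI) simp_all
    qed
    then obtain g where g: "g \<in> borel_measurable \<nu>" "density \<nu> g = \<mu>"
      using Radon_Nikodym[of \<mu>] \<mu> sets(1) by auto
    have "AE x in \<nu>. g x \<le> 1"
      by (rule AE_density_le[OF assms(1) g(1)]) (use g le sets(1) in \<open>auto simp: density_1\<close>)
    \<comment> \<open>Truncation at 1 alters the density on a null set only and makes the bound hold
      everywhere.\<close>
    then have "density \<nu> (\<lambda>x. min (g x) 1) = density \<nu> g"
      using g(1) by (intro density_cong) (auto elim!: AE_mp simp: min_def)
    then show ?thesis using g by (intro bexI[of _ "\<lambda>x. min (g x) 1"]) (auto simp: bm)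
  qed
  obtain b where b: "b \<in> borel_measurable borel" "density \<nu> b = \<beta>" "\<And>x. b x \<le> 1"
    using RN[OF sets(2) \<beta>] by auto
  have "\<forall>n. \<exists>g. g \<in> borel_measurable borel \<and> density \<nu> g = \<gamma> n \<and> (\<forall>x. g x \<le> 1)"
    using RN[OF sets(3) \<gamma>_le] by auto
  then obtain c where c: "\<And>n. c n \<in> borel_measurable borel" "\<And>n. density \<nu> (c n) = \<gamma> n" "\<And>n x. c n x \<le> 1"
    by metis
  have mono: "AE x in \<nu>. \<forall>n. c n x \<le> c (Suc n) x"
    unfolding AE_all_countable
  proof
    fix n show "AE x in \<nu>. c n x \<le> c (Suc n) x"
      by (rule AE_density_le[OF assms(1)])
        (use c(1,2) incseq_SucD[OF \<gamma>'(1)] sets(1) in \<open>simp_all add: bm\<close>)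
  qed
  \<comment> \<open>By monotone convergence the supremum of the densities represents
    \<open>\<nu>\<close> itself, so the densities increase to 1 almost everywhere.\<close>
  have "density \<nu> (\<lambda>x. SUP n. c n x) = density \<nu> (\<lambda>_. 1)"
  proof (rule measure_eqI)
    fix B assume "B \<in> sets (density \<nu> (\<lambda>x. SUP n. c n x))"
    then have B: "B \<in> sets borel" "B \<in> sets \<nu>" using sets(1) by auto
    have "emeasure (density \<nu> (\<lambda>x. SUP n. c n x)) B = (\<integral>\<^sup>+x. (SUP n. c n x * indicator B x) \<partial>\<nu>)"
      using B c(1) by (subst emeasure_density) (auto simp: bm SUP_mult_right_ennreal)
    also have "\<dots> = (SUP n. \<integral>\<^sup>+x. c n x * indicator B x \<partial>\<nu>)"
      by (rule nn_integral_monotone_convergence_SUP_AE)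
        (use mono B c(1) in \<open>auto simp: bm intro!: mult_right_mono\<close>)
    also have "\<dots> = (SUP n. emeasure (\<gamma> n) B)"
      using B c(1) by (simp add: emeasure_density bm flip: c(2))
    also have "\<dots> = emeasure \<nu> B"
      by (rule LIMSEQ_unique[OF LIMSEQ_SUP[OF \<gamma>'(1)] \<gamma>'(2)]; fact)
    finally show "emeasure (density \<nu> (\<lambda>x. SUP n. c n x)) B = emeasure (density \<nu> (\<lambda>_. 1)) B"
      by (simp add: density_1)
  qed simp
  then have "AE x in \<nu>. (SUP n. c n x) = 1"
    using c(1) by (intro density_unique) (auto simp: bm)
  with mono have "AE x in \<nu>. (\<lambda>n. c n x) \<longlonglongrightarrow> 1"
  proof eventually_elim
    case (elim x)
    then have "incseq (\<lambda>n. c n x)" by (intro incseq_SucI) simp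
    from LIMSEQ_SUP[OF this] elim show ?case by simp
  qed
  then have lim: "AE x in \<beta>. (\<lambda>n. c n x) \<longlonglongrightarrow> 1"
    unfolding b(2)[symmetric] by (subst AE_density) (use b(1) in \<open>auto simp: bm\<close>)
  \<comment> \<open>Together with \<open>h\<close> below: the minimum of \<open>b x\<close> and
    \<open>c n x\<close>, divided by \<open>b x\<close> for \<open>f\<close> and by
    \<open>c n x\<close> for \<open>h\<close>. Where the divisor vanishes it is the smaller of the
    two, so the first branch gives 1 and no division by zero occurs.\<close>
  define f where "f n x = (if b x \<le> c n x then 1 else c n x / b x)" for n x
  define h where "h n x = (if c n x \<le> b x then 1 else b x / c n x)" for n x
  have fm: "f n \<in> borel_measurable borel" and hm: "h n \<in> borel_measurable borel" for n
    unfolding f_def h_def using b(1) c(1) by measurable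
  have fin: "b x \<noteq> \<top>" "c n x \<noteq> \<top>" for n x
    using b(3)[of x] c(3)[of n x] by (auto simp: top_unique)
  have eq: "b x * f n x = c n x * h n x" for n x
  proof (cases "b x" "c n x" rule: linorder_cases)
    case less
    then have "c n x \<noteq> 0" by auto
    then have "c n x * (b x / c n x) = b x"
      using mult_divide_eq_ennreal[of "c n x" "b x"] fin by (simp add: ennreal_times_divide mult.commute)
    then show ?thesis using less less_imp_le[OF less] by (simp add: f_def h_def leD)
  next
    case greater
    then have "b x \<noteq> 0" by auto
    then have "b x * (c n x / b x) = c n x"
      using mult_divide_eq_ennreal[of "b x" "c n x"] fin by (simp add: ennreal_times_divide mult.commute)
    then show ?thesis using greater less_imp_le[OF greater] by (simp add: f_def h_def leD)
  qed (simp add: f_def h_def)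
  have f1: "f n x \<le> 1" and h1: "h n x \<le> 1" for n x
    unfolding f_def h_def
    by (auto intro!: divide_le_posI_ennreal simp: not_le dest: le_less_trans[OF zero_le])
  \<comment> \<open>Since \<open>b x\<close> is at most 1, dividing by it only increases
    \<open>c n x\<close>. This squeezes \<open>f n x\<close> between \<open>c n x\<close> and
    1.\<close>
  have cf: "c n x \<le> f n x" for n x
  proof (cases "b x \<le> c n x")
    case True
    then show ?thesis using c(3) by (simp add: f_def)
  next
    case False
    then have "b x \<noteq> 0" by auto
    then have "c n x = b x * (c n x / b x)"
      using mult_divide_eq_ennreal[of "b x" "c n x"] fin by (simp add: ennreal_times_divide mult.commute)
    also have "\<dots> \<le> 1 * (c n x / b x)" using b(3) by (intro mult_right_mono) simp_all
    finally show ?thesis using False by (simp add: f_def)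
  qed
  show ?thesis
  proof (rule that[of f h, OF fm hm f1 h1])
    show "density \<beta> (f n) = density (\<gamma> n) (h n)" for n
      unfolding b(2)[symmetric] c(2)[of n, symmetric]
      using b(1) c(1) fm hm by (simp add: density_density_eq bm eq)
    show "AE x in \<beta>. (\<lambda>n. f n x) \<longlonglongrightarrow> 1"
      using lim
    proof eventually_elim
      case (elim x)
      show ?case
        by (rule tendsto_sandwich[OF _ _ elim tendsto_const]) (auto simp: cf f1)
    qed
  qed
qed

text \<open>A compact set minus all the sets \<open>Fs n\<close> has zero capacity by monotonicity
  of the capacity, hence measure zero. Countably many compact sets cover \<open>E\<close>, so the
  sets \<open>Fs n\<close> and these null remainders form a cover by sets of finite measure.\<close>

lemma smooth_measure_sigma_finite:
  fixes \<nu> :: "'a::{metric_space, second_countable_topology} measure"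
  assumes lc: "locally_compact_space (euclidean :: 'a topology)" and \<nu>: "smooth_measure m D \<E> \<nu>"
  shows "sigma_finite_measure \<nu>"
proof -
  obtain Fs :: "nat \<Rightarrow> 'a set" where sets: "sets \<nu> = sets borel"
    and null: "\<And>B. B \<in> sets borel \<Longrightarrow> cap m D \<E> B = 0 \<Longrightarrow> emeasure \<nu> B = 0"
    and Fs: "\<And>n. closed (Fs n)" "\<And>n. emeasure \<nu> (Fs n) < \<infinity>"
      "\<And>K. compact K \<Longrightarrow> (\<lambda>n. cap m D \<E> (K - Fs n)) \<longlonglongrightarrow> 0"
    using \<nu> unfolding smooth_measure_def by auto
  obtain \<C> :: "'a set set"
    where \<C>: "countable \<C>" "\<And>C. C \<in> \<C> \<Longrightarrow> compact C \<and> C \<subseteq> UNIV" "UNIV = (\<Union>C\<in>\<C>. interior C)"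
  proof (rule open_eq_Union_interior_compact[OF lc open_UNIV])
    fix \<C> :: "'a set set"
    assume "countable \<C>" "\<And>C. C \<in> \<C> \<Longrightarrow> compact C \<and> C \<subseteq> UNIV" "UNIV = (\<Union>C\<in>\<C>. interior C)"
    then show thesis by (rule that)
  qed
  have UF: "(\<Union>n. Fs n) \<in> sets borel" using Fs(1) by auto
  have CF: "C - (\<Union>n. Fs n) \<in> sets borel" if "C \<in> \<C>" for C
    using \<C>(2)[OF that] by (intro sets.Diff UF borel_closed compact_imp_closed) simp
  have rest: "emeasure \<nu> (C - (\<Union>n. Fs n)) = 0" if "C \<in> \<C>" for C
  proof (rule null)
    show "C - (\<Union>n. Fs n) \<in> sets borel" by (rule CF[OF that])
    have "cap m D \<E> (C - (\<Union>n. Fs n)) \<le> cap m D \<E> (C - Fs n)" for n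
      unfolding cap_def by (rule INF_superset_mono) auto
    moreover have "(\<lambda>n. cap m D \<E> (C - Fs n)) \<longlonglongrightarrow> 0" using Fs(3) \<C>(2)[OF that] by blast
    ultimately have "cap m D \<E> (C - (\<Union>n. Fs n)) \<le> 0" by (intro LIMSEQ_le_const) blast+
    then show "cap m D \<E> (C - (\<Union>n. Fs n)) = 0" by simp
  qed
  show ?thesis
  proof
    let ?A = "range Fs \<union> (\<lambda>C. C - (\<Union>n. Fs n)) ` \<C>"
    have "UNIV \<subseteq> \<Union>?A"
    proof
      fix x :: 'a
      obtain C where "C \<in> \<C>" "x \<in> C" using \<C>(3) interior_subset by blast
      then show "x \<in> \<Union>?A" by blast
    qed
    then have "\<Union>?A = space \<nu>" using sets_eq_imp_space_eq[OF sets] by auto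
    moreover have "?A \<subseteq> sets \<nu>" using CF Fs(1) sets by auto
    moreover have "\<forall>a\<in>?A. emeasure \<nu> a \<noteq> \<infinity>" using Fs(2) rest by (auto dest: less_imp_neq)
    moreover have "countable ?A" using \<C>(1) by simp
    ultimately show "\<exists>A. countable A \<and> A \<subseteq> sets \<nu> \<and> \<Union>A = space \<nu> \<and> (\<forall>a\<in>A. emeasure \<nu> a \<noteq> \<infinity>)"
      by (intro exI[of _ ?A] conjI)
  qed
qed

section \<open>Additive functionals as additive processes\<close>

lemma path_integral_liminf:
  assumes v: "regular_path v" and y: "\<And>n. y n \<in> borel_measurable borel"
  shows "path_integral v (\<lambda>s. liminf (\<lambda>n. y n s)) t \<le> liminf (\<lambda>n. path_integral v (y n) t)"
proof -
  have "path_integral v (\<lambda>s. liminf (\<lambda>n. y n s)) t =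
    (\<integral>\<^sup>+r. liminf (\<lambda>n. indicator {0<..} r * (if level_time v r \<le> t then y n (level_time v r) else 0)) \<partial>lborel)"
    unfolding path_integral_def by (intro nn_integral_cong) (simp add: indicator_def Liminf_const)
  also have "\<dots> \<le> liminf (\<lambda>n. path_integral v (y n) t)"
    unfolding path_integral_def
    by (rule nn_integral_liminf) (use measurable_path_integrand[OF v y] in simp)
  finally show ?thesis .
qed

lemma path_integral_mono_integrand:
  "(\<And>s. s \<le> t \<Longrightarrow> y s \<le> y' s) \<Longrightarrow> path_integral v y t \<le> path_integral v y' t"
  unfolding path_integral_def by (intro nn_integral_mono mult_left_mono) auto

lemma path_integral_add_integrand:
  assumes v: "regular_path v" and y: "y \<in> borel_measurable borel" "y' \<in> borel_measurable borel"
  shows "path_integral v (\<lambda>s. y s + y' s) t = path_integral v y t + path_integral v y' t"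
proof -
  have "path_integral v (\<lambda>s. y s + y' s) t =
    (\<integral>\<^sup>+r. indicator {0<..} r * (if level_time v r \<le> t then y (level_time v r) else 0) +
      indicator {0<..} r * (if level_time v r \<le> t then y' (level_time v r) else 0) \<partial>lborel)"
    unfolding path_integral_def by (intro nn_integral_cong) (simp add: distrib_left)
  also have "\<dots> = path_integral v y t + path_integral v y' t"
    unfolding path_integral_def
    by (rule nn_integral_add) (use measurable_path_integrand[OF v y(1)] measurable_path_integrand[OF v y(2)] in simp_all)
  finally show ?thesis .
qed

lemma path_integral_zero:
  assumes "\<And>s. y s = 0"
  shows "path_integral v y t = 0"
proof -
  have "y = (\<lambda>_. 0)" using assms by auto
  then show ?thesis by (simp add: path_integral_def)
qed

context hunt begin

text \<open>The path properties hold for every \<open>\<omega>\<close>, so inverses and path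
  integrals can be formed without exceptional sets. Additivity is asked almost surely and from live
  times only, which suffices because the integrands vanish at the cemetery.\<close>

definition regular_af :: "(ennreal \<Rightarrow> 'w \<Rightarrow> ennreal) \<Rightarrow> bool" where
  "regular_af V \<longleftrightarrow>
    (\<forall>t<\<infinity>. V t \<in> borel_measurable (F t)) \<and>
    (\<forall>\<omega>. regular_path (\<lambda>t. V t \<omega>)) \<and>
    (\<forall>\<omega> t. X t \<omega> \<noteq> None \<longrightarrow> V t \<omega> < \<infinity>) \<and>
    (\<forall>z. AE \<omega> in Q z. \<forall>t<\<infinity>. X t \<omega> \<noteq> None \<longrightarrow> (\<forall>s<\<infinity>. V (t + s) \<omega> = V t \<omega> + V s (\<theta> t \<omega>)))"

lemma regular_afD:
  assumes "regular_af V"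
  shows "t < \<infinity> \<Longrightarrow> V t \<in> borel_measurable (F t)" "regular_path (\<lambda>t. V t \<omega>)"
    "X t \<omega> \<noteq> None \<Longrightarrow> V t \<omega> < \<infinity>"
    "AE \<omega> in Q z. \<forall>t<\<infinity>. X t \<omega> \<noteq> None \<longrightarrow> (\<forall>s<\<infinity>. V (t + s) \<omega> = V t \<omega> + V s (\<theta> t \<omega>))"
  using assms unfolding regular_af_def by simp_all

lemma alive_set: "{\<omega>. X 0 \<omega> \<noteq> None} \<in> sets (F t)"
proof -
  have "X 0 -` (UNIV - {None}) \<in> sets (F t)"
    using measurable_sets[OF X_measurable_F[of 0 t], of "UNIV - {None}"]
      sets.compl_sets[OF None_cemetery_borel] by simp
  moreover have "X 0 -` (UNIV - {None}) = {\<omega>. X 0 \<omega> \<noteq> None}" by auto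
  ultimately show ?thesis by simp
qed

text \<open>The defining set of a functional need not have full measure for the process started at the
  cemetery, but there all paths are trivial; this makes its complement negligible at every time.\<close>

lemma strict_pcaf_regularization:
  assumes V: "strict_pcaf X P \<theta> V"
  obtains V' where "regular_af V'" "\<And>x. AE \<omega> in Q (Some x). \<forall>t<\<infinity>. V' t \<omega> = V t \<omega>"
proof -
  from V[unfolded strict_pcaf_def, THEN conjunct2] obtain \<Lambda> where \<Lambda>1: "\<Lambda> \<in> sets (F \<infinity>)"
    and rest: "(\<forall>x. emeasure (Q (Some x)) \<Lambda> = 1) \<and> (\<forall>t<\<infinity>. \<theta> t ` \<Lambda> \<subseteq> \<Lambda>) \<and>
        (\<forall>\<omega>\<in>\<Lambda>. V 0 \<omega> = 0 \<and> continuous_on {..<\<infinity>} (\<lambda>t. V t \<omega>) \<and>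
           (\<forall>t<lifetime X \<omega>. V t \<omega> < \<infinity>) \<and>
           (\<forall>t<\<infinity>. lifetime X \<omega> \<le> t \<longrightarrow> V t \<omega> = V (lifetime X \<omega>) \<omega>) \<and>
           (\<forall>s<\<infinity>. \<forall>t<\<infinity>. V (t + s) \<omega> = V t \<omega> + V s (\<theta> t \<omega>)))"
    by (rule bexE)
  have \<Lambda>: "\<Lambda> \<in> sets (F \<infinity>)" "\<And>x. emeasure (Q (Some x)) \<Lambda> = 1" "\<And>t. t < \<infinity> \<Longrightarrow> \<theta> t ` \<Lambda> \<subseteq> \<Lambda>"
    by (fact \<Lambda>1, rule rest[THEN conjunct1, THEN spec])
      (rule rest[THEN conjunct2, THEN conjunct1, rule_format])
  have path: "V 0 \<omega> = 0 \<and> continuous_on {..<\<infinity>} (\<lambda>t. V t \<omega>) \<and> (\<forall>t<lifetime X \<omega>. V t \<omega> < \<infinity>) \<and>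
      (\<forall>s<\<infinity>. \<forall>t<\<infinity>. V (t + s) \<omega> = V t \<omega> + V s (\<theta> t \<omega>))" if "\<omega> \<in> \<Lambda>" for \<omega>
    using bspec[OF rest[THEN conjunct2, THEN conjunct2] that] by (elim conjE) (intro conjI)
  have adapted: "V t \<in> borel_measurable (F t)" if "t < \<infinity>" for t
    using V[unfolded strict_pcaf_def, THEN conjunct1] that by simp
  define Z where "Z = {\<omega>. X 0 \<omega> \<noteq> None} - \<Lambda>"
  have ZF: "Z \<in> sets (F \<infinity>)" unfolding Z_def using \<Lambda>(1) alive_set by blast
  have "AE \<omega> in Q z. \<omega> \<notin> Z" for z
  proof (cases z)
    case None
    have "AE \<omega> in Q z. X 0 \<omega> = z" using X_start by (simp add: AE_completion_iff)
    then show ?thesis by eventually_elim (simp add: None Z_def)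
  next
    case (Some x)
    have "AE \<omega> in Q z. \<omega> \<in> \<Lambda>"
      using prob_space.AE_in_set_eq_1[OF prob_Q[of z], of \<Lambda>] \<Lambda>(1,2) F_le_Q[of \<infinity> z] Some
      by (auto simp: measure_def simp del: emeasure_completion)
    then show ?thesis by eventually_elim (simp add: Z_def)
  qed
  then have Znull: "Z \<in> null_sets (Q z)" for z
    using AE_iff_null_sets[of Z "Q z"] ZF F_le_Q[of \<infinity> z] by auto
  have ZFt: "Z \<in> sets (F t)" for t by (rule null_in_F[OF ZF Znull])
  define L where "L = {\<omega>. X 0 \<omega> \<noteq> None} - Z"
  have L: "L \<in> sets (F t)" for t unfolding L_def using ZFt alive_set by blast
  have L_iff: "\<omega> \<in> L \<longleftrightarrow> \<omega> \<in> \<Lambda> \<and> X 0 \<omega> \<noteq> None" for \<omega> unfolding L_def Z_def by auto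
  define V' where "V' t \<omega> = (if \<omega> \<in> L then V t \<omega> else 0)" for t \<omega>
  have "regular_af V'"
    unfolding regular_af_def
  proof (intro conjI allI impI)
    fix t :: ennreal assume "t < \<infinity>"
    then show "V' t \<in> borel_measurable (F t)"
      unfolding V'_def using adapted L[of t] by (intro measurable_If_set) auto
  next
    fix \<omega>
    show "regular_path (\<lambda>t. V' t \<omega>)"
    proof (cases "\<omega> \<in> L")
      case True
      have "mono_on {..<\<infinity>} (\<lambda>t. V t \<omega>)"
      proof (rule mono_onI)
        fix r s :: ennreal assume rs: "r \<in> {..<\<infinity>}" "s \<in> {..<\<infinity>}" "r \<le> s"
        then obtain d where d: "s = r + d" by (metis add_diff_inverse_ennreal)
        then have "d < \<infinity>" using rs by (auto simp: less_top[symmetric])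
        then have "V s \<omega> = V r \<omega> + V d (\<theta> r \<omega>)"
          using path[of \<omega>] True rs by (simp add: d L_iff)
        then show "V r \<omega> \<le> V s \<omega>" by simp
      qed
      then show ?thesis using path[of \<omega>] True by (simp add: V'_def regular_path_def L_iff)
    qed (simp add: V'_def regular_path_def mono_on_def)
  next
    fix \<omega> t assume "X t \<omega> \<noteq> None"
    then have "t < lifetime X \<omega>" by (simp only: alive_iff)
    then show "V' t \<omega> < \<infinity>" using path[of \<omega>] by (simp add: V'_def L_iff)
  next
    fix z
    have "AE \<omega> in Q z. \<omega> \<notin> Z" using Znull by (rule AE_not_in)
    then show "AE \<omega> in Q z. \<forall>t<\<infinity>. X t \<omega> \<noteq> None \<longrightarrow> (\<forall>s<\<infinity>. V' (t + s) \<omega> = V' t \<omega> + V' s (\<theta> t \<omega>))"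
    proof eventually_elim
      case (elim \<omega>)
      show ?case
      proof (intro allI impI)
        fix t s :: ennreal assume t: "t < \<infinity>" "X t \<omega> \<noteq> None" "s < \<infinity>"
        have "X 0 \<omega> \<noteq> None" using dead_mono[of 0 \<omega> t] t(2) by (metis zero_le)
        \<comment> \<open>A path alive at \<open>t\<close> was alive at 0, so outside
          \<open>Z\<close> it lies in the defining set. Its shift by \<open>t\<close> stays there
          and starts alive, so the modified functional is the original one on both.\<close>
        then have w: "\<omega> \<in> L" using elim by (simp add: L_def)
        moreover have "\<theta> t \<omega> \<in> L"
          using w \<Lambda>(3)[OF t(1)] t(2) by (auto simp: L_iff X_shift)
        ultimately show "V' (t + s) \<omega> = V' t \<omega> + V' s (\<theta> t \<omega>)"
          using path[of \<omega>] t by (simp add: V'_def L_iff)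
      qed
    qed
  qed
  moreover have "AE \<omega> in Q (Some x). \<forall>t<\<infinity>. V' t \<omega> = V t \<omega>" for x
  proof -
    have "AE \<omega> in Q (Some x). X 0 \<omega> = Some x" using X_start by (simp add: AE_completion_iff)
    with AE_not_in[OF Znull] show ?thesis by eventually_elim (simp add: V'_def L_def)
  qed
  ultimately show ?thesis by (rule that)
qed

section \<open>Integrals with respect to an additive functional\<close>

definition af_integral :: "(ennreal \<Rightarrow> 'w \<Rightarrow> ennreal) \<Rightarrow> ('a \<Rightarrow> ennreal) \<Rightarrow> ennreal \<Rightarrow> 'w \<Rightarrow> ennreal" where
  "af_integral V f t \<omega> = path_integral (\<lambda>t. V t \<omega>) (\<lambda>s. extend_zero f (X s \<omega>)) t"

lemma X_path_decompose: "X s \<omega> = (if s < \<infinity> then X (ennreal (enn2real s)) \<omega> else None)"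
proof (cases "s < \<infinity>")
  case False
  then have "s = \<infinity>" by (simp add: less_top[symmetric])
  then show ?thesis using X_infinity[of \<omega>] by simp
qed (simp add: ennreal_enn2real)

lemma measurable_X_path: "(\<lambda>s. X s \<omega>) \<in> borel \<rightarrow>\<^sub>M cemetery_borel"
proof -
  have "(\<lambda>r. X (ennreal r) \<omega>) \<in> borel \<rightarrow>\<^sub>M cemetery_borel"
    using measurable_compose[OF measurable_Pair2' measurable_X_joint_infinity, of \<omega>] by simp
  then have "(\<lambda>s. X (ennreal (enn2real s)) \<omega>) \<in> borel \<rightarrow>\<^sub>M cemetery_borel"
    by (rule measurable_compose[rotated]) simp
  then have "(\<lambda>s. if s < \<infinity> then X (ennreal (enn2real s)) \<omega> else None) \<in> borel \<rightarrow>\<^sub>M cemetery_borel"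
    by (intro measurable_If) (auto intro: measurable_const)
  then show ?thesis by (simp only: X_path_decompose[symmetric])
qed

lemma measurable_extend_zero_path:
  fixes f :: "'a \<Rightarrow> ennreal"
  shows "f \<in> borel_measurable borel \<Longrightarrow> (\<lambda>s. extend_zero f (X s \<omega>)) \<in> borel_measurable borel"
  by (rule measurable_compose[OF measurable_X_path measurable_extend_zero])

text \<open>Whether a level is reached by some \<open>y \<le> t\<close> depends on
  \<open>V y\<close> alone, so the level time cut at \<open>t\<close> is jointly measurable in path
  and level for \<open>F t\<close>. Composition with the progressively measurable process and
  integration over the levels keep this.\<close>

lemma af_integral_adapted:
  assumes V: "regular_af V" and f: "f \<in> borel_measurable borel" and t: "t < \<infinity>"
  shows "af_integral V f t \<in> borel_measurable (F t)"
proof -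
  obtain u where u: "t = ennreal u" "0 \<le> u" using t by (cases t) auto
  let ?\<tau> = "\<lambda>x. level_time (\<lambda>t. V t (fst x)) (snd x)"
  have Vm: "(\<lambda>x. V y (fst x)) \<in> borel_measurable (F t \<Otimes>\<^sub>M borel)" if "y \<le> t" for y
    using measurable_compose[OF measurable_fst measurable_F_mono[OF regular_afD(1)[OF V] that]] that t
    by (auto intro: le_less_trans)
  have le: "{x \<in> space (F t \<Otimes>\<^sub>M borel). ?\<tau> x \<le> y} \<in> sets (F t \<Otimes>\<^sub>M borel)" if "y \<le> t" for y
  proof -
    have "y < \<infinity>" using that t by (rule le_less_trans)
    then have "{x \<in> space (F t \<Otimes>\<^sub>M borel). ?\<tau> x \<le> y} = {x \<in> space (F t \<Otimes>\<^sub>M borel). ennreal (snd x) \<le> V y (fst x)}"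
      using level_time_le_iff[OF regular_afD(2)[OF V]] by simp
    also have "\<dots> \<in> sets (F t \<Otimes>\<^sub>M borel)"
      using Vm[OF that] by measurable
    finally show ?thesis .
  qed
  have \<tau>: "(\<lambda>x. min (?\<tau> x) t) \<in> borel_measurable (F t \<Otimes>\<^sub>M borel)"
  proof (rule borel_measurableI_le)
    fix y
    show "{x \<in> space (F t \<Otimes>\<^sub>M borel). min (?\<tau> x) t \<le> y} \<in> sets (F t \<Otimes>\<^sub>M borel)"
    proof (cases "t \<le> y")
      case False
      then have "{x \<in> space (F t \<Otimes>\<^sub>M borel). min (?\<tau> x) t \<le> y} = {x \<in> space (F t \<Otimes>\<^sub>M borel). ?\<tau> x \<le> y}"
        by (auto simp: min_le_iff_disj)
      then show ?thesis using le[of y] False by (simp only: not_le less_imp_le)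
    qed (simp add: min_le_iff_disj)
  qed
  have XF: "(\<lambda>(r, \<omega>). X (ennreal (min r u)) \<omega>) \<in> borel \<Otimes>\<^sub>M F t \<rightarrow>\<^sub>M cemetery_borel"
    by (rule measurable_pair_mono[OF measurable_X_joint[OF u(2)]]) (use N_le_F[of t] u in auto)
  have "(\<lambda>x. (enn2real (min (?\<tau> x) t), fst x)) \<in> F t \<Otimes>\<^sub>M borel \<rightarrow>\<^sub>M borel \<Otimes>\<^sub>M F t"
    using \<tau> by measurable
  from measurable_compose[OF this XF]
  have "(\<lambda>x. X (ennreal (min (enn2real (min (?\<tau> x) t)) u)) (fst x)) \<in> F t \<Otimes>\<^sub>M borel \<rightarrow>\<^sub>M cemetery_borel"
    by simp
  moreover have "ennreal (min (enn2real (min (?\<tau> x) t)) u) = min (?\<tau> x) t" for x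
  proof -
    have "min (?\<tau> x) t < \<infinity>" using t by (simp add: min_less_iff_disj)
    moreover from this have "enn2real (min (?\<tau> x) t) \<le> u" using u by (intro enn2real_leI) auto
    ultimately show ?thesis by (simp add: min_absorb1 ennreal_enn2real)
  qed
  ultimately have "(\<lambda>x. X (min (?\<tau> x) t) (fst x)) \<in> F t \<Otimes>\<^sub>M borel \<rightarrow>\<^sub>M cemetery_borel" by simp
  from measurable_compose[OF this measurable_extend_zero[OF f]]
  have g: "(\<lambda>x. extend_zero f (X (min (?\<tau> x) t) (fst x))) \<in> borel_measurable (F t \<Otimes>\<^sub>M borel)" .
  have "(\<lambda>x. indicator {0<..} (snd x) * (if ?\<tau> x \<le> t then extend_zero f (X (min (?\<tau> x) t) (fst x)) else 0))
      \<in> borel_measurable (F t \<Otimes>\<^sub>M borel)"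
  proof -
    have [measurable]: "Measurable.pred (F t \<Otimes>\<^sub>M borel) (\<lambda>x. ?\<tau> x \<le> t)"
      using le[OF order_refl] by (simp add: pred_def)
    show ?thesis using g by measurable
  qed
  also have "(\<lambda>x. indicator {0<..} (snd x) * (if ?\<tau> x \<le> t then extend_zero f (X (min (?\<tau> x) t) (fst x)) else 0)) =
      (\<lambda>(\<omega>, r). indicator {0<..} r * (if level_time (\<lambda>t. V t \<omega>) r \<le> t
        then extend_zero f (X (level_time (\<lambda>t. V t \<omega>) r) \<omega>) else 0))"
    by (auto simp: fun_eq_iff min_absorb1)
  finally have "(\<lambda>(\<omega>, r). indicator {0<..} r * (if level_time (\<lambda>t. V t \<omega>) r \<le> t
        then extend_zero f (X (level_time (\<lambda>t. V t \<omega>) r) \<omega>) else 0)) \<in> borel_measurable (F t \<Otimes>\<^sub>M lborel)"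
    by (simp cong: measurable_cong_sets sets_pair_measure_cong)
  from sigma_finite_measure.borel_measurable_nn_integral[OF sigma_finite_lborel this]
  show ?thesis unfolding af_integral_def[abs_def] path_integral_def .
qed

lemma af_integral_infinity:
  assumes V: "regular_af V" and f: "f \<in> borel_measurable borel"
  shows "af_integral V f \<infinity> \<omega> = (SUP n. af_integral V f (of_nat n) \<omega>)"
  unfolding af_integral_def
  by (rule path_integral_infinity[OF regular_afD(2)[OF V] measurable_extend_zero_path[OF f]])
    (simp add: X_infinity[simplified] extend_zero_def)

lemma af_integral_measurable:
  assumes V: "regular_af V" and f: "f \<in> borel_measurable borel"
  shows "af_integral V f t \<in> borel_measurable (F t)"
proof (cases "t < \<infinity>")
  case True
  then show ?thesis by (rule af_integral_adapted[OF V f])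
next
  case False
  then have t: "t = \<infinity>" by (simp add: less_top[symmetric])
  have "af_integral V f (of_nat n) \<in> borel_measurable (F \<infinity>)" for n
    by (rule measurable_F_mono[OF af_integral_adapted[OF V f]]) (simp_all add: of_nat_less_top)
  then show ?thesis
    unfolding t af_integral_infinity[OF V f, abs_def] by (intro borel_measurable_SUP) auto
qed

lemma af_integral_additive_process:
  assumes V: "regular_af V" and f: "f \<in> borel_measurable borel"
  shows "additive_process (af_integral V f)"
  unfolding additive_process_def
proof (intro conjI allI impI)
  note v = regular_afD(2)[OF V] and y = measurable_extend_zero_path[OF f]
  show "af_integral V f t \<in> borel_measurable (F t)" for t by (rule af_integral_measurable[OF V f])
  show "af_integral V f s \<omega> \<le> af_integral V f t \<omega>" if "s \<le> t" for s t \<omega>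
    unfolding af_integral_def by (rule path_integral_mono[OF that])
  show "af_integral V f 0 \<omega> = 0" for \<omega>
    unfolding af_integral_def by (rule path_integral_0[OF v])
  show "continuous_on {0..} (\<lambda>t. af_integral V f (ennreal t) \<omega>)" if "af_integral V f \<infinity> \<omega> < \<infinity>" for \<omega>
    using that unfolding af_integral_def by (rule path_integral_continuous[OF v y])
  fix z
  show "AE \<omega> in Q z. \<forall>t<\<infinity>. \<forall>s. af_integral V f (t + s) \<omega> = af_integral V f t \<omega> + af_integral V f s (\<theta> t \<omega>)"
    using regular_afD(4)[OF V, of z]
  proof eventually_elim
    case (elim \<omega>)
    show ?case
    proof (intro allI impI)
      fix t s :: ennreal assume t: "t < \<infinity>"
      show "af_integral V f (t + s) \<omega> = af_integral V f t \<omega> + af_integral V f s (\<theta> t \<omega>)"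
      proof (cases "X t \<omega> = None")
        case False
        show ?thesis
          unfolding af_integral_def
          by (rule path_integral_add[OF v v y y t regular_afD(3)[OF V False]])
            (use elim t False in \<open>simp_all add: X_shift\<close>)
      next
        case True
        \<comment> \<open>From a dead time on the integrand vanishes, both along the path and along
          its shift, so additivity of the integral does not have to come from
          \<open>V\<close>.\<close>
        have "X u \<omega> = None" if "t \<le> u" for u using dead_mono[OF True that] .
        then have "extend_zero f (X u \<omega>) = 0" if "\<not> u \<le> t" for u
          using that by (simp add: extend_zero_def)
        then have "path_integral (\<lambda>t. V t \<omega>) (\<lambda>s. extend_zero f (X s \<omega>)) (t + s) =
            path_integral (\<lambda>t. V t \<omega>) (\<lambda>s. extend_zero f (X s \<omega>)) t"
          unfolding path_integral_def
          by (intro nn_integral_cong arg_cong2[where f = "(*)"] refl) (auto intro: order_trans)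
        moreover have "X u (\<theta> t \<omega>) = None" for u
          unfolding X_shift by (rule dead_mono[OF True]) simp
        then have "path_integral (\<lambda>u. V u (\<theta> t \<omega>)) (\<lambda>u. extend_zero f (X u (\<theta> t \<omega>))) s = 0"
          by (intro path_integral_zero) (simp add: extend_zero_def)
        ultimately show ?thesis unfolding af_integral_def by simp
      qed
    qed
  qed
qed

text \<open>Uniqueness requires equal and bounded expectations from every starting point, including
  the cemetery, where the Green function gives no information.\<close>

lemma af_integral_cemetery: "integral\<^sup>N (Q None) (af_integral V f t) = 0"
proof -
  have "AE \<omega> in Q None. X 0 \<omega> = None" using X_start by (simp add: AE_completion_iff)
  then have "AE \<omega> in Q None. af_integral V f t \<omega> = 0"
  proof eventually_elim
    case (elim \<omega>)
    then have "X u \<omega> = None" for u by (rule dead_mono) simp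
    then show ?case unfolding af_integral_def by (intro path_integral_zero) (simp add: extend_zero_def)
  qed
  then have "integral\<^sup>N (Q None) (af_integral V f t) = (\<integral>\<^sup>+\<omega>. 0 \<partial>Q None)" by (rule nn_integral_cong_AE)
  then show ?thesis by simp
qed

text \<open>The supremum stops short of the lifetime, where \<open>V\<close> may become infinite,
  but nothing is lost: a level reached before the lifetime is eventually counted along times
  converging to it, and later levels find the process at the cemetery. Fatou's lemma assembles the
  levels.\<close>

lemma integral_wrt_af_eq:
  assumes V: "regular_af V" and f: "f \<in> borel_measurable borel"
  shows "integral_wrt_af X V f \<omega> = af_integral V f \<infinity> \<omega>"
proof -
  note v = regular_afD(2)[OF V, of \<omega>] and y = measurable_extend_zero_path[OF f, of \<omega>]
  let ?J = "path_integral (\<lambda>t. V t \<omega>) (\<lambda>s. extend_zero f (X s \<omega>))"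
  let ?S = "{s::real. 0 \<le> s \<and> ennreal s < lifetime X \<omega>}"
  have "integral_wrt_af X V f \<omega> = (SUP s\<in>?S. ?J (ennreal s))"
    unfolding integral_wrt_af_def
  proof (rule SUP_cong[OF refl])
    fix s assume s: "s \<in> ?S"
    then have "X (ennreal s) \<omega> \<noteq> None" using alive_iff by blast
    with s show "(\<integral>\<^sup>+t\<in>{0..s}. extend_zero f (X (ennreal t) \<omega>) \<partial>interval_measure (\<lambda>t. enn2real (V (ennreal (min t s)) \<omega>))) =
        ?J (ennreal s)"
      by (intro nn_integral_interval_measure_path[OF v y] regular_afD(3)[OF V]) blast+
  qed
  also have "\<dots> = ?J \<infinity>"
  proof (rule antisym)
    show "(SUP s\<in>?S. ?J (ennreal s)) \<le> ?J \<infinity>" by (intro SUP_least path_integral_mono) simp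
    show "?J \<infinity> \<le> (SUP s\<in>?S. ?J (ennreal s))"
    proof (cases "lifetime X \<omega> = 0")
      case True
      then have "X u \<omega> = None" for u using X_dead[of \<omega> u] by simp
      then have "?J \<infinity> = 0" by (intro path_integral_zero) (simp add: extend_zero_def)
      then show ?thesis by simp
    next
      case False
      then have "0 < lifetime X \<omega>" by (simp add: zero_less_iff_neq_zero)
      then obtain u where u: "\<And>n. u n < lifetime X \<omega>" "u \<longlonglongrightarrow> lifetime X \<omega>"
        using approx_from_below_dense_linorder[of 0 "lifetime X \<omega>"] by auto
      let ?g = "\<lambda>t r. indicator {0<..} r * (if level_time (\<lambda>t. V t \<omega>) r \<le> t then extend_zero f (X (level_time (\<lambda>t. V t \<omega>) r) \<omega>) else 0)"
      have "?g \<infinity> r \<le> liminf (\<lambda>n. ?g (u n) r)" for r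
      proof (cases "level_time (\<lambda>t. V t \<omega>) r < lifetime X \<omega>")
        case True
        have "\<forall>\<^sub>F n in sequentially. level_time (\<lambda>t. V t \<omega>) r < u n"
          by (rule order_tendstoD(1)[OF u(2) True])
        then have "\<forall>\<^sub>F n in sequentially. ?g \<infinity> r \<le> ?g (u n) r"
          by eventually_elim simp
        then show ?thesis by (rule Liminf_bounded)
      next
        case False
        then have "X (level_time (\<lambda>t. V t \<omega>) r) \<omega> = None" by (intro X_dead) simp
        then show ?thesis by (simp add: extend_zero_def)
      qed
      then have "?J \<infinity> \<le> (\<integral>\<^sup>+r. liminf (\<lambda>n. ?g (u n) r) \<partial>lborel)"
        unfolding path_integral_def by (rule nn_integral_mono)
      also have "\<dots> \<le> liminf (\<lambda>n. ?J (u n))"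
        unfolding path_integral_def
        by (rule nn_integral_liminf) (use measurable_path_integrand[OF v y] in simp)
      also have "\<dots> \<le> (SUP s\<in>?S. ?J (ennreal s))"
      proof (rule Liminf_le)
        show "\<forall>\<^sub>F n in sequentially. ?J (u n) \<le> (SUP s\<in>?S. ?J (ennreal s))"
        proof (intro always_eventually allI)
          fix n
          have "u n < \<top>" using u(1)[of n] by (meson less_le_trans top_greatest)
          then have "ennreal (enn2real (u n)) = u n" by (rule ennreal_enn2real)
          then show "?J (u n) \<le> (SUP s\<in>?S. ?J (ennreal s))"
            using u(1)[of n] by (intro SUP_upper2[of "enn2real (u n)"]) auto
        qed
      qed simp
      finally show ?thesis .
    qed
  qed
  finally show ?thesis unfolding af_integral_def .
qed

definition regular_af_of :: "('a \<Rightarrow> 'a \<Rightarrow> ennreal) \<Rightarrow> 'a measure \<Rightarrow> (ennreal \<Rightarrow> 'w \<Rightarrow> ennreal) \<Rightarrow> bool" where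
  "regular_af_of G \<beta> V \<longleftrightarrow> regular_af V \<and> (\<forall>f\<in>borel_measurable borel. \<forall>x.
    integral\<^sup>N (Q (Some x)) (af_integral V f \<infinity>) = (\<integral>\<^sup>+y. G x y * f y \<partial>\<beta>))"

lemma regular_af_ofD:
  assumes "regular_af_of G \<beta> V"
  shows "regular_af V"
    "f \<in> borel_measurable borel \<Longrightarrow>
      integral\<^sup>N (Q (Some x)) (af_integral V f \<infinity>) = (\<integral>\<^sup>+y. G x y * f y \<partial>\<beta>)"
  using assms unfolding regular_af_of_def by simp_all

text \<open>The regular version agrees with \<open>V\<close> at all finite times almost surely from
  every point of \<open>E\<close>, so it inherits the potentials.\<close>

lemma strict_pcaf_of_regularization:
  assumes V: "strict_pcaf_of X P \<theta> G \<beta> V"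
  shows "\<exists>V'. regular_af_of G \<beta> V' \<and> (\<forall>x. AE \<omega> in Q (Some x). \<forall>t<\<infinity>. V' t \<omega> = V t \<omega>)"
proof -
  have s: "strict_pcaf X P \<theta> V"
    and G: "f \<in> borel_measurable borel \<Longrightarrow> integral\<^sup>N (Q (Some x)) (integral_wrt_af X V f) = (\<integral>\<^sup>+y. G x y * f y \<partial>\<beta>)" for f x
    using V unfolding strict_pcaf_of_def by auto
  obtain V' where V': "regular_af V'" "\<And>x. AE \<omega> in Q (Some x). \<forall>t<\<infinity>. V' t \<omega> = V t \<omega>"
  proof (rule strict_pcaf_regularization[OF s])
    fix V' assume "regular_af V'" "\<And>x. AE \<omega> in Q (Some x). \<forall>t<\<infinity>. V' t \<omega> = V t \<omega>"
    then show thesis by (rule that)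
  qed
  have "integral\<^sup>N (Q (Some x)) (af_integral V' f \<infinity>) = (\<integral>\<^sup>+y. G x y * f y \<partial>\<beta>)"
    if f: "f \<in> borel_measurable borel" for f x
  proof -
    have "integral\<^sup>N (Q (Some x)) (af_integral V' f \<infinity>) = integral\<^sup>N (Q (Some x)) (integral_wrt_af X V f)"
    proof (rule nn_integral_cong_AE)
      show "AE \<omega> in Q (Some x). af_integral V' f \<infinity> \<omega> = integral_wrt_af X V f \<omega>"
        using V'(2)[of x]
      proof eventually_elim
        case (elim \<omega>)
        then have "integral_wrt_af X V f \<omega> = integral_wrt_af X V' f \<omega>"
          unfolding integral_wrt_af_def by simp
        then show ?case by (simp add: integral_wrt_af_eq[OF V'(1) f])
      qed
    qed
    then show ?thesis using G[OF f] by simp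
  qed
  with V'(1) have "regular_af_of G \<beta> V'" unfolding regular_af_of_def by (intro conjI ballI allI)
  with V'(2) show ?thesis by (intro exI[of _ V'] conjI allI)
qed

end

section \<open>Comparison of additive functionals\<close>

lemma measures_increase_to_const:
  "measures_increase_to (\<lambda>_. \<nu>) \<nu>"
  unfolding measures_increase_to_def by (simp add: incseq_def)

lemma measures_increase_to_le:
  assumes "measures_increase_to \<nu>s \<nu>" "B \<in> sets borel"
  shows "emeasure (\<nu>s n) B \<le> emeasure \<nu> B" "emeasure (\<nu>s n) B \<le> emeasure (\<nu>s (Suc n)) B"
  using assms unfolding measures_increase_to_def by (auto intro: incseq_le incseq_SucD)

section \<open>The exponential of a functional that may become infinite\<close>

lemma exp_neg_le_1: "exp_neg a \<le> 1"
  unfolding exp_neg_def by (auto simp flip: ennreal_1 intro!: ennreal_leI)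

lemma measurable_exp_neg [measurable]: "exp_neg \<in> borel_measurable borel"
  unfolding exp_neg_def[abs_def] by measurable

lemma exp_neg_tendsto_incseq:
  assumes "incseq a"
  shows "(\<lambda>n. exp_neg (a n)) \<longlonglongrightarrow> exp_neg (SUP n. a n)"
proof -
  have lim: "a \<longlonglongrightarrow> (SUP n. a n)" by (rule LIMSEQ_SUP[OF assms])
  show ?thesis
  proof (cases "(SUP n. a n) = \<infinity>")
    case False
    then have fin: "a n \<noteq> \<infinity>" for n
      using SUP_upper[of n UNIV a] by (metis UNIV_I infinity_ennreal_def top_unique)
    have "(\<lambda>n. enn2real (a n)) \<longlonglongrightarrow> enn2real (SUP n. a n)"
    proof (rule tendsto_enn2real)
      have "ennreal (enn2real (SUP n. a n)) = (SUP n. a n)"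
        using False by (intro ennreal_enn2real) (simp only: infinity_ennreal_def top.not_eq_extremum)
      with lim show "a \<longlonglongrightarrow> ennreal (enn2real (SUP n. a n))" by (simp only:)
    qed simp
    then have "(\<lambda>n. ennreal (exp (- enn2real (a n)))) \<longlonglongrightarrow> ennreal (exp (- enn2real (SUP n. a n)))"
      by (intro tendsto_ennrealI tendsto_exp tendsto_minus)
    then show ?thesis using False fin unfolding exp_neg_def by (simp only: if_False)
  next
    case True
    have "(\<lambda>n. exp_neg (a n)) \<longlonglongrightarrow> 0"
    proof (rule order_tendstoI)
      fix u :: ennreal assume "0 < u"
      then obtain y where y: "0 < y" "y < u" using dense by blast
      then obtain r where r: "y = ennreal r" "0 < r" by (cases y) auto
      \<comment> \<open>Beyond \<open>- ln r\<close> the exponential is below \<open>r\<close>; the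
        maximum with 0 makes the comparison in \<open>ennreal\<close> equivalent to the one between
        reals.\<close>
      have "ennreal (max 0 (- ln r)) < (SUP n. a n)" unfolding True infinity_ennreal_def by (rule ennreal_less_top)
      from order_tendstoD(1)[OF lim this]
      show "\<forall>\<^sub>F n in sequentially. exp_neg (a n) < u"
      proof eventually_elim
        case (elim n)
        show ?case
        proof (cases "a n")
          case (real s)
          have "max 0 (- ln r) < s"
            using elim unfolding \<open>a n = ennreal s\<close> by (rule ennreal_less_iff[THEN iffD1, rotated]) simp
          then have "- ln r < s" by simp
          then have "exp (- s) < exp (ln r)" by simp
          then have "exp_neg (a n) \<le> y" using r real by (simp add: exp_neg_def ennreal_leI)
          then show ?thesis using y(2) by simp
        next
          case top
          then show ?thesis using \<open>0 < u\<close> by (simp add: exp_neg_def)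
        qed
      qed
    qed simp
    then show ?thesis using True by (simp add: exp_neg_def)
  qed
qed

context hunt begin

lemma af_integral_le:
  assumes V: "regular_af V" and t: "t < \<infinity>" and f: "\<And>x. f x \<le> 1"
  shows "af_integral V f t \<omega> \<le> V t \<omega>"
  unfolding af_integral_def
  by (rule path_integral_le[OF regular_afD(2)[OF V] t]) (simp add: extend_zero_def f split: option.split)

lemma af_integral_1:
  assumes V: "regular_af V" and t: "X t \<omega> \<noteq> None"
  shows "af_integral V (\<lambda>_. 1) t \<omega> = V t \<omega>"
  unfolding af_integral_def
proof (rule path_integral_eq[OF regular_afD(2)[OF V]])
  show "t < \<infinity>" using t X_infinity[of \<omega>] by (cases t) auto
  show "V t \<omega> < \<infinity>" by (rule regular_afD(3)[OF V t])
  show "extend_zero (\<lambda>_. 1) (X s \<omega>) = 1" if "s \<le> t" for s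
    using dead_mono[OF _ that] t by (auto simp: extend_zero_def split: option.split)
qed

lemma af_integral_liminf:
  assumes V: "regular_af V" and f: "\<And>n. f n \<in> borel_measurable borel"
  shows "af_integral V (\<lambda>y. liminf (\<lambda>n. f n y)) t \<omega> \<le> liminf (\<lambda>n. af_integral V (f n) t \<omega>)"
proof -
  have "extend_zero (\<lambda>y. liminf (\<lambda>n. f n y)) z = liminf (\<lambda>n. extend_zero (f n) z)" for z
    by (cases z) (simp_all add: extend_zero_def Liminf_const)
  then show ?thesis
    unfolding af_integral_def
    using path_integral_liminf[where y = "\<lambda>n s. extend_zero (f n) (X s \<omega>)" and v = "\<lambda>t. V t \<omega>" and t = t,
        OF regular_afD(2)[OF V] measurable_extend_zero_path[OF f]]
    by simp
qed

lemma af_integral_mono_add: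
  assumes V: "regular_af V" and f: "f \<in> borel_measurable borel" "g \<in> borel_measurable borel"
    and le: "\<And>x. k x \<le> f x + g x"
  shows "af_integral V k t \<omega> \<le> af_integral V f t \<omega> + af_integral V g t \<omega>"
proof -
  have "af_integral V k t \<omega> \<le> path_integral (\<lambda>t. V t \<omega>) (\<lambda>s. extend_zero f (X s \<omega>) + extend_zero g (X s \<omega>)) t"
    unfolding af_integral_def
    by (rule path_integral_mono_integrand) (simp add: extend_zero_def le split: option.split)
  also have "\<dots> = af_integral V f t \<omega> + af_integral V g t \<omega>"
    unfolding af_integral_def
    by (rule path_integral_add_integrand[OF regular_afD(2)[OF V]]) (intro measurable_extend_zero_path f)+
  finally show ?thesis .
qed

text \<open>Both integrals have the potential of the common measure restricted to \<open>B\<close>.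
  It is bounded because \<open>h\<close> is at most 1 and the potential of \<open>\<gamma>\<close>
  on \<open>B\<close> is bounded, so uniqueness of additive processes applies.\<close>

lemma af_integral_eq_of_density_eq:
  assumes G: "\<And>x. G x \<in> borel_measurable borel" and f: "f \<in> borel_measurable borel" and h: "h \<in> borel_measurable borel"
    and VG: "regular_af_of G \<beta> V" and WG: "regular_af_of G \<gamma> W"
    and sets: "sets \<beta> = sets borel" "sets \<gamma> = sets borel"
    and eq: "density \<beta> f = density \<gamma> h" and h1: "\<And>y. h y \<le> 1"
    and B: "B \<in> sets borel" and c: "\<And>x. potential G (density \<gamma> (indicator B)) x \<le> ennreal c"
    and T: "0 \<le> T"
  shows "AE \<omega> in Q z. af_integral V (\<lambda>y. f y * indicator B y) (ennreal T) \<omega> =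
    af_integral W (\<lambda>y. h y * indicator B y) (ennreal T) \<omega>"
proof (rule additive_process_eq_of_expectation[OF _ _ _ _ T, where c = c])
  note V = regular_af_ofD(1)[OF VG] and W = regular_af_ofD(1)[OF WG]
  have fB: "(\<lambda>y. f y * indicator B y) \<in> borel_measurable borel" and hB: "(\<lambda>y. h y * indicator B y) \<in> borel_measurable borel"
    using f h B by auto
  show "additive_process (af_integral V (\<lambda>y. f y * indicator B y))" by (rule af_integral_additive_process[OF V fB])
  show "additive_process (af_integral W (\<lambda>y. h y * indicator B y))" by (rule af_integral_additive_process[OF W hB])
  have m\<beta>: "g \<in> borel_measurable \<beta>" and m\<gamma>: "g \<in> borel_measurable \<gamma>" if "g \<in> borel_measurable borel" for g :: "'a \<Rightarrow> ennreal"
    using that sets by (simp_all cong: measurable_cong_sets)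
  have GB: "(\<lambda>y. G x y * indicator B y) \<in> borel_measurable borel" for x using G[of x] B by measurable
  have "(\<integral>\<^sup>+y. G x y * (f y * indicator B y) \<partial>\<beta>) = (\<integral>\<^sup>+y. G x y * indicator B y \<partial>density \<beta> f)" for x
    using nn_integral_density[OF m\<beta>[OF f] m\<beta>[OF GB[of x]]] by (simp add: ac_simps)
  moreover have "(\<integral>\<^sup>+y. G x y * (h y * indicator B y) \<partial>\<gamma>) = (\<integral>\<^sup>+y. G x y * indicator B y \<partial>density \<gamma> h)" for x
    using nn_integral_density[OF m\<gamma>[OF h] m\<gamma>[OF GB[of x]]] by (simp add: ac_simps)
  ultimately have e: "(\<integral>\<^sup>+y. G x y * (f y * indicator B y) \<partial>\<beta>) = (\<integral>\<^sup>+y. G x y * (h y * indicator B y) \<partial>\<gamma>)" for x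
    by (simp add: eq)
  have b: "(\<integral>\<^sup>+y. G x y * (h y * indicator B y) \<partial>\<gamma>) \<le> ennreal c" for x
  proof -
    have "(\<integral>\<^sup>+y. G x y * (h y * indicator B y) \<partial>\<gamma>) \<le> (\<integral>\<^sup>+y. indicator B y * G x y \<partial>\<gamma>)"
    proof (rule nn_integral_mono)
      fix y show "G x y * (h y * indicator B y) \<le> indicator B y * G x y"
        using mult_left_mono[OF h1[of y], of "G x y"] by (simp add: indicator_def)
    qed
    also have "\<dots> = potential G (density \<gamma> (indicator B)) x"
      unfolding potential_def using B G by (subst nn_integral_density) (auto intro!: m\<gamma>)
    finally show ?thesis using c[of x] by simp
  qed
  show "(\<integral>\<^sup>+\<omega>. af_integral V (\<lambda>y. f y * indicator B y) \<infinity> \<omega> \<partial>Q y) =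
      (\<integral>\<^sup>+\<omega>. af_integral W (\<lambda>y. h y * indicator B y) \<infinity> \<omega> \<partial>Q y)" for y
    by (cases y) (simp_all only: af_integral_cemetery regular_af_ofD(2)[OF VG fB] regular_af_ofD(2)[OF WG hB] e)
  show "(\<integral>\<^sup>+\<omega>. af_integral V (\<lambda>y. f y * indicator B y) \<infinity> \<omega> \<partial>Q y) \<le> ennreal c" for y
    by (cases y) (simp_all only: af_integral_cemetery regular_af_ofD(2)[OF VG fB] e b zero_le)
qed

text \<open>The truncated integrals of \<open>V\<close> equal integrals against \<open>W n\<close>,
  which are at most \<open>W n\<close>. Fatou's lemma removes first the nest (in \<open>j\<close>),
  then the truncation (in \<open>n\<close>). Equality is available at rational times only;
  monotonicity and continuity extend the bound to all live times.\<close>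

lemma strictly_smooth_af_le_SUP:
  assumes G: "\<And>x. G x \<in> borel_measurable borel"
    and VG: "regular_af_of G \<beta> V" and WG: "\<And>n. regular_af_of G (\<gamma> n) (W n)"
    and \<nu>: "smooth_measure m D \<E> \<nu>" and \<beta>: "sets \<beta> = sets borel" "\<And>B. B \<in> sets borel \<Longrightarrow> emeasure \<beta> B \<le> emeasure \<nu> B"
    and \<gamma>: "\<And>n. strictly_smooth_measure m D \<E> G (\<gamma> n)" "measures_increase_to \<gamma> \<nu>"
  shows "AE \<omega> in Q (Some x). \<forall>t. X t \<omega> \<noteq> None \<longrightarrow> V t \<omega> \<le> (SUP n. W n t \<omega>)"
proof -
  note V = regular_af_ofD(1)[OF VG] and W = regular_af_ofD(1)[OF WG]
  have sets_\<nu>: "sets \<nu> = sets borel" using \<nu> by (simp add: smooth_measure_def)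
  have sets_\<gamma>: "sets (\<gamma> n) = sets borel" for n
    using \<gamma>(1)[of n] by (simp add: strictly_smooth_measure_def smooth_measure_def)
  obtain f h :: "nat \<Rightarrow> 'a \<Rightarrow> ennreal" where
    fm: "\<And>n. f n \<in> borel_measurable borel" and hm: "\<And>n. h n \<in> borel_measurable borel"
    and h1: "\<And>n x. h n x \<le> 1"
    and eq: "\<And>n. density \<beta> (f n) = density (\<gamma> n) (h n)" and lim: "AE x in \<beta>. (\<lambda>n. f n x) \<longlonglongrightarrow> 1"
  proof (rule increasing_measures_common_densities[OF smooth_measure_sigma_finite[OF locally_compact \<nu>] sets_\<nu> \<beta>(1) sets_\<gamma> \<beta>(2) \<gamma>(2)])
    fix f h :: "nat \<Rightarrow> 'a \<Rightarrow> ennreal"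
    assume "\<And>n. f n \<in> borel_measurable borel" "\<And>n. h n \<in> borel_measurable borel" "\<And>n x. f n x \<le> 1"
      "\<And>n x. h n x \<le> 1" "\<And>n. density \<beta> (f n) = density (\<gamma> n) (h n)" "AE x in \<beta>. (\<lambda>n. f n x) \<longlonglongrightarrow> 1"
    then show thesis by (intro that[of f h])
  qed
  define nest where "nest n B \<longleftrightarrow> (\<forall>j::nat. B j \<in> sets borel) \<and> incseq B \<and> (\<Union>j. B j) = UNIV \<and>
      (\<forall>j. \<exists>c::real. \<forall>x. potential G (density (\<gamma> n) (indicator (B j))) x \<le> ennreal c)" for n B
  have "\<exists>B. nest n B" for n
    using \<gamma>(1)[of n] unfolding strictly_smooth_measure_def nest_def by (rule conjunct2)
  then obtain B where "nest n (B n)" for n by metis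
  note B' = this[unfolded nest_def]
  have B: "B n j \<in> sets borel" "incseq (B n)" "(\<Union>j. B n j) = UNIV" for n j
    using B'[of n] by simp_all
  have Bc: "\<exists>c::real. \<forall>x. potential G (density (\<gamma> n) (indicator (B n j))) x \<le> ennreal c" for n j
    using B'[of n, THEN conjunct2, THEN conjunct2, THEN conjunct2] by (rule spec)
  \<comment> \<open>Countably many identities share one exceptional null set, hence the restriction
    to rational times.\<close>
  have eqs: "AE \<omega> in Q (Some x). \<forall>n j. \<forall>q::rat. 0 \<le> q \<longrightarrow>
      af_integral V (\<lambda>y. f n y * indicator (B n j) y) (ennreal (of_rat q)) \<omega> =
      af_integral (W n) (\<lambda>y. h n y * indicator (B n j) y) (ennreal (of_rat q)) \<omega>"
    unfolding AE_all_countable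
  proof (intro allI)
    fix n j and q :: rat
    from Bc[of n j] obtain c where c: "\<forall>x. potential G (density (\<gamma> n) (indicator (B n j))) x \<le> ennreal c"
      by (rule exE)
    note af_integral_eq_of_density_eq[where G = G and f = "f n" and h = "h n" and V = V and W = "W n" and \<beta> = \<beta>
        and \<gamma> = "\<gamma> n" and B = "B n j" and c = c and T = "of_rat q" and z = "Some x",
        OF G fm hm VG WG \<beta>(1) sets_\<gamma> eq h1 B(1) c[rule_format]]
    then show "AE \<omega> in Q (Some x). 0 \<le> q \<longrightarrow> af_integral V (\<lambda>y. f n y * indicator (B n j) y) (ennreal (of_rat q)) \<omega> =
      af_integral (W n) (\<lambda>y. h n y * indicator (B n j) y) (ennreal (of_rat q)) \<omega>"
      by (cases "0 \<le> q") simp_all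
  qed
  define g where "g y = liminf (\<lambda>n. f n y)" for y
  have gm: "g \<in> borel_measurable borel" unfolding g_def[abs_def] using fm by measurable
  \<comment> \<open>The limit of the truncations fails to be 1 only on this
    \<open>\<beta>\<close>-null set. Its potential vanishes, so almost surely the functional
    \<open>V\<close> does not grow while the process is there.\<close>
  define Z where "Z = {y. g y \<noteq> 1}"
  have Z: "Z \<in> sets borel" unfolding Z_def using gm by measurable
  have iZ: "(indicator Z :: 'a \<Rightarrow> ennreal) \<in> borel_measurable borel" using Z by simp
  have "AE y in \<beta>. g y = 1" using lim unfolding g_def
    by eventually_elim (rule lim_imp_Liminf, simp_all)
  then have "AE y in \<beta>. G x y * indicator Z y = 0" by eventually_elim (simp add: Z_def)
  then have "(\<integral>\<^sup>+y. G x y * indicator Z y \<partial>\<beta>) = (\<integral>\<^sup>+y. 0 \<partial>\<beta>)" by (rule nn_integral_cong_AE)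
  then have "integral\<^sup>N (Q (Some x)) (af_integral V (indicator Z) \<infinity>) = 0" by (simp add: regular_af_ofD(2)[OF VG iZ, simplified])
  then have zero: "AE \<omega> in Q (Some x). af_integral V (indicator Z) \<infinity> \<omega> = 0"
    by (subst (asm) nn_integral_0_iff_AE[OF measurable_FQ[OF af_integral_measurable[OF V iZ]]])
  from eqs zero show ?thesis
  proof eventually_elim
    case (elim \<omega>)
    note v = regular_afD(2)[OF V, of \<omega>]
    have rational: "V (ennreal (of_rat q)) \<omega> \<le> (SUP n. W n (ennreal (of_rat q)) \<omega>)"
      if q: "0 \<le> q" "X (ennreal (of_rat q)) \<omega> \<noteq> None" for q :: rat
    proof -
      let ?t = "ennreal (of_rat q)" and ?S = "SUP n. W n (ennreal (of_rat q)) \<omega>"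
      have fn: "af_integral V (f n) ?t \<omega> \<le> ?S" for n
      proof -
        \<comment> \<open>Each point lies in all sufficiently late members of the nest, so the
          sequence in \<open>j\<close> is eventually constant.\<close>
        have ev: "liminf (\<lambda>j. f n y * indicator (B n j) y) = f n y" for y
        proof -
          obtain j0 where "y \<in> B n j0" using B(3)[of n] by auto
          then have "\<forall>j\<ge>j0. y \<in> B n j" using B(2)[of n] by (auto simp: incseq_def)
          then have "\<forall>\<^sub>F j in sequentially. f n y * indicator (B n j) y = f n y"
            by (intro eventually_sequentiallyI[of j0]) simp
          from tendsto_eventually[OF this] show ?thesis by (rule lim_imp_Liminf[rotated]) simp
        qed
        have "af_integral V (f n) ?t \<omega> = af_integral V (\<lambda>y. liminf (\<lambda>j. f n y * indicator (B n j) y)) ?t \<omega>"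
          by (simp only: ev)
        also have "\<dots> \<le> liminf (\<lambda>j. af_integral V (\<lambda>y. f n y * indicator (B n j) y) ?t \<omega>)"
          by (rule af_integral_liminf[OF V]) (use fm B(1) in measurable)
        also have "\<dots> \<le> ?S"
        proof (rule Liminf_le)
          show "\<forall>\<^sub>F j in sequentially. af_integral V (\<lambda>y. f n y * indicator (B n j) y) ?t \<omega> \<le> ?S"
          proof (intro always_eventually allI)
            fix j
            have "af_integral V (\<lambda>y. f n y * indicator (B n j) y) ?t \<omega> =
                af_integral (W n) (\<lambda>y. h n y * indicator (B n j) y) ?t \<omega>"
              using elim(1) q(1) by blast
            also have "\<dots> \<le> W n ?t \<omega>"
              by (rule af_integral_le[OF W]) (use h1 in \<open>auto simp: indicator_def\<close>)
            also have "\<dots> \<le> ?S" by (rule SUP_upper) simp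
            finally show "af_integral V (\<lambda>y. f n y * indicator (B n j) y) ?t \<omega> \<le> ?S" .
          qed
        qed simp
        finally show ?thesis .
      qed
      have "V ?t \<omega> = af_integral V (\<lambda>_. 1) ?t \<omega>" by (rule af_integral_1[OF V q(2), symmetric])
      also have "\<dots> \<le> af_integral V g ?t \<omega> + af_integral V (indicator Z) ?t \<omega>"
        by (rule af_integral_mono_add[OF V gm iZ]) (simp add: Z_def indicator_def)
      also have "af_integral V (indicator Z) ?t \<omega> \<le> af_integral V (indicator Z) \<infinity> \<omega>"
        unfolding af_integral_def by (rule path_integral_mono) simp
      also have "af_integral V (indicator Z) \<infinity> \<omega> = 0" by (rule elim(2))
      also have "af_integral V g ?t \<omega> \<le> liminf (\<lambda>n. af_integral V (f n) ?t \<omega>)"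
        unfolding g_def[abs_def] by (rule af_integral_liminf[OF V fm])
      also have "liminf (\<lambda>n. af_integral V (f n) ?t \<omega>) \<le> ?S"
        by (rule Liminf_le) (simp_all add: fn)
      finally show ?thesis by (simp add: add_mono)
    qed
    show ?case
    proof (intro allI impI)
      fix t assume t: "X t \<omega> \<noteq> None"
      have fin: "t < \<infinity>" using t X_infinity[of \<omega>] by (cases t) auto
      show "V t \<omega> \<le> (SUP n. W n t \<omega>)"
      proof (rule ccontr)
        assume less: "\<not> V t \<omega> \<le> (SUP n. W n t \<omega>)"
        then have tm: "t \<in> {u. u < \<infinity> \<and> (SUP n. W n t \<omega>) < V u \<omega>}" using fin by auto
        have "t \<noteq> 0" using less regular_pathD(1)[OF v] by auto
        then have "0 < t" by (simp add: zero_less_iff_neq_zero)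
        from open_left[OF open_path_level(2)[OF v] tm this] obtain b where
          b: "b < t" "{b<..t} \<subseteq> {u. u < \<infinity> \<and> (SUP n. W n t \<omega>) < V u \<omega>}" by blast
        obtain q :: rat where q: "0 \<le> q" "b < ennreal (of_rat q)" "ennreal (of_rat q) < t"
        proof -
          obtain b' t' where bt: "b = ennreal b'" "0 \<le> b'" "t = ennreal t'" "0 \<le> t'"
            using b(1) fin by (cases b; cases t) auto
          then have "b' < t'" using b(1) by (simp add: ennreal_less_iff)
          then obtain q where q: "b' < of_rat q" "of_rat q < t'" using of_rat_dense by blast
          then have "0 \<le> q" using bt(2) by (metis le_less_trans less_imp_le zero_less_of_rat_iff)
          then show thesis using q bt by (intro that[of q]) (simp_all add: ennreal_less_iff)
        qed
        have "X (ennreal (of_rat q)) \<omega> \<noteq> None" using dead_mono[of _ \<omega> t] q(3) t by (metis less_imp_le)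
        from rational[OF q(1) this]
        have "V (ennreal (of_rat q)) \<omega> \<le> (SUP n. W n t \<omega>)"
        proof (rule order_trans)
          show "(SUP n. W n (ennreal (of_rat q)) \<omega>) \<le> (SUP n. W n t \<omega>)"
            using regular_pathD(2)[OF regular_afD(2)[OF W] less_imp_le[OF q(3)] fin] by (intro SUP_mono) blast
        qed
        moreover have "ennreal (of_rat q) \<in> {b<..t}" using q by simp
        ultimately show False using b(2) by (auto dest: leD)
      qed
    qed
  qed
qed

section \<open>Convergence of the killed resolvents\<close>

text \<open>By monotonicity and right-continuity, the value at \<open>r\<close> is the infimum of
  the values at the grid points above \<open>r\<close>.\<close>

lemma regular_af_joint_measurable:
  assumes V: "regular_af V"
  shows "(\<lambda>(r, \<omega>). V (ennreal r) \<omega>) \<in> borel_measurable (borel \<Otimes>\<^sub>M Q z)"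
proof -
  have "V (ennreal u) \<in> borel_measurable (Q z)" for u
    by (rule measurable_FQ[OF regular_afD(1)[OF V]]) simp
  from measurable_grid_step[OF this]
  have "(\<lambda>x. INF n. (\<lambda>(r, \<omega>). V (ennreal (grid_up n r)) \<omega>) x) \<in> borel_measurable (borel \<Otimes>\<^sub>M Q z)"
    by (intro borel_measurable_INF) simp_all
  moreover have "(INF n. V (ennreal (grid_up n r)) \<omega>) = V (ennreal r) \<omega>" for r \<omega>
  proof (rule antisym)
    note v = regular_afD(2)[OF V, of \<omega>]
    show "V (ennreal r) \<omega> \<le> (INF n. V (ennreal (grid_up n r)) \<omega>)"
      by (intro INF_greatest regular_pathD(2)[OF v] ennreal_leI less_imp_le[OF grid_up_gt]) simp
    have "(\<lambda>n. ennreal (grid_up n r)) \<longlonglongrightarrow> ennreal r"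
      by (rule tendsto_ennrealI[OF grid_up_LIMSEQ])
    then have "(\<lambda>n. V (ennreal (grid_up n r)) \<omega>) \<longlonglongrightarrow> V (ennreal r) \<omega>"
      by (rule continuous_on_tendsto_compose[OF regular_pathD(3)[OF v]]) simp_all
    then show "(INF n. V (ennreal (grid_up n r)) \<omega>) \<le> V (ennreal r) \<omega>"
      by (rule LIMSEQ_le_const) (auto intro: INF_lower)
  qed
  ultimately show ?thesis by (simp add: split_beta')
qed

text \<open>Dominated convergence twice: in time along a path, with majorant \<open>\<eta>\<close>
  along that path, and then over the paths, with majorant its time integral. All comparisons are
  needed at live times only, since the integrand vanishes at the cemetery.\<close>

lemma killed_resolvent_tendsto:
  assumes W: "\<And>n. regular_af (W n)" and A: "\<And>n. AE \<omega> in Q (Some x). \<forall>t<\<infinity>. A n t \<omega> = W n t \<omega>"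
    and inc: "\<And>n. AE \<omega> in Q (Some x). \<forall>t. X t \<omega> \<noteq> None \<longrightarrow> W n t \<omega> \<le> W (Suc n) t \<omega>"
    and B: "AE \<omega> in Q (Some x). \<forall>t. X t \<omega> \<noteq> None \<longrightarrow> B t \<omega> = (SUP n. W n t \<omega>)"
    and \<eta>: "\<eta> \<in> borel_measurable borel" and fin: "resolvent X P 0 \<eta> x < \<infinity>"
  shows "(\<lambda>n. killed_resolvent X P (A n) \<eta> x) \<longlonglongrightarrow> killed_resolvent X P B \<eta> x"
proof -
  let ?e = "\<lambda>t \<omega>. extend_zero \<eta> (X (ennreal t) \<omega>) * indicator {0..} t"
  let ?u = "\<lambda>n \<omega>. \<integral>\<^sup>+t. exp_neg (W n (ennreal t) \<omega>) * ?e t \<omega> \<partial>lborel"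
  let ?v = "\<lambda>\<omega>. \<integral>\<^sup>+t. exp_neg (SUP n. W n (ennreal t) \<omega>) * ?e t \<omega> \<partial>lborel"
  let ?D = "\<lambda>\<omega>. \<integral>\<^sup>+t. ?e t \<omega> \<partial>lborel"
  \<comment> \<open>The value 0 at the cemetery already enforces the restriction to times before the
    lifetime; only \<open>t \<ge> 0\<close> has to be kept.\<close>
  have alive: "g * extend_zero \<eta> (X (ennreal t) \<omega>) * indicator {t. 0 \<le> t \<and> ennreal t < lifetime X \<omega>} t = g * ?e t \<omega>"
    for g :: ennreal and t \<omega>
  proof (cases "0 \<le> t \<and> \<not> ennreal t < lifetime X \<omega>")
    case True
    then have "lifetime X \<omega> \<le> ennreal t" by (simp only: not_less)
    then have "X (ennreal t) \<omega> = None" by (rule X_dead)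
    then show ?thesis by (simp add: extend_zero_def)
  next
    case False
    then show ?thesis by (auto simp: indicator_def)
  qed
  have XQ: "(\<lambda>(t, \<omega>). X (ennreal t) \<omega>) \<in> borel \<Otimes>\<^sub>M Q (Some x) \<rightarrow>\<^sub>M cemetery_borel"
    by (rule measurable_pair_mono[OF measurable_X_joint_infinity]) auto
  have em: "(\<lambda>y. ?e (fst y) (snd y)) \<in> borel_measurable (borel \<Otimes>\<^sub>M Q (Some x))"
    using measurable_compose[OF XQ measurable_extend_zero[OF \<eta>]] by (simp add: split_beta')
  have Wm: "(\<lambda>y. W n (ennreal (fst y)) (snd y)) \<in> borel_measurable (borel \<Otimes>\<^sub>M Q (Some x))" for n
    using regular_af_joint_measurable[OF W[of n], of "Some x"] by (simp add: split_beta')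
  have um: "(\<lambda>y. exp_neg (W n (ennreal (fst y)) (snd y)) * ?e (fst y) (snd y)) \<in> borel_measurable (borel \<Otimes>\<^sub>M Q (Some x))" for n
    by (rule borel_measurable_times_ennreal[OF measurable_compose[OF Wm measurable_exp_neg] em])
  have vm: "(\<lambda>y. exp_neg (SUP n. W n (ennreal (fst y)) (snd y)) * ?e (fst y) (snd y)) \<in> borel_measurable (borel \<Otimes>\<^sub>M Q (Some x))"
    by (intro borel_measurable_times_ennreal[OF measurable_compose[OF _ measurable_exp_neg] em]
        borel_measurable_SUP Wm) simp
  have integral_m: "(\<lambda>\<omega>. \<integral>\<^sup>+t. k (t, \<omega>) \<partial>lborel) \<in> borel_measurable (Q (Some x))"
    if "k \<in> borel_measurable (borel \<Otimes>\<^sub>M Q (Some x))" for k :: "real \<times> 'w \<Rightarrow> ennreal"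
  proof -
    have "(\<lambda>(\<omega>, t). k (t, \<omega>)) \<in> borel_measurable (Q (Some x) \<Otimes>\<^sub>M lborel)"
      using measurable_compose[OF measurable_pair_swap' that]
      by (simp add: split_beta' cong: measurable_cong_sets sets_pair_measure_cong)
    from sigma_finite_measure.borel_measurable_nn_integral[OF sigma_finite_lborel this]
    show ?thesis .
  qed
  have section_m: "(\<lambda>t. k (t, \<omega>)) \<in> borel_measurable lborel"
    if "k \<in> borel_measurable (borel \<Otimes>\<^sub>M Q (Some x))" for k :: "real \<times> 'w \<Rightarrow> ennreal" and \<omega>
    using measurable_compose[OF measurable_Pair2'[of \<omega> "Q (Some x)" borel] that] by simp
  have uQ: "?u n \<in> borel_measurable (Q (Some x))" for n using integral_m[OF um[of n]] by simp
  have vQ: "?v \<in> borel_measurable (Q (Some x))" using integral_m[OF vm] by simp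
  have DQ: "?D \<in> borel_measurable (Q (Some x))" using integral_m[OF em] by simp
  have "resolvent X P 0 \<eta> x = integral\<^sup>N (P (Some x)) ?D"
    unfolding resolvent_def by (intro nn_integral_cong) (use alive[of 1] in simp)
  then have Dfin: "integral\<^sup>N (Q (Some x)) ?D < \<infinity>"
    using fin by (simp only: nn_integral_completion)
  have AE_D: "AE \<omega> in Q (Some x). ?D \<omega> \<noteq> \<infinity>"
    by (rule nn_integral_PInf_AE[OF DQ]) (use Dfin in \<open>simp only: infinity_ennreal_def top.not_eq_extremum\<close>)
  have inc': "AE \<omega> in Q (Some x). \<forall>n t. X t \<omega> \<noteq> None \<longrightarrow> W n t \<omega> \<le> W (Suc n) t \<omega>"
    unfolding AE_all_countable using inc by (intro allI)
  have killed_W: "killed_resolvent X P (A n) \<eta> x = integral\<^sup>N (Q (Some x)) (?u n)" for n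
    unfolding killed_resolvent_def
  proof (rule nn_integral_cong_AE)
    show "AE \<omega> in Q (Some x). (\<integral>\<^sup>+t\<in>{t. 0 \<le> t \<and> ennreal t < lifetime X \<omega>}.
        exp_neg (A n (ennreal t) \<omega>) * extend_zero \<eta> (X (ennreal t) \<omega>) \<partial>lborel) = ?u n \<omega>"
      using A[of n] by eventually_elim (intro nn_integral_cong, simp add: alive)
  qed
  have killed_B: "killed_resolvent X P B \<eta> x = integral\<^sup>N (Q (Some x)) ?v"
    unfolding killed_resolvent_def
  proof (rule nn_integral_cong_AE)
    show "AE \<omega> in Q (Some x). (\<integral>\<^sup>+t\<in>{t. 0 \<le> t \<and> ennreal t < lifetime X \<omega>}.
        exp_neg (B (ennreal t) \<omega>) * extend_zero \<eta> (X (ennreal t) \<omega>) \<partial>lborel) = ?v \<omega>"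
      using B
    proof eventually_elim
      case (elim \<omega>)
      show ?case
      proof (rule nn_integral_cong)
        fix t :: real
        show "exp_neg (B (ennreal t) \<omega>) * extend_zero \<eta> (X (ennreal t) \<omega>) *
            indicator {t. 0 \<le> t \<and> ennreal t < lifetime X \<omega>} t = exp_neg (SUP n. W n (ennreal t) \<omega>) * ?e t \<omega>"
        proof (cases "X (ennreal t) \<omega>")
          case None
          then show ?thesis by (simp add: extend_zero_def)
        next
          case (Some y)
          then have "B (ennreal t) \<omega> = (SUP n. W n (ennreal t) \<omega>)" using elim by blast
          then show ?thesis by (simp only: alive)
        qed
      qed
    qed
  qed
  have u_le: "?u n \<omega> \<le> ?D \<omega>" for n \<omega>
    using mult_right_mono[OF exp_neg_le_1] by (intro nn_integral_mono) fastforce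
  have lim: "AE \<omega> in Q (Some x). (\<lambda>n. ?u n \<omega>) \<longlonglongrightarrow> ?v \<omega>"
    using AE_D inc'
  proof eventually_elim
    case (elim \<omega>)
    have e_m: "(\<lambda>t. ?e t \<omega>) \<in> borel_measurable lborel" using section_m[OF em, of \<omega>] by simp
    \<comment> \<open>\<open>\<eta>\<close> may take the value \<open>\<infinity>\<close>, and
      multiplication by \<open>\<infinity>\<close> is not continuous at 0. Integrability confines
      this to a null set of times.\<close>
    have "AE t in lborel. ?e t \<omega> \<noteq> \<infinity>" by (rule nn_integral_PInf_AE[OF e_m elim(1)])
    then have "AE t in lborel. (\<lambda>n. exp_neg (W n (ennreal t) \<omega>) * ?e t \<omega>) \<longlonglongrightarrow>
        exp_neg (SUP n. W n (ennreal t) \<omega>) * ?e t \<omega>"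
    proof eventually_elim
      case (elim t)
      show ?case
      proof (cases "X (ennreal t) \<omega>")
        case None
        then show ?thesis by (simp add: extend_zero_def)
      next
        case (Some y)
        have "incseq (\<lambda>n. W n (ennreal t) \<omega>)"
          by (rule incseq_SucI) (use \<open>\<forall>n t. X t \<omega> \<noteq> None \<longrightarrow> W n t \<omega> \<le> W (Suc n) t \<omega>\<close> Some in blast)
        from exp_neg_tendsto_incseq[OF this]
        have "(\<lambda>n. ?e t \<omega> * exp_neg (W n (ennreal t) \<omega>)) \<longlonglongrightarrow> ?e t \<omega> * exp_neg (SUP n. W n (ennreal t) \<omega>)"
          by (rule ennreal_tendsto_cmult[rotated]) (use elim in \<open>simp only: infinity_ennreal_def top.not_eq_extremum\<close>)
        then show ?thesis by (simp only: mult.commute[of "exp_neg _"])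
      qed
    qed
    then show ?case
    proof (rule nn_integral_dominated_convergence[rotated 5])
      show "(\<lambda>t. exp_neg (W n (ennreal t) \<omega>) * ?e t \<omega>) \<in> borel_measurable lborel" for n
        using section_m[OF um[of n], of \<omega>] by simp
      show "(\<lambda>t. exp_neg (SUP n. W n (ennreal t) \<omega>) * ?e t \<omega>) \<in> borel_measurable lborel"
        using section_m[OF vm, of \<omega>] by simp
      show "(\<lambda>t. ?e t \<omega>) \<in> borel_measurable lborel" by (rule e_m)
      show "AE t in lborel. exp_neg (W n (ennreal t) \<omega>) * ?e t \<omega> \<le> ?e t \<omega>" for n
        using mult_right_mono[OF exp_neg_le_1] by (intro AE_I2) fastforce
      show "?D \<omega> < \<infinity>" using elim(1) by (simp only: infinity_ennreal_def top.not_eq_extremum)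
    qed
  qed
  have "(\<lambda>n. \<integral>\<^sup>+\<omega>. ?u n \<omega> \<partial>Q (Some x)) \<longlonglongrightarrow> integral\<^sup>N (Q (Some x)) ?v"
    by (rule nn_integral_dominated_convergence[OF uQ vQ DQ AE_I2[OF u_le] Dfin lim])
  then show ?thesis unfolding killed_W killed_B .
qed

end

theorem proposition4p6:
  fixes m :: "'a::{metric_space, second_countable_topology} measure"
    and A :: "(('a \<Rightarrow> real) \<times> ('a \<Rightarrow> real)) set"
    and T :: "real \<Rightarrow> ('a \<Rightarrow> real) \<Rightarrow> ('a \<Rightarrow> real)"
    and D :: "('a \<Rightarrow> real) set"
    and \<E> :: "('a \<Rightarrow> real) \<Rightarrow> ('a \<Rightarrow> real) \<Rightarrow> real"
    and X :: "ennreal \<Rightarrow> 'w \<Rightarrow> 'a option"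
    and P :: "'a option \<Rightarrow> 'w measure"
    and \<theta> :: "ennreal \<Rightarrow> 'w \<Rightarrow> 'w"
    and G :: "'a \<Rightarrow> 'a \<Rightarrow> ennreal"
    and \<nu> :: "'a measure" and \<nu>s :: "nat \<Rightarrow> 'a measure"
    and A\<nu> :: "ennreal \<Rightarrow> 'w \<Rightarrow> ennreal"
    and A\<nu>s :: "nat \<Rightarrow> ennreal \<Rightarrow> 'w \<Rightarrow> ennreal"
    and \<eta> :: "'a \<Rightarrow> ennreal"
  assumes "dirichlet_hunt_setting m A T D \<E> X P \<theta> G"
    and "smooth_measure m D \<E> \<nu>"
    and "\<And>n. strictly_smooth_measure m D \<E> G (\<nu>s n)"
    and "measures_increase_to \<nu>s \<nu>"
    and "\<And>n. strict_pcaf_of X P \<theta> G (\<nu>s n) (A\<nu>s n)"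
    and "pcaf_of_smooth m D \<E> X P \<theta> G \<nu> A\<nu>"
    and "\<eta> \<in> borel_measurable borel"
    and "\<exists>c::real. \<forall>x. resolvent X P 0 \<eta> x \<le> ennreal c"
  shows "\<forall>x. (\<lambda>n. killed_resolvent X P (A\<nu>s n) \<eta> x) \<longlonglongrightarrow> killed_resolvent X P A\<nu> \<eta> x"
proof
  fix x
  interpret hunt X P \<theta>
    using assms(1) by unfold_locales (simp_all add: dirichlet_hunt_setting_def)
  have G: "G x \<in> borel_measurable borel" for x
    using assms(1) unfolding dirichlet_hunt_setting_def green_function_def excessive_def by simp
  obtain \<beta>s Vs where \<beta>s: "\<forall>n::nat. strictly_smooth_measure m D \<E> G (\<beta>s n)" "measures_increase_to \<beta>s \<nu>"
    and Vs: "\<forall>n. strict_pcaf_of X P \<theta> G (\<beta>s n) (Vs n)" and A\<nu>: "\<forall>t \<omega>. A\<nu> t \<omega> = (SUP n. Vs n t \<omega>)"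
    using assms(6) unfolding pcaf_of_smooth_def by (elim exE conjE)
  \<comment> \<open>Regular versions for both sequences, the given one and the one behind
    \<open>A\<nu>\<close>. The choice does not depend on the starting point, as agreement holds from
    every point.\<close>
  define rep where "rep \<beta> V = (SOME V'. regular_af_of G \<beta> V' \<and>
    (\<forall>x. AE \<omega> in Q (Some x). \<forall>t<\<infinity>. V' t \<omega> = V t \<omega>))" for \<beta> V
  have rep: "regular_af_of G \<beta> (rep \<beta> V)" "AE \<omega> in Q (Some x). \<forall>t<\<infinity>. rep \<beta> V t \<omega> = V t \<omega>"
    if "strict_pcaf_of X P \<theta> G \<beta> V" for \<beta> V x
    using someI_ex[OF strict_pcaf_of_regularization[OF that]] unfolding rep_def
    by (rule conjunct1, elim conjE allE)
  define W where "W n = rep (\<nu>s n) (A\<nu>s n)" for n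
  define V' where "V' n = rep (\<beta>s n) (Vs n)" for n
  have W: "regular_af_of G (\<nu>s n) (W n)" "AE \<omega> in Q (Some x). \<forall>t<\<infinity>. W n t \<omega> = A\<nu>s n t \<omega>" for n
    unfolding W_def by (rule rep[OF assms(5)])+
  have V': "regular_af_of G (\<beta>s n) (V' n)" "AE \<omega> in Q (Some x). \<forall>t<\<infinity>. V' n t \<omega> = Vs n t \<omega>" for n
    unfolding V'_def by (rule rep[OF Vs[rule_format]])+
  have smooth: "smooth_measure m D \<E> \<mu>" "sets \<mu> = sets borel" if "strictly_smooth_measure m D \<E> G \<mu>" for \<mu>
    using that by (simp_all add: strictly_smooth_measure_def smooth_measure_def)
  note le = strictly_smooth_af_le_SUP[where G = G and m = m and D = D and \<E> = \<E>, OF G]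
  have inc: "AE \<omega> in Q (Some x). \<forall>t. X t \<omega> \<noteq> None \<longrightarrow> W n t \<omega> \<le> W (Suc n) t \<omega>" for n
  proof -
    \<comment> \<open>Monotonicity in \<open>n\<close> is the comparison lemma with
      \<open>\<nu>s (Suc n)\<close> as the dominating measure and the constant sequence increasing
      to it.\<close>
    have "AE \<omega> in Q (Some x). \<forall>t. X t \<omega> \<noteq> None \<longrightarrow> W n t \<omega> \<le> (SUP k. (\<lambda>_::nat. W (Suc n)) k t \<omega>)"
      by (rule le[where V = "W n" and \<beta> = "\<nu>s n" and W = "\<lambda>_. W (Suc n)" and \<gamma> = "\<lambda>_. \<nu>s (Suc n)",
            OF W(1) W(1) smooth(1)[OF assms(3)] smooth(2)[OF assms(3)]
            measures_increase_to_le(2)[OF assms(4)] assms(3) measures_increase_to_const])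
    then show ?thesis by simp
  qed
  \<comment> \<open>Two sequences of measures with the same limit interlace: each functional of one
    is below the supremum over the other. Hence the suprema coincide, whichever sequence defines
    \<open>A\<nu>\<close>.\<close>
  have VW: "AE \<omega> in Q (Some x). \<forall>n t. X t \<omega> \<noteq> None \<longrightarrow> V' n t \<omega> \<le> (SUP k. W k t \<omega>)"
    unfolding AE_all_countable
    by (intro allI le[where W = W and \<gamma> = \<nu>s, OF V'(1) W(1) assms(2) smooth(2)[OF \<beta>s(1)[rule_format]]
          measures_increase_to_le(1)[OF \<beta>s(2)] assms(3,4)])
  have WV: "AE \<omega> in Q (Some x). \<forall>n t. X t \<omega> \<noteq> None \<longrightarrow> W n t \<omega> \<le> (SUP k. V' k t \<omega>)"
    unfolding AE_all_countable
    by (intro allI le[where W = V' and \<gamma> = \<beta>s, OF W(1) V'(1) assms(2) smooth(2)[OF assms(3)]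
          measures_increase_to_le(1)[OF assms(4)] \<beta>s(1)[rule_format] \<beta>s(2)])
  have VV: "AE \<omega> in Q (Some x). \<forall>n. \<forall>t<\<infinity>. V' n t \<omega> = Vs n t \<omega>"
    unfolding AE_all_countable by (intro allI V'(2))
  have B: "AE \<omega> in Q (Some x). \<forall>t. X t \<omega> \<noteq> None \<longrightarrow> A\<nu> t \<omega> = (SUP n. W n t \<omega>)"
    using VW WV VV
  proof eventually_elim
    case (elim \<omega>)
    show ?case
    proof (intro allI impI)
      fix t assume t: "X t \<omega> \<noteq> None"
      then have "t < \<infinity>" using X_infinity[of \<omega>] by (cases t) auto
      then have "A\<nu> t \<omega> = (SUP n. V' n t \<omega>)" using elim(3) A\<nu> by simp
      also have "\<dots> = (SUP n. W n t \<omega>)"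
        by (rule antisym; rule SUP_least) (use elim(1,2) t in blast)+
      finally show "A\<nu> t \<omega> = (SUP n. W n t \<omega>)" .
    qed
  qed
  have AW: "AE \<omega> in Q (Some x). \<forall>t<\<infinity>. A\<nu>s n t \<omega> = W n t \<omega>" for n
    using W(2)[of n] by eventually_elim simp
  obtain c :: real where c: "\<forall>x. resolvent X P 0 \<eta> x \<le> ennreal c" using assms(8) by (rule exE)
  have "resolvent X P 0 \<eta> x < \<infinity>"
    using le_less_trans[OF c[rule_format] ennreal_less_top] by simp
  from killed_resolvent_tendsto[OF regular_af_ofD(1)[OF W(1)] AW inc B assms(7) this]
  show "(\<lambda>n. killed_resolvent X P (A\<nu>s n) \<eta> x) \<longlonglongrightarrow> killed_resolvent X P A\<nu> \<eta> x" .
qed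

end
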